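(* Let $u_h$ be the numerical solution of the stabilized GRP method. Assume that (i) $|u_h|\le\overline u$ with a constant $\overline u$ uniform for $\Delta t,h\to0$, and (ii) $(\Delta t,h)\in(0,1]^2$ and $\Delta t\le C_2h^{4/3}$ with a constant $C_2$ independent of $\Delta t$ and $h$. Then for all $\tau\in(0,T)$ and all $\phi\in W^{2,\infty}((0,T)\times\mathbb T^d)$, $$\Big[\int_{\mathbb T^d}u_h\phi\,dx\Big]_{t=0}^{t=\tau}=\int_0^\tau\int_{\mathbb T^d}\Big(u_h\partial_t\phi+f(u_h)\sum_{i=1}^d\partial_{x_i}\phi\Big)dx\,dt+e_u(\phi,h,\tau),$$ where the consistency error satisfies $|e_u(\phi,h,\tau)|\le C_uh^{1/3}$, and the constant $C_u$ depends solely on $T$ and $\|\phi\|_{W^{2,\infty}((0,T)\times\mathbb T^d)}$ (the domain, $d$, $C_1$, $C_2$ and $\overline u$ being fixed); in particular it is independent of $h$, $\Delta t$ and $\tau$.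
   Context: **Setting.** $d\in\{2,3\}$, $T>0$, $\mathbb T^d$ is a flat torus (bounded periodic domain), $f(u)=u^2/2$, $u_0\in L^\infty(\mathbb T^d)$. **Mesh.** $\mathbb T^d$ is partitioned into a uniform mesh $\mathcal T_h$ of cubes (squares if $d=2$) $K$ of side $h$, with centers $x_K$, $|K|=h^d$. $\mathcal E$ is the set of faces, $\mathcal E_i$ the faces orthogonal to the basis vector $e_i$, $\mathcal E(K)$ and $\mathcal E_i(K)$ the corresponding faces of $K$; a face $\sigma$ has center $x_\sigma$ and measure $|\sigma|=h^{d-1}$. $\int_{\mathcal E}g\,dS:=\sum_{\sigma\in\mathcal E}\int_\sigma g\,dS$. $Q_h$ is the space of functions constant on each cell ($r_K$ is the value on $K$), and $\Pi_Q\phi|_K=\frac1{|K|}\int_K\phi\,dx$. For $\sigma=K|L\in\mathcal E_i$, with $L$ the neighbour of $K$ in direction $+e_i$, and a piecewise linear $v$: $v_\sigma^\pm=\lim_{\delta\to0+}v(x_\sigma\pm\delta e_i)$, average $\{\{v\}\}_\sigma=(v_\sigma^++v_\sigma^-)/2$, jump $[[v]]_\sigma=v_\sigma^+-v_\sigma^-$ (so $[[r]]_\sigma=r_L-r_K$ for $r\in Q_h$). **Reconstruction (minmod).** For $r\in Q_h$, with $s_1,s_2$ the two numbers $[[r]]_\sigma/h$, $\sigma\in\mathcal E_i(K)$: $(\nabla_h^{(i)}r)_K=\min(s_1,s_2)$ if $s_1,s_2>0$, $=\max(s_1,s_2)$ if $s_1,s_2<0$, and $=0$ otherwise. $R_Vr(x)=r_K+(x-x_K)\cdot(\nabla_hr)_K$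 for $x\in K$, and $\mathrm{div}_h(r)_K:=\sum_{j=1}^d(\nabla_h^{(j)}r)_K$. **Cases at a face $\sigma$ (with $r=R_Vu_h$).** Case 1: $[[r]]<0,\{\{r\}\}>0$. Case 2: $[[r]]<0,\{\{r\}\}\le0$. Case 3: $0<r_\sigma^-\le r_\sigma^+$. Case 4: $r_\sigma^-\le0\le r_\sigma^+$. Case 5: $r_\sigma^-\le r_\sigma^+<0$. **GRP flux.** $f_\sigma^{GRP}=\frac12|(R_Vu_h)_\sigma^-|^2\big(1-\Delta t\,(\mathrm{div}_hu_h)_\sigma^-\big)$ in Cases 1, 3; $\frac12|(R_Vu_h)_\sigma^+|^2\big(1-\Delta t\,(\mathrm{div}_hu_h)_\sigma^+\big)$ in Cases 2, 5; $0$ in Case 4. **Stabilized GRP method.** Fix a constant $C_1\in(0,1/24]$ independent of $\Delta t,h$, and put $f_\sigma^{GRP,New}=f_\sigma^{GRP}$ if $[[u_h]]_\sigma\ge0$, $f_\sigma^{GRP,New}=f_\sigma^{GRP}+(\frac1{24}+C_1)[[u_h]]_\sigma^2$ if $[[u_h]]_\sigma<0$. With $\Delta t=T/N_T$, $t_k=k\Delta t$, the numerical solution $u_h$ takes values in $Q_h$, is constant in time on each $[t_k,t_{k+1})$, satisfies $u_h(0,\cdot)=\Pi_Qu_0$, and at each time level $$\int_{\mathbb T^d}\phi_hD_tu_h\,dx-\int_{\mathcal E}f_\sigma^{GRP,New}[[\phi_h]]\,dS=0\quad\forall\phi_h\in Q_h,\qquad D_tv(t)=\frac{v(t+\Delta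 t)-v(t)}{\Delta t}.$$ All flux quantities are evaluated at time $t$. *)

theory Defs
  imports "HOL-Analysis.Analysis" "HOL-Probability.Essential_Supremum"
begin

text \<open>
  The torus is \<open>\<real>\<^sup>d / (l\<^sub>1\<int> \<times> \<dots> \<times> l\<^sub>d\<int>)\<close> with \<open>d = CARD('n)\<close> and arbitrary side lengths \<open>l $ i > 0\<close>.
  Functions on it are periodic functions on \<^typ>\<open>real ^ 'n\<close>; integrals over it are integrals over
  the fundamental domain \<open>cbox 0 l\<close>.
\<close>

definition periodic :: "real ^ 'n \<Rightarrow> (real ^ 'n \<Rightarrow> 'b) \<Rightarrow> bool" where
  "periodic l g \<longleftrightarrow> (\<forall>x i. g (x + axis i (l $ i)) = g x)"

definition burgers :: "real \<Rightarrow> real" where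
  "burgers u = u\<^sup>2 / 2"


section \<open>Sobolev spaces \<open>W\<^sup>m\<^sup>,\<^sup>\<infinity>((0,T) \<times> \<T>\<^sup>d)\<close>\<close>

definition Linf :: "'a measure \<Rightarrow> ('a \<Rightarrow> real) set" where
  "Linf M = {g \<in> borel_measurable M. esssup M (\<lambda>z. ereal \<bar>g z\<bar>) < \<infinity>}"

definition Linf_norm :: "'a measure \<Rightarrow> ('a \<Rightarrow> real) \<Rightarrow> real" where
  "Linf_norm M g = real_of_ereal (esssup M (\<lambda>z. ereal \<bar>g z\<bar>))"

primrec Ck :: "nat \<Rightarrow> ('a::euclidean_space \<Rightarrow> real) \<Rightarrow> bool" where
  "Ck 0 g \<longleftrightarrow> continuous_on UNIV g"
| "Ck (Suc m) g \<longleftrightarrow>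
    (\<exists>g'. (\<forall>z. (g has_derivative g' z) (at z)) \<and> (\<forall>v. Ck m (\<lambda>z. g' z v)))"

text \<open>\<open>C\<^sub>c\<^sup>\<infinity>((0,T) \<times> \<T>\<^sup>d)\<close>: the torus being compact, only the support in time is restricted.\<close>

definition test_functions :: "real \<Rightarrow> real ^ 'n \<Rightarrow> (real \<times> (real ^ 'n) \<Rightarrow> real) set" where
  "test_functions T l = {\<psi>. (\<forall>m. Ck m \<psi>) \<and> (\<forall>t. periodic l (\<lambda>x. \<psi> (t, x))) \<and>
     (\<exists>a b. 0 < a \<and> b < T \<and> (\<forall>t x. t \<notin> {a..b} \<longrightarrow> \<psi> (t, x) = 0))}"

primrec iter_deriv :: "'a list \<Rightarrow> ('a::euclidean_space \<Rightarrow> real) \<Rightarrow> 'a \<Rightarrow> real" where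
  "iter_deriv [] g = g"
| "iter_deriv (v # \<alpha>) g = (\<lambda>z. frechet_derivative (iter_deriv \<alpha> g) (at z) v)"

definition spacetime :: "real \<Rightarrow> real ^ 'n \<Rightarrow> (real \<times> (real ^ 'n)) measure" where
  "spacetime T l = lebesgue_on ({0<..<T} \<times> cbox 0 l)"

text \<open>
  A multi-index is a list \<open>\<alpha>\<close> of coordinate directions of \<^typ>\<open>real \<times> (real ^ 'n)\<close>, of order
  \<open>length \<alpha>\<close>; mixed derivatives are listed once for every ordering.
\<close>

definition is_weak_deriv ::
  "real \<Rightarrow> real ^ 'n \<Rightarrow> (real \<times> (real ^ 'n)) list \<Rightarrow> (real \<times> (real ^ 'n) \<Rightarrow> real) \<Rightarrow>
    (real \<times> (real ^ 'n) \<Rightarrow> real) \<Rightarrow> bool" where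
  "is_weak_deriv T l \<alpha> \<phi> g \<longleftrightarrow> (\<forall>\<psi> \<in> test_functions T l.
     integral\<^sup>L (spacetime T l) (\<lambda>z. \<phi> z * iter_deriv \<alpha> \<psi> z)
       = (- 1) ^ length \<alpha> * integral\<^sup>L (spacetime T l) (\<lambda>z. g z * \<psi> z))"

text \<open>Some representative of the weak derivative, which is unique up to null sets.\<close>

definition weak_deriv ::
  "real \<Rightarrow> real ^ 'n \<Rightarrow> (real \<times> (real ^ 'n)) list \<Rightarrow> (real \<times> (real ^ 'n) \<Rightarrow> real) \<Rightarrow>
    (real \<times> (real ^ 'n) \<Rightarrow> real)" where
  "weak_deriv T l \<alpha> \<phi> = (SOME g. g \<in> Linf (spacetime T l) \<and> is_weak_deriv T l \<alpha> \<phi> g)"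

definition multi_indices :: "nat \<Rightarrow> 'a::euclidean_space list set" where
  "multi_indices m = {\<alpha>. set \<alpha> \<subseteq> Basis \<and> length \<alpha> \<le> m}"

definition Winf :: "nat \<Rightarrow> real \<Rightarrow> real ^ 'n \<Rightarrow> (real \<times> (real ^ 'n) \<Rightarrow> real) set" where
  "Winf m T l = {\<phi> \<in> Linf (spacetime T l).
     (\<forall>t \<in> {0<..<T}. periodic l (\<lambda>x. \<phi> (t, x))) \<and>
     (\<forall>\<alpha> \<in> multi_indices m. \<exists>g \<in> Linf (spacetime T l). is_weak_deriv T l \<alpha> \<phi> g)}"

definition Winf_norm :: "nat \<Rightarrow> real \<Rightarrow> real ^ 'n \<Rightarrow> (real \<times> (real ^ 'n) \<Rightarrow> real) \<Rightarrow> real" where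
  "Winf_norm m T l \<phi> =
     Max ((\<lambda>\<alpha>. Linf_norm (spacetime T l) (weak_deriv T l \<alpha> \<phi>)) ` multi_indices m)"

abbreviation weak_dt ::
  "real \<Rightarrow> real ^ 'n \<Rightarrow> (real \<times> (real ^ 'n) \<Rightarrow> real) \<Rightarrow> (real \<times> (real ^ 'n) \<Rightarrow> real)" where
  "weak_dt T l \<phi> \<equiv> weak_deriv T l [(1, 0)] \<phi>"

abbreviation weak_dx ::
  "real \<Rightarrow> real ^ 'n \<Rightarrow> 'n \<Rightarrow> (real \<times> (real ^ 'n) \<Rightarrow> real) \<Rightarrow> (real \<times> (real ^ 'n) \<Rightarrow> real)" where
  "weak_dx T l i \<phi> \<equiv> weak_deriv T l [(0, axis i 1)] \<phi>"


section \<open>Mesh, discrete functions and traces\<close>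

text \<open>
  Coordinates are chosen such that the origin is a mesh vertex. The cube with lower corner
  \<open>h k\<close> is named by \<open>k \<in> \<int>\<^sup>d\<close>; \<open>mesh l h\<close> contains one representative of each cell of the torus.
  The pair \<open>(k, i)\<close> names the face orthogonal to \<open>e\<^sub>i\<close> between \<open>k\<close> and its neighbour \<open>k + e\<^sub>i\<close>,
  so the two faces of \<open>k\<close> orthogonal to \<open>e\<^sub>i\<close> are \<open>(k, i)\<close> and \<open>(k - e\<^sub>i, i)\<close>.
\<close>

definition uniform_mesh :: "real ^ 'n \<Rightarrow> real \<Rightarrow> bool" where
  "uniform_mesh l h \<longleftrightarrow> 0 < h \<and> (\<forall>i. \<exists>m::nat. 0 < m \<and> l $ i = real m * h)"

definition mesh :: "real ^ 'n \<Rightarrow> real \<Rightarrow> (int ^ 'n) set" where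
  "mesh l h = {k. \<forall>i. 0 \<le> k $ i \<and> h * of_int (k $ i) < l $ i}"

definition faces :: "real ^ 'n \<Rightarrow> real \<Rightarrow> ((int ^ 'n) \<times> 'n) set" where
  "faces l h = mesh l h \<times> UNIV"

definition cell :: "real \<Rightarrow> int ^ 'n \<Rightarrow> (real ^ 'n) set" where
  "cell h k = {x. \<forall>i. h * of_int (k $ i) \<le> x $ i \<and> x $ i < h * (of_int (k $ i) + 1)}"

definition cell_center :: "real \<Rightarrow> int ^ 'n \<Rightarrow> real ^ 'n" where
  "cell_center h k = (\<chi> i. h * (of_int (k $ i) + 1 / 2))"

text \<open>The \<open>k\<close> with \<open>x \<in> cell h k\<close>.\<close>

definition cell_index :: "real \<Rightarrow> real ^ 'n \<Rightarrow> int ^ 'n" where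
  "cell_index h x = (\<chi> i. \<lfloor>x $ i / h\<rfloor>)"

definition face_center :: "real \<Rightarrow> (int ^ 'n) \<times> 'n \<Rightarrow> real ^ 'n" where
  "face_center h \<sigma> = cell_center h (fst \<sigma>) + axis (snd \<sigma>) (h / 2)"

definition Qh :: "real ^ 'n \<Rightarrow> real \<Rightarrow> (real ^ 'n \<Rightarrow> real) set" where
  "Qh l h = {r. periodic l r \<and> (\<forall>k. \<forall>x \<in> cell h k. r x = r (cell_center h k))}"

definition proj_Q :: "real \<Rightarrow> (real ^ 'n \<Rightarrow> real) \<Rightarrow> real ^ 'n \<Rightarrow> real" where
  "proj_Q h w x = (1 / h ^ CARD('n)) * integral\<^sup>L (lebesgue_on (cell h (cell_index h x))) w"

definition trace_plus :: "real \<Rightarrow> (real ^ 'n \<Rightarrow> real) \<Rightarrow> (int ^ 'n) \<times> 'n \<Rightarrow> real" where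
  "trace_plus h v \<sigma> = Lim (at_right 0) (\<lambda>\<delta>. v (face_center h \<sigma> + \<delta> *\<^sub>R axis (snd \<sigma>) 1))"

definition trace_minus :: "real \<Rightarrow> (real ^ 'n \<Rightarrow> real) \<Rightarrow> (int ^ 'n) \<times> 'n \<Rightarrow> real" where
  "trace_minus h v \<sigma> = Lim (at_right 0) (\<lambda>\<delta>. v (face_center h \<sigma> - \<delta> *\<^sub>R axis (snd \<sigma>) 1))"

definition avg :: "real \<Rightarrow> (real ^ 'n \<Rightarrow> real) \<Rightarrow> (int ^ 'n) \<times> 'n \<Rightarrow> real" where
  "avg h v \<sigma> = (trace_plus h v \<sigma> + trace_minus h v \<sigma>) / 2"

definition jump :: "real \<Rightarrow> (real ^ 'n \<Rightarrow> real) \<Rightarrow> (int ^ 'n) \<times> 'n \<Rightarrow> real" where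
  "jump h v \<sigma> = trace_plus h v \<sigma> - trace_minus h v \<sigma>"

text \<open>\<open>\<integral>\<^sub>E g dS\<close> for integrands that are constant on every face, such as \<open>f\<^sub>\<sigma> [[\<phi>\<^sub>h]]\<^sub>\<sigma>\<close>.\<close>

definition face_integral :: "real ^ 'n \<Rightarrow> real \<Rightarrow> ((int ^ 'n) \<times> 'n \<Rightarrow> real) \<Rightarrow> real" where
  "face_integral l h g = (\<Sum>\<sigma> \<in> faces l h. h ^ (CARD('n) - 1) * g \<sigma>)"


section \<open>Reconstruction and fluxes\<close>

definition minmod :: "real \<Rightarrow> real \<Rightarrow> real" where
  "minmod a b = (if a > 0 \<and> b > 0 then min a b else if a < 0 \<and> b < 0 then max a b else 0)"

definition slope :: "real \<Rightarrow> (real ^ 'n \<Rightarrow> real) \<Rightarrow> int ^ 'n \<Rightarrow> real ^ 'n" where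
  "slope h r k = (\<chi> i. minmod (jump h r (k - axis i 1, i) / h) (jump h r (k, i) / h))"

definition reconstruct :: "real \<Rightarrow> (real ^ 'n \<Rightarrow> real) \<Rightarrow> real ^ 'n \<Rightarrow> real" where
  "reconstruct h r x =
     (let k = cell_index h x
      in r (cell_center h k) + (x - cell_center h k) \<bullet> slope h r k)"

definition div_h :: "real \<Rightarrow> (real ^ 'n \<Rightarrow> real) \<Rightarrow> real ^ 'n \<Rightarrow> real" where
  "div_h h r x = (\<Sum>j \<in> UNIV. slope h r (cell_index h x) $ j)"

text \<open>
  The first branch consists of Cases 1 and 3, the second of Cases 2 and 5; what remains is
  Case 4, \<open>r\<^sup>- \<le> 0 \<le> r\<^sup>+\<close>.
\<close>

definition grp_flux :: "real \<Rightarrow> real \<Rightarrow> (real ^ 'n \<Rightarrow> real) \<Rightarrow> (int ^ 'n) \<times> 'n \<Rightarrow> real" where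
  "grp_flux h dt u \<sigma> =
     (let r = reconstruct h u; rm = trace_minus h r \<sigma>; rp = trace_plus h r \<sigma> in
      if jump h r \<sigma> < 0 \<and> avg h r \<sigma> > 0 \<or> 0 < rm \<and> rm \<le> rp
      then 1 / 2 * \<bar>rm\<bar>\<^sup>2 * (1 - dt * trace_minus h (div_h h u) \<sigma>)
      else if jump h r \<sigma> < 0 \<and> avg h r \<sigma> \<le> 0 \<or> rm \<le> rp \<and> rp < 0
      then 1 / 2 * \<bar>rp\<bar>\<^sup>2 * (1 - dt * trace_plus h (div_h h u) \<sigma>)
      else 0)"

definition grp_flux_new ::
  "real \<Rightarrow> real \<Rightarrow> real \<Rightarrow> (real ^ 'n \<Rightarrow> real) \<Rightarrow> (int ^ 'n) \<times> 'n \<Rightarrow> real" where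
  "grp_flux_new C1 h dt u \<sigma> =
     (if jump h u \<sigma> \<ge> 0 then grp_flux h dt u \<sigma>
      else grp_flux h dt u \<sigma> + (1 / 24 + C1) * (jump h u \<sigma>)\<^sup>2)"

text \<open>\<open>u\<close> is the stabilized GRP solution on \<open>[0, N dt]\<close>, i.e. up to the final time \<open>T = N dt\<close>.\<close>

definition stabilized_grp_solution ::
  "real ^ 'n \<Rightarrow> real \<Rightarrow> real \<Rightarrow> real \<Rightarrow> nat \<Rightarrow> (real ^ 'n \<Rightarrow> real) \<Rightarrow>
    (real \<Rightarrow> real ^ 'n \<Rightarrow> real) \<Rightarrow> bool" where
  "stabilized_grp_solution l C1 h dt N u0 u \<longleftrightarrow>
     (\<forall>t \<in> {0..real N * dt}. u t \<in> Qh l h) \<and>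
     (\<forall>k<N. \<forall>t \<in> {real k * dt..<real (Suc k) * dt}. u t = u (real k * dt)) \<and>
     u 0 = proj_Q h u0 \<and>
     (\<forall>k<N. let t = real k * dt in \<forall>\<phi> \<in> Qh l h.
        integral\<^sup>L (lebesgue_on (cbox 0 l)) (\<lambda>x. \<phi> x * ((u (t + dt) x - u t x) / dt))
          - face_integral l h (\<lambda>\<sigma>. grp_flux_new C1 h dt (u t) \<sigma> * jump h \<phi> \<sigma>) = 0)"

end

theory Submission
  imports Defs "HOL-Real_Asymp.Real_Asymp"
begin

text \<open>
  Write \<open>j\<close> for the jump of \<open>u\<^sub>h\<close> at a face. Testing the scheme with \<open>u\<^sub>h\<close> itself, the spatial terms
  dissipate: \<open>f\<^sub>\<sigma> j - [[u\<^sup>3]] / 6 \<le> - C\<^sub>1 |j|\<^sup>3\<close> up to the \<open>\<Delta>t\<close>-part of the flux, because minmod puts the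
  two traces on either side of the mean of the adjacent cell values. That part and the term
  \<open>\<Delta>t |D\<^sub>t u\<^sub>h|\<^sup>2\<close> of the explicit time step are both of size \<open>(\<Delta>t / h) j\<^sup>2 \<le> C\<^sub>2 h\<^sup>1\<^sup>/\<^sup>3 j\<^sup>2\<close>, which Young's
  inequality absorbs into \<open>|j|\<^sup>3 + h\<close>; so \<open>\<integral>\<integral> |j|\<^sup>3\<close> is bounded uniformly in \<open>h\<close> and \<open>\<Delta>t\<close>. Testing with
  the cell averages of \<open>\<phi>\<close> leaves a consistency error of size \<open>h |j|\<close>, and
  \<open>h |j| \<le> h\<^sup>1\<^sup>/\<^sup>3 (|j|\<^sup>3 + h)\<close>.

  On the side of \<open>\<phi>\<close> only box integrals of weak derivatives and second differences of \<open>\<phi>\<close> occur.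
  Pairing \<open>\<phi>\<close> with translates of a test function \<open>\<psi>\<close> and differentiating in the translation bounds
  them by the weak derivatives, and \<open>\<psi>\<close> may then increase to the indicator of a box.
\<close>

section \<open>Analysis of \<open>\<phi>\<close>: translated test functions in place of
  mollification\<close>

section \<open>Smooth functions\<close>

text \<open>The potential difference \<open>(b ^ 3 - a ^ 3) / 6\<close> is the integral of
  \<open>u^2 / 2\<close> from \<open>a\<close> to \<open>b\<close>; the midpoint rule misses it by
  \<open>(b - a) ^ 3 / 24\<close>. As the traces straddle the midpoint, the upwind flux is at most
  the midpoint flux on an upward jump and at least that on a downward one. So 1/24 is exactly what a
  downward jump lacks, \<open>C1\<close> is the surplus, and \<open>C1 \<le> 1 / 24\<close> lets an
  upward jump dissipate at the same rate. With \<open>s = h powr (1 / 3)\<close> the assumptions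
  become \<open>h = s ^ 3\<close> and \<open>dt \<le> C2 * s ^ 4\<close>. Then
  \<open>dt / h \<le> C2 * s\<close>, and Young's inequality leaves a residue of order
  \<open>s ^ 3 = h\<close> per face, the order of the energy itself; this balance is where the
  exponents 4/3 and 1/3 come from. The obstacle on the side of \<open>\<phi>\<close> is that its
  weak derivatives are arbitrary representatives on an open time interval, which a mollification in
  time would leave. Forward translates of a test function only need room before \<open>T\<close>.
  Every complete time step before \<open>\<tau>\<close> has this room; the incomplete last one is
  bounded by its length.\<close>

lemma Ck_imp_continuous_on: "Ck m g \<Longrightarrow> continuous_on S g"
proof (cases m)
  case 0
  then show "Ck m g \<Longrightarrow> continuous_on S g" by (auto intro: continuous_on_subset)
next
  case (Suc n)
  assume "Ck m g"
  with Suc obtain g' where "\<And>z. (g has_derivative g' z) (at z)" by auto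
  then show ?thesis
    by (meson continuous_at_imp_continuous_on has_derivative_continuous)
qed

lemma Ck_SucD: "Ck (Suc m) g \<Longrightarrow> Ck m g"
proof (induction m arbitrary: g)
  case 0
  then show ?case using Ck_imp_continuous_on[of "Suc 0" g UNIV] by simp
next
  case (Suc m)
  then obtain g' where "\<And>z. (g has_derivative g' z) (at z)" "\<And>v. Ck (Suc m) (\<lambda>z. g' z v)"
    by auto
  with Suc.IH show ?case by (auto intro!: exI[of _ g'])
qed

lemma Ck_const: "Ck m (\<lambda>_. c)"
  by (induction m arbitrary: c) (auto intro!: exI[of _ "\<lambda>_ _. 0"])

lemma Ck_bounded_linear: "bounded_linear f \<Longrightarrow> Ck m f"
proof (cases m)
  case 0
  then show "bounded_linear f \<Longrightarrow> Ck m f" by (simp add: linear_continuous_on)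
next
  case (Suc n)
  then show "bounded_linear f \<Longrightarrow> Ck m f"
    by (auto intro!: exI[of _ "\<lambda>_. f"] Ck_const bounded_linear_imp_has_derivative)
qed

lemma Ck_add: "Ck m f \<Longrightarrow> Ck m g \<Longrightarrow> Ck m (\<lambda>z. f z + g z)"
proof (induction m arbitrary: f g)
  case 0
  then show ?case by (simp add: continuous_on_add)
next
  case (Suc m)
  then obtain f' g' where
    "\<And>z. (f has_derivative f' z) (at z)" "\<And>v. Ck m (\<lambda>z. f' z v)"
    "\<And>z. (g has_derivative g' z) (at z)" "\<And>v. Ck m (\<lambda>z. g' z v)" by auto
  with Suc.IH show ?case
    by (auto intro!: exI[of _ "\<lambda>z v. f' z v + g' z v"] has_derivative_add)
qed

lemma Ck_mult: "Ck m f \<Longrightarrow> Ck m g \<Longrightarrow> Ck m (\<lambda>z. f z * g z)"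
proof (induction m arbitrary: f g)
  case 0
  then show ?case by (simp add: continuous_on_mult)
next
  case (Suc m)
  note cont = Suc.prems[THEN Ck_SucD]
  from Suc.prems obtain f' g' where
    "\<And>z. (f has_derivative f' z) (at z)" "\<And>v. Ck m (\<lambda>z. f' z v)"
    "\<And>z. (g has_derivative g' z) (at z)" "\<And>v. Ck m (\<lambda>z. g' z v)" by auto
  with Suc.IH cont show ?case
    by (auto intro!: exI[of _ "\<lambda>z v. f z * g' z v + f' z v * g z"] has_derivative_mult Ck_add)
qed

lemma Ck_compose:
  fixes f :: "real \<Rightarrow> real"
  shows "Ck m f \<Longrightarrow> Ck m g \<Longrightarrow> Ck m (\<lambda>z. f (g z))"
proof (induction m arbitrary: f)
  case 0
  then show ?case by (auto intro: continuous_on_compose2[of UNIV f UNIV g])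
next
  case (Suc m)
  note cont = Suc.prems(2)[THEN Ck_SucD]
  from Suc.prems obtain f' g' where
    f: "\<And>z. (f has_derivative f' z) (at z)" "\<And>v. Ck m (\<lambda>z. f' z v)" and
    g: "\<And>z. (g has_derivative g' z) (at z)" "\<And>v. Ck m (\<lambda>z. g' z v)" by auto
  \<comment> \<open>A linear map on the reals is multiplication by its value at 1. This turns the
    chain rule into a product, to which \<open>Ck_mult\<close> and the induction hypothesis
    apply.\<close>
  have "f' y v = f' y 1 * v" for y v
  proof -
    have "f' y (v *\<^sub>R 1) = v *\<^sub>R f' y 1"
      using f(1)[of y] by (meson has_derivative_linear linear_scale)
    then show ?thesis by simp
  qed
  then have "(\<lambda>z. f' (g z) (g' z v)) = (\<lambda>z. f' (g z) 1 * g' z v)" for v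
    by (intro ext) metis
  moreover have "Ck m (\<lambda>z. f' (g z) 1 * g' z v)" for v
    by (intro Ck_mult g Suc.IH[of "\<lambda>z. f' z 1"] f cont)
  moreover have "((\<lambda>z. f (g z)) has_derivative (\<lambda>v. f' (g z) (g' z v))) (at z)" for z
    using has_derivative_compose[OF g(1)[of z] f(1)[of "g z"]] .
  ultimately show ?case by (auto intro!: exI[of _ "\<lambda>z v. f' (g z) (g' z v)"])
qed

lemma Ck_prod: "finite I \<Longrightarrow> (\<And>i. i \<in> I \<Longrightarrow> Ck m (f i)) \<Longrightarrow> Ck m (\<lambda>z. \<Prod>i\<in>I. f i z)"
  by (induction I rule: finite_induct) (auto intro: Ck_const Ck_mult)

lemma Ck_real_deriv:
  fixes f :: "real \<Rightarrow> real"
  assumes "\<And>x. (f has_real_derivative f' x) (at x)" "Ck m f'"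
  shows "Ck (Suc m) f"
  using assms by (auto simp: has_field_derivative_def intro!: exI[of _ "\<lambda>x. (*) (f' x)"] Ck_mult Ck_const)

lemma Ck_cos: "Ck m (cos :: real \<Rightarrow> real)"
proof -
  have "Ck m (sin :: real \<Rightarrow> real) \<and> Ck m (\<lambda>x::real. - sin x) \<and> Ck m (cos :: real \<Rightarrow> real)"
  proof (induction m)
    case 0
    then show ?case by (auto intro!: continuous_intros)
  next
    case (Suc m)
    have s: "Ck (Suc m) (sin :: real \<Rightarrow> real)"
      by (rule Ck_real_deriv[where f' = cos]) (use Suc in \<open>auto intro!: derivative_eq_intros\<close>)
    moreover have "Ck (Suc m) (cos :: real \<Rightarrow> real)"
      by (rule Ck_real_deriv[where f' = "\<lambda>x. - sin x"]) (use Suc in \<open>auto intro!: derivative_eq_intros\<close>)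
    moreover have "Ck (Suc m) (\<lambda>x::real. - sin x)"
      using Ck_mult[OF Ck_const s, of "-1"] by simp
    ultimately show ?case by simp
  qed
  then show ?thesis by simp
qed

text \<open>The polynomial factor closes the family under differentiation, so smoothness follows
  from one induction over all \<open>p\<close>. The case \<open>p = 1\<close> is the classical
  \<open>exp (- 1 / x)\<close>.\<close>

definition flat :: "real poly \<Rightarrow> real \<Rightarrow> real" where
  "flat p x = (if x > 0 then poly p (1 / x) * exp (- (1 / x)) else 0)"

lemma poly_mult_exp_minus_tendsto_0: "((\<lambda>y. poly p y * exp (- y)) \<longlongrightarrow> (0::real)) at_top"
proof -
  have "((\<lambda>y. coeff p i * (y ^ i / exp y)) \<longlongrightarrow> coeff p i * 0) at_top" for i
    by (intro tendsto_intros tendsto_power_div_exp_0)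
  then have "((\<lambda>y. \<Sum>i\<le>degree p. coeff p i * (y ^ i / exp y)) \<longlongrightarrow> (\<Sum>i\<le>degree p. 0)) at_top"
    by (intro tendsto_sum) simp
  then show ?thesis
    by (simp add: poly_altdef exp_minus sum_distrib_right divide_inverse mult.assoc)
qed

lemma flat_tendsto_0: "(flat p \<longlongrightarrow> 0) (at_right 0)"
proof -
  have "((\<lambda>x. poly p (inverse x) * exp (- inverse x)) \<longlongrightarrow> (0::real)) (at_right 0)"
    using filterlim_compose[OF poly_mult_exp_minus_tendsto_0 filterlim_inverse_at_top_right] .
  then show ?thesis
    by (rule Lim_transform_eventually)
       (auto simp: eventually_at_filter flat_def divide_inverse)
qed

text \<open>With \<open>y = 1 / x\<close> the derivative of \<open>p(y) exp(-y)\<close> is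
  \<open>y^2 (p(y) - p'(y)) exp(-y)\<close>. At 0 the right difference quotient is again flat, with
  the polynomial \<open>[:0, 1:] * p\<close>, and so tends to 0.\<close>

lemma flat_has_derivative:
  "(flat p has_real_derivative flat ([:0, 0, 1:] * (p - pderiv p)) x) (at x)"
proof (cases "x = 0")
  case True
  have "((\<lambda>y. flat p y / y) \<longlongrightarrow> 0) (at_right 0)"
    using flat_tendsto_0[of "[:0, 1:] * p"]
    by (rule Lim_transform_eventually) (auto simp: eventually_at_filter flat_def field_simps)
  moreover have "((\<lambda>y. flat p y / y) \<longlongrightarrow> 0) (at_left 0)"
    by (rule tendsto_eventually) (auto simp: eventually_at_filter flat_def)
  ultimately show ?thesis
    using True by (simp add: has_field_derivative_iff filterlim_at_split flat_def[of _ 0])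
next
  case False
  show ?thesis
  proof (cases "x > 0")
    case True
    have "((\<lambda>x. poly p (1 / x) * exp (- (1 / x))) has_real_derivative
        flat ([:0, 0, 1:] * (p - pderiv p)) x) (at x)"
      using True by (auto intro!: derivative_eq_intros simp: flat_def field_simps power2_eq_square)
    then show ?thesis
      by (rule has_field_derivative_transform_within_open[where S = "{0<..}"])
         (use True in \<open>auto simp: flat_def\<close>)
  next
    case neg: False
    have "((\<lambda>x. 0) has_real_derivative flat ([:0, 0, 1:] * (p - pderiv p)) x) (at x)"
      using neg by (simp add: flat_def)
    then show ?thesis
      by (rule has_field_derivative_transform_within_open[where S = "{..<0}"])
         (use neg False in \<open>auto simp: flat_def\<close>)
  qed
qed

lemma Ck_flat: "Ck m (flat p)"
proof (induction m arbitrary: p)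
  case 0
  show ?case
    using DERIV_isCont[OF flat_has_derivative] by (simp add: continuous_at_imp_continuous_on)
next
  case (Suc m)
  then show ?case using Ck_real_deriv flat_has_derivative by blast
qed

abbreviation "bump \<equiv> flat 1"

lemma bump_simps: "x \<le> 0 \<Longrightarrow> bump x = 0" "0 \<le> bump x" "bump x \<le> 1"
  by (auto simp: flat_def)

text \<open>For \<open>y > 0\<close> the offset \<open>c\<close> is lost against
  \<open>n * y\<close>; for \<open>y \<le> 0\<close> the argument is never positive and the sequence
  is constantly 0. The time factor of \<open>box_bump\<close> uses \<open>c = 1\<close>, the space
  factors \<open>c = 0\<close>.\<close>

lemma bump_tendsto:
  "(\<lambda>n. bump (real n * y - c)) \<longlonglongrightarrow> (if y > 0 then 1 else 0)" if "0 \<le> c"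
proof (cases "y > 0")
  case True
  then have lim: "filterlim (\<lambda>n. real n * y - c) at_top sequentially"
    by real_asymp
  have "(\<lambda>n. exp (- inverse (real n * y - c))) \<longlonglongrightarrow> exp (- 0)"
    by (intro tendsto_intros filterlim_compose[OF tendsto_inverse_0_at_top[OF filterlim_ident] lim])
  moreover have "eventually (\<lambda>n. real n * y - c > 0) sequentially"
    using lim unfolding filterlim_at_top_dense by blast
  ultimately show ?thesis
    using True by (auto elim!: Lim_transform_eventually eventually_mono simp: flat_def divide_inverse)
next
  case False
  then have "real n * y - c \<le> 0" for n
    using that by (smt (verit) mult_nonneg_nonpos of_nat_0_le_iff)
  then show ?thesis using False by (simp add: bump_simps)
qed

section \<open>Test functions and their translates\<close>

definition dirderiv :: "'a::euclidean_space \<Rightarrow> ('a \<Rightarrow> real) \<Rightarrow> 'a \<Rightarrow> real" where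
  "dirderiv v \<psi> = (\<lambda>z. frechet_derivative \<psi> (at z) v)"

definition shift :: "'a::euclidean_space \<Rightarrow> ('a \<Rightarrow> real) \<Rightarrow> 'a \<Rightarrow> real" where
  "shift v \<psi> = (\<lambda>z. \<psi> (z - v))"

text \<open>\<open>test_functions\<close> with the support interval as a parameter: a translation by
  \<open>v\<close> moves it by \<open>fst v\<close>, and whether it still lies in
  \<open>(0, T)\<close> has to be tracked.\<close>

definition torus_test :: "real ^ 'n \<Rightarrow> real \<Rightarrow> real \<Rightarrow> (real \<times> (real ^ 'n) \<Rightarrow> real) \<Rightarrow> bool" where
  "torus_test l a b \<psi> \<longleftrightarrow> (\<forall>m. Ck m \<psi>) \<and> (\<forall>t. periodic l (\<lambda>x. \<psi> (t, x))) \<and>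
     (\<forall>t x. t \<notin> {a..b} \<longrightarrow> \<psi> (t, x) = 0)"

lemma test_functionsI: "torus_test l a b \<psi> \<Longrightarrow> 0 < a \<Longrightarrow> b < T \<Longrightarrow> \<psi> \<in> test_functions T l"
  unfolding torus_test_def test_functions_def by blast

lemma smooth_has_derivative:
  assumes "\<forall>m. Ck m \<psi>"
  shows "(\<psi> has_derivative (\<lambda>v. dirderiv v \<psi> z)) (at z)"
proof -
  from assms have "Ck (Suc 0) \<psi>" by blast
  then obtain g' where "(\<psi> has_derivative g' z) (at z)" by auto
  then show ?thesis
    unfolding dirderiv_def using frechet_derivative_at by force
qed

lemma smooth_dirderiv:
  assumes "\<forall>m. Ck m \<psi>"
  shows "\<forall>m. Ck m (dirderiv v \<psi>)"
proof
  fix m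
  from assms have "Ck (Suc m) \<psi>" by blast
  then obtain g' where g': "\<And>z. (\<psi> has_derivative g' z) (at z)" "\<And>v. Ck m (\<lambda>z. g' z v)" by auto
  have "dirderiv v \<psi> = (\<lambda>z. g' z v)"
    unfolding dirderiv_def using frechet_derivative_at[OF g'(1)] by metis
  then show "Ck m (dirderiv v \<psi>)" using g'(2) by simp
qed

lemma smooth_continuous_on: "\<forall>m. Ck m \<psi> \<Longrightarrow> continuous_on S \<psi>"
  using Ck_imp_continuous_on by blast

lemma Ck_shift: "Ck m \<psi> \<Longrightarrow> Ck m (shift v \<psi>)"
  unfolding shift_def
proof (induction m arbitrary: \<psi>)
  case 0
  then show ?case
    by (auto intro!: continuous_on_compose2[of UNIV \<psi> UNIV "\<lambda>z. z - v"] continuous_intros)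
next
  case (Suc m)
  then obtain g' where g': "\<And>z. (\<psi> has_derivative g' z) (at z)" "\<And>v. Ck m (\<lambda>z. g' z v)" by auto
  have "((\<lambda>z. \<psi> (z - v)) has_derivative g' (z - v)) (at z)" for z
    by (rule has_derivative_compose[of "\<lambda>z. z - v" "\<lambda>w. w" z UNIV \<psi> "g' (z - v)"])
       (auto intro!: derivative_eq_intros g')
  with g' Suc.IH show ?case by (auto intro!: exI[of _ "\<lambda>z. g' (z - v)"])
qed

lemma dirderiv_shift:
  assumes "\<forall>m. Ck m \<psi>"
  shows "dirderiv w (shift v \<psi>) = shift v (dirderiv w \<psi>)"
proof
  fix z
  have "((\<lambda>z. \<psi> (z - v)) has_derivative (\<lambda>u. dirderiv u \<psi> (z - v))) (at z)"
    by (rule has_derivative_compose[of "\<lambda>z. z - v" "\<lambda>w. w" z UNIV \<psi>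
          "\<lambda>u. dirderiv u \<psi> (z - v)"])
       (auto intro!: derivative_eq_intros smooth_has_derivative assms)
  then show "dirderiv w (shift v \<psi>) z = shift v (dirderiv w \<psi>) z"
    unfolding shift_def dirderiv_def[of w "\<lambda>z. \<psi> (z - v)"]
    by (metis frechet_derivative_at)
qed

lemma torus_test_shift:
  "torus_test l a b \<psi> \<Longrightarrow> torus_test l (a + fst v) (b + fst v) (shift v \<psi>)"
  unfolding torus_test_def
proof (elim conjE, intro conjI allI impI)
  assume *: "\<forall>t. periodic l (\<lambda>x. \<psi> (t, x))"
  show "periodic l (\<lambda>x. shift v \<psi> (t, x))" for t
    unfolding periodic_def
  proof (intro allI)
    fix x i
    have "\<psi> (t - fst v, (x - snd v) + axis i (l $ i)) = \<psi> (t - fst v, x - snd v)"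
      using * unfolding periodic_def by blast
    then show "shift v \<psi> (t, x + axis i (l $ i)) = shift v \<psi> (t, x)"
      by (cases v) (simp add: shift_def algebra_simps)
  qed
next
  assume "\<forall>m. Ck m \<psi>" then show "Ck m (shift v \<psi>)" for m by (simp add: Ck_shift)
next
  assume *: "\<forall>t x. t \<notin> {a..b} \<longrightarrow> \<psi> (t, x) = 0"
  fix t x assume "t \<notin> {a + fst v..b + fst v}"
  then have "t - fst v \<notin> {a..b}" by auto
  then show "shift v \<psi> (t, x) = 0" using * by (cases v) (simp add: shift_def)
qed

text \<open>The shifted box is cut where the original one begins. The part that sticks out is moved
  by one period and fills exactly the part left free at the other end.\<close>

lemma integral_cbox_periodic_shift:
  fixes p :: "'a::euclidean_space \<Rightarrow> real"
  assumes p: "continuous_on UNIV p" and k: "k \<in> Basis"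
    and per: "\<And>z. p (z + L *\<^sub>R k) = p z" and s: "0 \<le> s" "s \<le> L" "b \<bullet> k - a \<bullet> k = L"
  shows "integral (cbox (a - s *\<^sub>R k) (b - s *\<^sub>R k)) p = integral (cbox a b) p"
proof -
  have int: "p integrable_on cbox c d" for c d
    by (rule integrable_continuous) (rule continuous_on_subset[OF p], simp)
  have A1: "cbox (a - s *\<^sub>R k) (b - s *\<^sub>R k) \<inter> {x. x \<bullet> k \<le> a \<bullet> k} = cbox (a - s *\<^sub>R k) (b - L *\<^sub>R k)"
    using s k by (fastforce simp: mem_box inner_diff_left inner_Basis split: if_splits)
  have A2: "cbox (a - s *\<^sub>R k) (b - s *\<^sub>R k) \<inter> {x. x \<bullet> k \<ge> a \<bullet> k} = cbox a (b - s *\<^sub>R k)"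
    using s k by (fastforce simp: mem_box inner_diff_left inner_Basis split: if_splits)
  have B1: "cbox a b \<inter> {x. x \<bullet> k \<le> b \<bullet> k - s} = cbox a (b - s *\<^sub>R k)"
    using s k by (fastforce simp: mem_box inner_diff_left inner_Basis split: if_splits)
  have B2: "cbox a b \<inter> {x. x \<bullet> k \<ge> b \<bullet> k - s} = cbox (a - s *\<^sub>R k + L *\<^sub>R k) b"
    using s k by (fastforce simp: mem_box inner_diff_left inner_add_left inner_Basis split: if_splits)
  have "integral (cbox (a - s *\<^sub>R k) (b - s *\<^sub>R k)) p =
      integral (cbox (a - s *\<^sub>R k) (b - L *\<^sub>R k)) p + integral (cbox a (b - s *\<^sub>R k)) p"
    using integral_split[OF int k, of "a - s *\<^sub>R k" "b - s *\<^sub>R k" "a \<bullet> k"] unfolding A1 A2 .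
  moreover have "integral (cbox a b) p =
      integral (cbox a (b - s *\<^sub>R k)) p + integral (cbox (a - s *\<^sub>R k + L *\<^sub>R k) b) p"
    using integral_split[OF int k, of a b "b \<bullet> k - s"] unfolding B1 B2 .
  moreover have "integral (cbox (a - s *\<^sub>R k) (b - L *\<^sub>R k)) p =
      integral (cbox (a - s *\<^sub>R k + L *\<^sub>R k) b) p"
    using integral_shift_cbox[of "a - s *\<^sub>R k + L *\<^sub>R k" "L *\<^sub>R k" b p] by (simp add: per)
  ultimately show ?thesis by simp
qed

text \<open>
  The locale hypotheses are those consequences of \<open>\<Phi> \<in> W\<^sup>2\<^sup>,\<^sup>\<infinity>\<close> that need no weak derivative
  to be written down.
\<close>

locale weakly_C11 =
  fixes T :: real and l :: "real ^ 'n" and M :: real and \<Phi> :: "real \<times> (real ^ 'n) \<Rightarrow> real"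
  assumes T_pos: "0 < T" and l_pos: "\<And>i. 0 < l $ i"
    and cont: "continuous_on UNIV \<Phi>" and per: "\<And>t. periodic l (\<lambda>x. \<Phi> (t, x))"
    and weak1: "\<And>v a b \<psi>. v \<in> Basis \<Longrightarrow> torus_test l a b \<psi> \<Longrightarrow> 0 < a \<Longrightarrow> b < T \<Longrightarrow>
      (\<And>z. 0 \<le> \<psi> z) \<Longrightarrow>
      \<bar>integral (cbox (0, 0) (T, l)) (\<lambda>z. \<Phi> z * dirderiv v \<psi> z)\<bar>
        \<le> M * integral (cbox (0, 0) (T, l)) \<psi>"
    and weak2: "\<And>v w a b \<psi>. v \<in> Basis \<Longrightarrow> w \<in> Basis \<Longrightarrow> torus_test l a b \<psi> \<Longrightarrow> 0 < a \<Longrightarrow> b < T \<Longrightarrow>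
      (\<And>z. 0 \<le> \<psi> z) \<Longrightarrow>
      \<bar>integral (cbox (0, 0) (T, l)) (\<lambda>z. \<Phi> z * dirderiv w (dirderiv v \<psi>) z)\<bar>
        \<le> M * integral (cbox (0, 0) (T, l)) \<psi>"
begin

definition pairing :: "(real \<times> (real ^ 'n) \<Rightarrow> real) \<Rightarrow> real" where
  "pairing \<psi> = integral (cbox (0, 0) (T, l)) (\<lambda>z. \<Phi> z * \<psi> z)"

text \<open>Differentiation under the integral sign hits only the smooth factor;
  \<open>\<Phi>\<close> is merely continuous.\<close>

lemma pairing_shift_deriv:
  assumes "\<forall>m. Ck m \<eta>"
  shows "((\<lambda>s. pairing (shift (s *\<^sub>R v) \<eta>)) has_real_derivative
      - pairing (shift (s *\<^sub>R v) (dirderiv v \<eta>))) (at s)"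
proof -
  have cont\<Phi>: "continuous_on S (\<lambda>x. \<Phi> (f x))" if "continuous_on S f" for S and f :: "'b::topological_space \<Rightarrow> _"
    by (rule continuous_on_compose2[OF cont that]) auto
  have cont\<eta>: "continuous_on S (\<lambda>x. \<eta> (f x))" if "continuous_on S f" for S and f :: "'b::topological_space \<Rightarrow> _"
    by (rule continuous_on_compose2[OF smooth_continuous_on[OF assms, of UNIV] that]) auto
  have contD\<eta>: "continuous_on S (\<lambda>x. dirderiv v \<eta> (f x))" if "continuous_on S f" for S and f :: "'b::topological_space \<Rightarrow> _"
    by (rule continuous_on_compose2[OF smooth_continuous_on[OF smooth_dirderiv[OF assms], of UNIV] that]) auto
  have "((\<lambda>s. integral (cbox (0, 0) (T, l)) (\<lambda>z. \<Phi> z * \<eta> (z - s *\<^sub>R v))) has_real_derivative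
      integral (cbox (0, 0) (T, l)) (\<lambda>z. \<Phi> z * - dirderiv v \<eta> (z - s *\<^sub>R v))) (at s within UNIV)"
  proof (rule leibniz_rule_field_derivative)
    fix s z
    have "((\<lambda>s. \<eta> (z - s *\<^sub>R v)) has_derivative (\<lambda>r. dirderiv (- r *\<^sub>R v) \<eta> (z - s *\<^sub>R v))) (at s)"
      by (rule has_derivative_compose[of "\<lambda>s. z - s *\<^sub>R v" "\<lambda>r. - r *\<^sub>R v" s UNIV \<eta>
            "\<lambda>u. dirderiv u \<eta> (z - s *\<^sub>R v)"])
         (auto intro!: derivative_eq_intros smooth_has_derivative assms)
    moreover have "dirderiv (- r *\<^sub>R v) \<eta> y = r * - dirderiv v \<eta> y" for r y
      using linear_scale[OF has_derivative_linear[OF smooth_has_derivative[OF assms, of y]], of "-r" v]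
      by simp
    ultimately have "((\<lambda>s. \<eta> (z - s *\<^sub>R v)) has_real_derivative - dirderiv v \<eta> (z - s *\<^sub>R v)) (at s)"
      by (simp only: has_field_derivative_def mult.commute[of _ "- dirderiv v \<eta> (z - s *\<^sub>R v)"])
    then show "((\<lambda>s. \<Phi> z * \<eta> (z - s *\<^sub>R v)) has_real_derivative
        \<Phi> z * - dirderiv v \<eta> (z - s *\<^sub>R v)) (at s within UNIV)"
      by (rule DERIV_cmult)
  qed (auto intro!: integrable_continuous continuous_intros cont\<Phi> cont\<eta> contD\<eta> simp: split_beta)
  then show ?thesis
    by (simp add: pairing_def shift_def)
qed

lemma pairing_shift_bound:
  assumes "\<forall>m. Ck m \<eta>" "0 \<le> r" "\<And>q. 0 \<le> q \<Longrightarrow> q \<le> r \<Longrightarrow> \<bar>pairing (dirderiv w (shift (q *\<^sub>R w) \<eta>))\<bar> \<le> K"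
  shows "\<bar>pairing (shift (r *\<^sub>R w) \<eta>) - pairing \<eta>\<bar> \<le> K * r"
proof -
  have "norm (pairing (shift (r *\<^sub>R w) \<eta>) - pairing (shift (0 *\<^sub>R w) \<eta>)) \<le> K * norm (r - 0)"
  proof (rule field_differentiable_bound)
    show "((\<lambda>r. pairing (shift (r *\<^sub>R w) \<eta>)) has_field_derivative
        - pairing (shift (q *\<^sub>R w) (dirderiv w \<eta>))) (at q within {0..r})" for q
      using pairing_shift_deriv[OF assms(1)] by (rule has_field_derivative_at_within)
  qed (use assms in \<open>auto simp: dirderiv_shift\<close>)
  then show ?thesis using assms by (simp add: shift_def)
qed

text \<open>A change of variables carries the translation over from \<open>\<psi>\<close> to
  \<open>c\<close>, but also moves the domain. In time this is undone by the support of
  \<open>\<psi>\<close>, in space by periodicity, for at most one period, hence the bound on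
  \<open>s\<close>.\<close>

lemma integral_shift_test:
  assumes c: "continuous_on UNIV c" "\<And>t. periodic l (\<lambda>x. c (t, x))"
    and \<psi>: "torus_test l a b \<psi>" and v: "v \<in> Basis" and s: "0 \<le> s" "\<And>i. v = (0, axis i 1) \<Longrightarrow> s \<le> l $ i"
    and ab: "0 \<le> a" "b + s * fst v \<le> T" "b \<le> T"
  shows "integral (cbox (0, 0) (T, l)) (\<lambda>z. c z * shift (s *\<^sub>R v) \<psi> z)
    = integral (cbox (0, 0) (T, l)) (\<lambda>z. c (z + s *\<^sub>R v) * \<psi> z)"
proof -
  define p where "p = (\<lambda>z. c (z + s *\<^sub>R v) * \<psi> z)"
  have sm: "\<forall>m. Ck m \<psi>" and per\<psi>: "\<And>t. periodic l (\<lambda>x. \<psi> (t, x))"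
    and supp: "\<And>t x. t \<notin> {a..b} \<Longrightarrow> \<psi> (t, x) = 0"
    using \<psi> by (auto simp: torus_test_def)
  have contp: "continuous_on UNIV p"
    unfolding p_def
    by (intro continuous_intros smooth_continuous_on[OF sm] continuous_on_compose2[OF c(1)]) auto
  have *: "integral (cbox (0, 0) (T, l)) (\<lambda>z. c z * shift (s *\<^sub>R v) \<psi> z) =
      integral (cbox ((0, 0) - s *\<^sub>R v) ((T, l) - s *\<^sub>R v)) p"
    using integral_shift_cbox[of "(0, 0)" "- s *\<^sub>R v" "(T, l)" p]
    using integral_shift_cbox[of "(0, 0) - s *\<^sub>R v" "- s *\<^sub>R v" "(T, l) - s *\<^sub>R v" p]
    by (simp add: p_def shift_def)
  from v consider "v = (1, 0)" | i where "v = (0, axis i 1)"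
    by (auto simp: Basis_prod_def Basis_vec_def)
  then have "integral (cbox ((0, 0) - s *\<^sub>R v) ((T, l) - s *\<^sub>R v)) p = integral (cbox (0, 0) (T, l)) p"
  proof cases
    case 1
    \<comment> \<open>All time intervals containing the support give the same integral; the shifted
      and the original domain are two instances.\<close>
    have eq: "integral (cbox (t1, 0) (t2, l)) p = integral (cbox (a, 0) (b, l)) p"
      if "t1 \<le> a" "b \<le> t2" for t1 t2
    proof -
      have "integral (cbox (t1, 0) (t2, l)) p =
          integral (cbox (t1, 0) (t2, l)) (\<lambda>z. if z \<in> cbox (a, 0) (b, l) then p z else 0)"
        using supp by (intro integral_cong) (force simp: p_def)
      also have "\<dots> = integral (cbox (a, 0) (b, l) \<inter> cbox (t1, 0) (t2, l)) p"
        by (rule integral_restrict_Int)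
      also have "cbox (a, 0) (b, l) \<inter> cbox (t1, 0) (t2, l) = cbox (a, 0) (b, l)"
        using that by auto
      finally show ?thesis .
    qed
    show ?thesis
      using eq[of "-s" "T - s"] eq[of 0 T] 1 s ab by simp
  next
    case (2 i)
    show ?thesis
    proof (rule integral_cbox_periodic_shift[OF contp v])
      fix z :: "real \<times> (real ^ 'n)"
      obtain t x where z: "z = (t, x)" by fastforce
      have eq: "l $ i *\<^sub>R axis i 1 = axis i (l $ i)"
        by (simp add: vec_eq_iff axis_def)
      show "p (z + l $ i *\<^sub>R v) = p z"
        using per\<psi>[of t] c(2)[of t, unfolded periodic_def, rule_format, of "x + s *\<^sub>R axis i 1" i]
        by (simp add: p_def z 2 periodic_def eq add_ac)
    qed (use s 2 in \<open>auto simp: inner_axis\<close>)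
  qed
  with * show ?thesis by (simp add: p_def)
qed

end

section \<open>Smooth approximation of box indicators\<close>

text \<open>Beyond \<open>pi\<close> the cosine increases again, but up to
  \<open>2 * pi - \<alpha>\<close> it does not exceed \<open>cos \<alpha>\<close>. This range is
  needed because a point of one period can be farther than half a period from the midpoint of the
  interval below.\<close>

lemma cos_gt_cos_iff:
  assumes "0 < \<alpha>" "\<alpha> \<le> pi" "0 \<le> \<theta>" "\<theta> \<le> 2 * pi - \<alpha>"
  shows "cos \<theta> > cos \<alpha> \<longleftrightarrow> \<theta> < \<alpha>"
proof (cases "\<theta> \<le> pi")
  case True
  then show ?thesis using assms cos_mono_less_eq by simp
next
  case False
  have "cos (2 * pi - \<theta>) \<le> cos \<alpha>"
    by (rule cos_monotone_0_pi_le) (use assms False in auto)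
  then show ?thesis using assms False by (simp add: cos_2pi_minus)
qed

text \<open>A cosine centred at the midpoint and cut at its value at both endpoints: a smooth
  periodic function of \<open>x\<close> whose positivity set within one period is the
  interval.\<close>

lemma interval_iff_cos:
  fixes L p q x :: real
  assumes "0 \<le> p" "p < q" "q \<le> L" "0 \<le> x" "x \<le> L"
  shows "cos (2 * pi * (x - (p + q) / 2) / L) > cos (pi * (q - p) / L) \<longleftrightarrow> p < x \<and> x < q"
proof -
  have L: "0 < L" using assms by linarith
  define y where "y = \<bar>x - (p + q) / 2\<bar>"
  have y: "y \<ge> 0" "2 * y \<le> 2 * L - (q - p)"
    using assms by (auto simp: y_def abs_if field_simps)
  have cos: "cos (2 * pi * (x - (p + q) / 2) / L) = cos (2 * pi * y / L)"
  proof (cases "x - (p + q) / 2 \<ge> 0")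
    case False
    then have "2 * pi * y / L = - (2 * pi * (x - (p + q) / 2) / L)"
      using L by (simp add: y_def field_simps)
    then show ?thesis by (metis cos_minus)
  qed (simp add: y_def)
  have "cos (2 * pi * y / L) > cos (pi * (q - p) / L) \<longleftrightarrow> 2 * pi * y / L < pi * (q - p) / L"
  proof (rule cos_gt_cos_iff)
    have "pi * (2 * y) \<le> pi * (2 * L - (q - p))"
      using y(2) by (intro mult_left_mono) auto
    then show "2 * pi * y / L \<le> 2 * pi - pi * (q - p) / L"
      using L by (simp add: field_simps)
    have "pi * (q - p) \<le> pi * L"
      using assms by (intro mult_left_mono) auto
    then show "pi * (q - p) / L \<le> pi"
      using L by (simp add: field_simps)
  qed (use assms L y in auto)
  also have "\<dots> \<longleftrightarrow> pi * (2 * y) < pi * (q - p)"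
    using L by (simp add: divide_less_cancel mult.assoc mult.left_commute)
  also have "\<dots> \<longleftrightarrow> p < x \<and> x < q"
    by (auto simp: y_def abs_if field_simps)
  finally show ?thesis unfolding cos .
qed

text \<open>
  Smooth periodic functions increasing to the indicator of the open box \<open>(t\<^sub>1,t\<^sub>2) \<times> (p,q)\<close>. The
  summand \<open>-1\<close> keeps their supports away from \<open>t\<^sub>1\<close> and \<open>t\<^sub>2\<close>.
\<close>

definition box_bump ::
  "real ^ 'n \<Rightarrow> real \<Rightarrow> real \<Rightarrow> real ^ 'n \<Rightarrow> real ^ 'n \<Rightarrow> nat \<Rightarrow> real \<times> (real ^ 'n) \<Rightarrow> real" where
  "box_bump l t1 t2 p q n z = bump (real n * ((fst z - t1) * (t2 - fst z)) - 1) *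
     (\<Prod>i\<in>UNIV. bump (real n * (cos (2 * pi * (snd z $ i - (p $ i + q $ i) / 2) / l $ i)
        - cos (pi * (q $ i - p $ i) / l $ i)) - 0))"

lemma box_bump_bounds: "0 \<le> box_bump l t1 t2 p q n z" "box_bump l t1 t2 p q n z \<le> 1"
  unfolding box_bump_def[abs_def]
  by (intro mult_nonneg_nonneg prod_nonneg ballI bump_simps)
     (intro mult_le_one prod_nonneg prod_le_1 ballI conjI bump_simps)

lemma box_bump_test:
  fixes l p q :: "real ^ 'n"
  assumes "t1 < t2" and l: "\<And>i. 0 < l $ i"
  obtains a b where "t1 < a" "b < t2" "torus_test l a b (box_bump l t1 t2 p q n)"
proof -
  \<comment> \<open>Where \<open>n * (t - t1) * (t2 - t) > 1\<close>, both distances exceed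
    \<open>c\<close>, since each of them is at most \<open>t2 - t1\<close>. \<open>Suc n\<close>
    keeps \<open>c\<close> positive for \<open>n = 0\<close>.\<close>
  define c where "c = 1 / (real (Suc n) * (t2 - t1))"
  have "torus_test l (t1 + c) (t2 - c) (box_bump l t1 t2 p q n)"
    unfolding torus_test_def
  proof (intro conjI allI impI)
    fix m
    have fst: "Ck m (\<lambda>z. fst z :: real)" and snd: "Ck m (\<lambda>z::real \<times> (real^'n). snd z $ i)" for i
      by (intro Ck_bounded_linear bounded_linear_fst bounded_linear_snd
          bounded_linear_compose[OF bounded_linear_vec_nth bounded_linear_snd])+
    have minus: "Ck m (\<lambda>z. f z - c)" "Ck m (\<lambda>z. c - f z)" if "Ck m f" for f :: "real \<times> (real^'n) \<Rightarrow> real" and c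
      using Ck_add[OF that Ck_const[of m "- c"]] Ck_add[OF Ck_const[of m c] Ck_mult[OF Ck_const[of m "-1"] that]]
      by simp_all
    have divide: "Ck m (\<lambda>z. f z / c)" if "Ck m f" for f :: "real \<times> (real^'n) \<Rightarrow> real" and c
      using Ck_mult[OF that Ck_const[of m "1/c"]] by simp
    have bump: "Ck m (\<lambda>z. bump (f z))" and cos: "Ck m (\<lambda>z. cos (f z))"
      if "Ck m f" for f :: "real \<times> (real^'n) \<Rightarrow> real"
      by (rule Ck_compose[OF Ck_flat that], rule Ck_compose[OF Ck_cos that])
    show "Ck m (box_bump l t1 t2 p q n)"
      unfolding box_bump_def[abs_def]
      by (intro Ck_mult Ck_prod bump cos minus divide fst snd Ck_const) auto
  next
    have "cos (2 * pi * (x + l $ i - y) / l $ i) = cos (2 * pi * (x - y) / l $ i)" for x y i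
    proof -
      have "2 * pi * (x + l $ i - y) / l $ i = 2 * pi * (x - y) / l $ i + 2 * pi"
        using l[of i] by (simp add: field_simps)
      then show ?thesis by simp
    qed
    then have "cos (2 * pi * ((x + axis i (l $ i)) $ j - y) / l $ j) = cos (2 * pi * (x $ j - y) / l $ j)"
      for x i j y by (auto simp: axis_def)
    then show "periodic l (\<lambda>x. box_bump l t1 t2 p q n (t, x))" for t
      unfolding periodic_def box_bump_def by simp
  next
    fix t x assume t: "t \<notin> {t1 + c..t2 - c}"
    have "real n * ((t - t1) * (t2 - t)) - 1 \<le> 0"
    proof (rule ccontr)
      assume "\<not> ?thesis"
      then have *: "real n * ((t - t1) * (t2 - t)) > 1" by simp
      have pos: "(t - t1) * (t2 - t) > 0"
      proof (rule ccontr)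
        assume "\<not> ?thesis"
        then have "(t - t1) * (t2 - t) \<le> 0" by (rule leI)
        then have "real n * ((t - t1) * (t2 - t)) \<le> 0" by (rule mult_nonneg_nonpos[OF of_nat_0_le_iff])
        then show False using order.strict_trans2[OF *] by (meson not_one_less_zero)
      qed
      then have t12: "t1 < t" "t < t2" using \<open>t1 < t2\<close> by (auto simp: zero_less_mult_iff)
      have **: "1 < real (Suc n) * ((t - t1) * (t2 - t))"
        using add_strict_mono[OF * pos] unfolding of_nat_Suc distrib_right by simp
      have le: "(t - t1) * (t2 - t) \<le> (t - t1) * (t2 - t1)" "(t - t1) * (t2 - t) \<le> (t2 - t1) * (t2 - t)"
        using t12 by (auto intro!: mult_left_mono mult_right_mono)
      have "1 < real (Suc n) * ((t - t1) * (t2 - t1))" "1 < real (Suc n) * ((t2 - t1) * (t2 - t))"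
        by (rule less_le_trans[OF ** mult_left_mono[OF le(1)]], simp,
            rule less_le_trans[OF ** mult_left_mono[OF le(2)]], simp)
      then have "c < t - t1" "c < t2 - t"
        using \<open>t1 < t2\<close> by (simp_all add: c_def field_simps del: of_nat_Suc)
      with t show False by auto
    qed
    then show "box_bump l t1 t2 p q n (t, x) = 0"
      by (simp add: box_bump_def bump_simps)
  qed
  moreover have "0 < c" using \<open>t1 < t2\<close> by (simp add: c_def)
  ultimately show ?thesis by (intro that[of "t1 + c" "t2 - c"]) auto
qed

lemma mem_box_Pair: "(t, x) \<in> box (a, c) (b, d) \<longleftrightarrow> a < t \<and> t < b \<and> x \<in> box c d"
  for t :: real and x :: "'a::euclidean_space"
  by (simp add: box_prod)

lemma box_bump_tendsto:
  assumes "\<And>i. 0 \<le> p $ i" "\<And>i. p $ i < q $ i" "\<And>i. q $ i \<le> l $ i" "x \<in> cbox 0 l" "t1 < t2"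
  shows "(\<lambda>n. box_bump l t1 t2 p q n (t, x)) \<longlonglongrightarrow> indicator (box (t1, p) (t2, q)) (t, x)"
proof -
  have *: "cos (2 * pi * (x $ i - (p $ i + q $ i) / 2) / l $ i) - cos (pi * (q $ i - p $ i) / l $ i) > 0
      \<longleftrightarrow> p $ i < x $ i \<and> x $ i < q $ i" for i
    using interval_iff_cos[of "p $ i" "q $ i" "l $ i" "x $ i"] assms by (simp add: mem_box_cart)
  have t: "(t - t1) * (t2 - t) > 0 \<longleftrightarrow> t1 < t \<and> t < t2"
    using assms(5) by (auto simp: zero_less_mult_iff)
  have "(\<lambda>n. box_bump l t1 t2 p q n (t, x)) \<longlonglongrightarrow> (if (t - t1) * (t2 - t) > 0 then 1 else 0) *
      (\<Prod>i\<in>UNIV. if cos (2 * pi * (x $ i - (p $ i + q $ i) / 2) / l $ i)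
         - cos (pi * (q $ i - p $ i) / l $ i) > 0 then 1 else 0)"
    unfolding box_bump_def fst_conv snd_conv by (intro tendsto_mult tendsto_prod bump_tendsto) auto
  also have "(if (t - t1) * (t2 - t) > 0 then 1 else 0) *
      (\<Prod>i\<in>UNIV. if cos (2 * pi * (x $ i - (p $ i + q $ i) / 2) / l $ i)
         - cos (pi * (q $ i - p $ i) / l $ i) > 0 then 1 else 0) = (indicator (box (t1, p) (t2, q)) (t, x) :: real)"
    unfolding * t by (auto simp: indicator_def mem_box_Pair mem_box_cart)
  finally show ?thesis .
qed

lemma integral_box_bump_tendsto:
  fixes l p q :: "real ^ 'n"
  assumes c: "continuous_on UNIV c" and "0 \<le> t1" "t1 < t2" "t2 \<le> T"
    and pq: "\<And>i. 0 \<le> p $ i" "\<And>i. p $ i < q $ i" "\<And>i. q $ i \<le> l $ i"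
  shows "(\<lambda>n. integral (cbox (0, 0) (T, l)) (\<lambda>z. c z * box_bump l t1 t2 p q n z))
    \<longlonglongrightarrow> integral (cbox (t1, p) (t2, q)) c"
proof -
  let ?Q = "cbox (0, 0) (T, l)" and ?B = "box (t1, p) (t2, q)"
  have l: "0 < l $ i" for i using pq[of i] by linarith
  have "(\<lambda>n. integral ?Q (\<lambda>z. c z * box_bump l t1 t2 p q n z)) \<longlonglongrightarrow>
      integral ?Q (\<lambda>z. c z * indicator ?B z)"
  proof (rule dominated_convergence(2))
    show "(\<lambda>z. c z * box_bump l t1 t2 p q n z) integrable_on ?Q" for n
    proof -
      obtain a b where "torus_test l a b (box_bump l t1 t2 p q n)"
        using box_bump_test[OF \<open>t1 < t2\<close> l] by metis
      then show ?thesis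
        by (intro integrable_continuous continuous_on_mult smooth_continuous_on continuous_on_subset[OF c])
           (auto simp: torus_test_def)
    qed
    show "(\<lambda>z. \<bar>c z\<bar>) integrable_on ?Q"
      by (auto intro!: integrable_continuous continuous_intros continuous_on_subset[OF c])
    show "norm (c z * box_bump l t1 t2 p q n z) \<le> \<bar>c z\<bar>" for n z
      using box_bump_bounds[of l t1 t2 p q n z] by (simp add: abs_mult mult_left_le)
    show "(\<lambda>n. c z * box_bump l t1 t2 p q n z) \<longlonglongrightarrow> c z * indicator ?B z" if "z \<in> ?Q" for z
      using that pq \<open>t1 < t2\<close> by (cases z) (auto intro!: tendsto_intros box_bump_tendsto)
  qed
  also have "integral ?Q (\<lambda>z. c z * indicator ?B z) = integral ?Q (\<lambda>z. if z \<in> ?B then c z else 0)"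
    by (rule integral_cong) (auto simp: indicator_def)
  also have "\<dots> = integral (?B \<inter> ?Q) c"
    by (rule Henstock_Kurzweil_Integration.integral_restrict_Int)
  also have "?B \<inter> ?Q = ?B"
  proof -
    have "(t, x) \<in> ?Q" if "(t, x) \<in> ?B" for t x
    proof -
      have "0 \<le> x $ i" "x $ i \<le> l $ i" for i
        using that pq[of i] by (auto simp: mem_box_Pair mem_box_cart dest!: spec[of _ i])
      then show ?thesis
        using that assms(2,4) by (auto simp: mem_box_Pair mem_box_cart)
    qed
    then show ?thesis by auto
  qed
  finally show ?thesis by (simp add: integral_open_interval)
qed

text \<open>If \<open>c\<close> exceeded \<open>K\<close> at an interior point, it would exceed some
  \<open>K' > K\<close> on a whole closed box around it and violate the hypothesis there. Continuity
  extends the bound to the boundary.\<close>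

lemma continuous_le_of_integral_le:
  fixes c :: "'a::euclidean_space \<Rightarrow> real"
  assumes c: "continuous_on UNIV c" and "z \<in> cbox a b" "box a b \<noteq> {}"
    and le: "\<And>p q. cbox p q \<subseteq> box a b \<Longrightarrow> \<forall>i\<in>Basis. p \<bullet> i < q \<bullet> i \<Longrightarrow>
      integral (cbox p q) c \<le> K * measure lborel (cbox p q)"
  shows "c z \<le> K"
proof -
  have "c y \<le> K" if y: "y \<in> box a b" for y
  proof (rule ccontr)
    assume "\<not> c y \<le> K"
    define K' where "K' = (c y + K) / 2"
    have K': "K < K'" "K' < c y" using \<open>\<not> c y \<le> K\<close> by (auto simp: K'_def field_simps)
    have "open (box a b \<inter> {x. K' < c x})"
      using c by (intro open_Int open_box open_Collect_less) (auto intro: continuous_intros)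
    then obtain p q where pq: "cbox p q \<subseteq> box a b \<inter> {x. K' < c x}" "\<forall>i\<in>Basis. p \<bullet> i < q \<bullet> i"
      using y K' by (elim open_contains_cbox[of _ y]) auto
    have "0 < measure lborel (cbox p q)" using pq(2) by (simp add: content_pos_lt_eq)
    then have "K * measure lborel (cbox p q) < K' * measure lborel (cbox p q)" using K' by simp
    also have "\<dots> = integral (cbox p q) (\<lambda>_. K')" by simp
    also have "\<dots> \<le> integral (cbox p q) c"
      using pq(1) by (intro integral_le integrable_continuous continuous_on_subset[OF c])
        (auto intro!: continuous_intros)
    finally show False using le[of p q] pq by auto
  qed
  then show ?thesis
    using continuous_le_on_closure[of "box a b" c z K] continuous_on_subset[OF c] assms(2,3) by auto
qed

section \<open>Difference quotients bounded by weak derivatives\<close>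

context weakly_C11
begin

abbreviation Q where "Q \<equiv> cbox (0, 0) (T, l)"

lemma fst_Basis: "v \<in> Basis \<Longrightarrow> 0 \<le> fst v" for v :: "real \<times> (real ^ 'n)"
  by (auto simp: Basis_prod_def)

lemma integral_test_nonneg:
  assumes "torus_test l a b \<psi>" "\<And>z. 0 \<le> \<psi> z"
  shows "0 \<le> integral Q \<psi>"
  using assms by (intro integral_nonneg integrable_continuous smooth_continuous_on)
    (auto simp: torus_test_def)

lemma integral_mult_test_diff:
  assumes "continuous_on UNIV c" "continuous_on UNIV d" "torus_test l a b \<psi>"
  shows "integral Q (\<lambda>z. (c z - d z) * \<psi> z) = integral Q (\<lambda>z. c z * \<psi> z) - integral Q (\<lambda>z. d z * \<psi> z)"
  unfolding left_diff_distrib using assms(3)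
  by (intro Henstock_Kurzweil_Integration.integral_diff integrable_continuous continuous_on_mult
      smooth_continuous_on continuous_on_subset[OF assms(1)] continuous_on_subset[OF assms(2)])
     (auto simp: torus_test_def)

lemma integral_shift_test_1:
  assumes "torus_test l a b \<psi>" "v \<in> Basis" "0 \<le> s" "\<And>i. v = (0, axis i 1) \<Longrightarrow> s \<le> l $ i"
    "0 < a" "b + s * fst v < T"
  shows "integral Q (shift (s *\<^sub>R v) \<psi>) = integral Q \<psi>"
proof -
  have "0 \<le> s * fst v" using assms fst_Basis by auto
  then have "integral Q (\<lambda>z. 1 * shift (s *\<^sub>R v) \<psi> z) = integral Q (\<lambda>z. 1 * \<psi> z)"
    using assms(5,6) by (intro integral_shift_test[of "\<lambda>_. 1", OF _ _ assms(1-4)]) (auto simp: periodic_def)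
  then show ?thesis by simp
qed

text \<open>Translation does not change \<open>integral Q \<psi>\<close>, so one bound holds for all
  intermediate \<open>q\<close>, as the mean value inequality requires.\<close>

lemma weak1_shift:
  assumes \<psi>: "torus_test l a b \<psi>" "\<And>z. 0 \<le> \<psi> z" and v: "v \<in> Basis" "w \<in> Basis"
    and s: "0 \<le> s" "\<And>i. v = (0, axis i 1) \<Longrightarrow> s \<le> l $ i" "0 < a" "b + s * fst v < T" and q: "0 \<le> q" "q \<le> s"
  shows "\<bar>pairing (dirderiv w (shift (q *\<^sub>R v) \<psi>))\<bar> \<le> M * integral Q \<psi>"
    and "u \<in> Basis \<Longrightarrow> \<bar>pairing (dirderiv w (dirderiv u (shift (q *\<^sub>R v) \<psi>)))\<bar> \<le> M * integral Q \<psi>"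
proof -
  have q': "0 \<le> q * fst v" "q * fst v \<le> s * fst v" "\<And>i. v = (0, axis i 1) \<Longrightarrow> q \<le> l $ i"
    using q fst_Basis[OF v(1)] s by (auto intro: mult_right_mono order_trans)
  have t: "torus_test l (a + q * fst v) (b + q * fst v) (shift (q *\<^sub>R v) \<psi>)"
    using torus_test_shift[OF \<psi>(1), of "q *\<^sub>R v"] by simp
  have eq: "integral Q (shift (q *\<^sub>R v) \<psi>) = integral Q \<psi>"
    using \<psi>(1) v(1) q(1) q' s by (intro integral_shift_test_1) auto
  have pos: "0 \<le> shift (q *\<^sub>R v) \<psi> z" for z using \<psi>(2) by (simp add: shift_def)
  show "\<bar>pairing (dirderiv w (shift (q *\<^sub>R v) \<psi>))\<bar> \<le> M * integral Q \<psi>" 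
    unfolding eq[symmetric] pairing_def by (rule weak1[OF v(2) t _ _ pos]) (use q' s in auto)
  show "\<bar>pairing (dirderiv w (dirderiv u (shift (q *\<^sub>R v) \<psi>)))\<bar> \<le> M * integral Q \<psi>" if "u \<in> Basis"
    unfolding eq[symmetric] pairing_def by (rule weak2[OF that v(2) t _ _ pos]) (use q' s in auto)
qed

lemma pairing_diff1:
  assumes \<psi>: "torus_test l a b \<psi>" "\<And>z. 0 \<le> \<psi> z" and v: "v \<in> Basis"
    and s: "0 \<le> s" "\<And>i. v = (0, axis i 1) \<Longrightarrow> s \<le> l $ i" "0 < a" "b + s * fst v < T"
  shows "\<bar>pairing (shift (s *\<^sub>R v) \<psi>) - pairing \<psi>\<bar> \<le> M * integral Q \<psi> * s"
    and "u \<in> Basis \<Longrightarrow> \<bar>pairing (shift (s *\<^sub>R v) (dirderiv u \<psi>)) - pairing (dirderiv u \<psi>)\<bar>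
      \<le> M * integral Q \<psi> * s"
proof -
  have sm: "\<forall>m. Ck m \<psi>" using \<psi> by (simp add: torus_test_def)
  show "\<bar>pairing (shift (s *\<^sub>R v) \<psi>) - pairing \<psi>\<bar> \<le> M * integral Q \<psi> * s"
    by (rule pairing_shift_bound[OF sm s(1)]) (rule weak1_shift(1)[OF \<psi> v v s])
  assume u: "u \<in> Basis"
  show "\<bar>pairing (shift (s *\<^sub>R v) (dirderiv u \<psi>)) - pairing (dirderiv u \<psi>)\<bar>
      \<le> M * integral Q \<psi> * s"
    by (rule pairing_shift_bound[OF smooth_dirderiv[OF sm] s(1)])
       (unfold dirderiv_shift[OF sm, symmetric], rule weak1_shift(2)[OF \<psi> v v s _ _ u])
qed

text \<open>Mean value inequality applied twice: the derivative of the \<open>w\<close>-difference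
  along \<open>v\<close> is the \<open>w\<close>-difference of a pairing with
  \<open>dirderiv v\<close>, to which the second part of \<open>pairing_diff1\<close>
  applies.\<close>

lemma pairing_diff2:
  assumes \<psi>: "torus_test l a b \<psi>" "\<And>z. 0 \<le> \<psi> z" and v: "v \<in> Basis" "w \<in> Basis"
    and s: "0 \<le> s" "\<And>i. v = (0, axis i 1) \<Longrightarrow> s \<le> l $ i" "0 \<le> r" "\<And>i. w = (0, axis i 1) \<Longrightarrow> r \<le> l $ i" "0 < a" "b + s * fst v + r * fst w < T"
  shows "\<bar>(pairing (shift (s *\<^sub>R v) (shift (r *\<^sub>R w) \<psi>)) - pairing (shift (s *\<^sub>R v) \<psi>))
     - (pairing (shift (r *\<^sub>R w) \<psi>) - pairing \<psi>)\<bar> \<le> M * integral Q \<psi> * r * s"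
proof -
  have sm: "\<forall>m. Ck m \<psi>" using \<psi> by (simp add: torus_test_def)
  have sm': "\<forall>m. Ck m (shift x \<psi>)" for x using sm by (simp add: Ck_shift)
  define H where "H = (\<lambda>q. pairing (shift (q *\<^sub>R v) (shift (r *\<^sub>R w) \<psi>)) - pairing (shift (q *\<^sub>R v) \<psi>))"
  have "norm (H s - H 0) \<le> M * integral Q \<psi> * r * norm (s - 0)"
  proof (rule field_differentiable_bound[of "{0..s}"])
    show "(H has_field_derivative (- pairing (shift (q *\<^sub>R v) (dirderiv v (shift (r *\<^sub>R w) \<psi>)))
        - - pairing (shift (q *\<^sub>R v) (dirderiv v \<psi>)))) (at q within {0..s})" for q
      unfolding H_def
      by (intro DERIV_diff pairing_shift_deriv[THEN has_field_derivative_at_within] sm sm')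
    fix q assume q: "q \<in> {0..s}"
    have comm: "shift x (shift y f) = shift y (shift x f)" for x y and f :: "real \<times> (real^'n) \<Rightarrow> real"
      by (simp add: shift_def algebra_simps)
    have qv: "0 \<le> q * fst v" "q * fst v \<le> s * fst v" "0 \<le> r * fst w"
      using q s fst_Basis[OF v(1)] fst_Basis[OF v(2)] by (auto intro: mult_right_mono)
    have "\<bar>pairing (shift (r *\<^sub>R w) (dirderiv v (shift (q *\<^sub>R v) \<psi>))) - pairing (dirderiv v (shift (q *\<^sub>R v) \<psi>))\<bar>
      \<le> M * integral Q (shift (q *\<^sub>R v) \<psi>) * r"
    proof (rule pairing_diff1(2)[OF _ _ v(2) s(3,4)])
      show "torus_test l (a + q * fst v) (b + q * fst v) (shift (q *\<^sub>R v) \<psi>)"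
        using torus_test_shift[OF \<psi>(1), of "q *\<^sub>R v"] by simp
    qed (use qv s \<psi>(2) v in \<open>auto simp: shift_def\<close>)
    also have "integral Q (shift (q *\<^sub>R v) \<psi>) = integral Q \<psi>"
      using \<psi>(1) v(1) s q qv by (intro integral_shift_test_1) (auto intro: order_trans)
    finally show "norm (- pairing (shift (q *\<^sub>R v) (dirderiv v (shift (r *\<^sub>R w) \<psi>)))
        - - pairing (shift (q *\<^sub>R v) (dirderiv v \<psi>))) \<le> M * integral Q \<psi> * r"
      by (simp add: dirderiv_shift sm comm)
  qed (use s in auto)
  then show ?thesis using s by (simp add: H_def shift_def)
qed

text \<open>The plus sign in front of the linear term is due to \<open>pairing_shift_deriv\<close>:
  the translation parameter enters \<open>\<psi>\<close> with a minus. The derivative of the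
  remainder is itself a first difference, of order \<open>q\<close>.\<close>

lemma pairing_taylor:
  assumes \<psi>: "torus_test l a b \<psi>" "\<And>z. 0 \<le> \<psi> z" and v: "v \<in> Basis"
    and s: "0 \<le> s" "\<And>i. v = (0, axis i 1) \<Longrightarrow> s \<le> l $ i" "0 < a" "b + s * fst v < T"
  shows "\<bar>pairing (shift (s *\<^sub>R v) \<psi>) - pairing \<psi> + s * pairing (dirderiv v \<psi>)\<bar>
    \<le> \<bar>M\<bar> * integral Q \<psi> * s * s"
proof -
  have sm: "\<forall>m. Ck m \<psi>" using \<psi> by (simp add: torus_test_def)
  define H where "H = (\<lambda>q. pairing (shift (q *\<^sub>R v) \<psi>) + q * pairing (dirderiv v \<psi>))"
  have "norm (H s - H 0) \<le> \<bar>M\<bar> * integral Q \<psi> * s * norm (s - 0)"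
  proof (rule field_differentiable_bound[of "{0..s}"])
    show "(H has_field_derivative (- pairing (shift (q *\<^sub>R v) (dirderiv v \<psi>))
        + 1 * pairing (dirderiv v \<psi>))) (at q within {0..s})" for q
      unfolding H_def
      by (intro DERIV_add pairing_shift_deriv[THEN has_field_derivative_at_within] sm DERIV_cmult_right DERIV_ident)
    fix q assume q: "q \<in> {0..s}"
    then have qv: "0 \<le> q" "\<And>i. v = (0, axis i 1) \<Longrightarrow> q \<le> l $ i" "b + q * fst v < T"
      using s fst_Basis[OF v] by (auto intro: order_trans le_less_trans[OF add_left_mono[OF mult_right_mono]])
    have "\<bar>pairing (shift (q *\<^sub>R v) (dirderiv v \<psi>)) - pairing (dirderiv v \<psi>)\<bar> \<le> M * integral Q \<psi> * q"
      by (rule pairing_diff1(2)[OF \<psi> v qv(1,2) s(3) qv(3) v])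
    also have "\<dots> \<le> \<bar>M\<bar> * integral Q \<psi> * s"
      using q integral_test_nonneg[OF \<psi>] by (intro mult_mono) (auto intro: mult_right_mono)
    finally show "norm (- pairing (shift (q *\<^sub>R v) (dirderiv v \<psi>)) + 1 * pairing (dirderiv v \<psi>))
        \<le> \<bar>M\<bar> * integral Q \<psi> * s" by simp
  qed (use s in auto)
  then show ?thesis using s by (simp add: H_def shift_def)
qed

lemma box_of_test_le:
  assumes c: "continuous_on UNIV c" and "T' \<le> T"
    and le: "\<And>a b \<psi>. torus_test l a b \<psi> \<Longrightarrow> (\<And>z. 0 \<le> \<psi> z) \<Longrightarrow> 0 < a \<Longrightarrow> b < T' \<Longrightarrow>
      integral Q (\<lambda>z. c z * \<psi> z) \<le> K * integral Q \<psi>"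
    and t: "0 \<le> t1" "t1 < t2" "t2 \<le> T'"
    and pq: "\<And>i. 0 \<le> p $ i" "\<And>i. p $ i < q $ i" "\<And>i. q $ i \<le> l $ i"
  shows "integral (cbox (t1, p) (t2, q)) c \<le> K * measure lborel (cbox (t1, p) (t2, q))"
proof (rule LIMSEQ_le)
  show "(\<lambda>n. integral Q (\<lambda>z. c z * box_bump l t1 t2 p q n z)) \<longlonglongrightarrow> integral (cbox (t1, p) (t2, q)) c"
    using t pq \<open>T' \<le> T\<close> by (intro integral_box_bump_tendsto c) auto
  have "(\<lambda>n. integral Q (\<lambda>z. 1 * box_bump l t1 t2 p q n z)) \<longlonglongrightarrow> integral (cbox (t1, p) (t2, q)) (\<lambda>_. 1)"
    using t pq \<open>T' \<le> T\<close> by (intro integral_box_bump_tendsto) auto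
  then show "(\<lambda>n. K * integral Q (box_bump l t1 t2 p q n)) \<longlonglongrightarrow> K * measure lborel (cbox (t1, p) (t2, q))"
    by (intro tendsto_intros) simp
  have "integral Q (\<lambda>z. c z * box_bump l t1 t2 p q n z) \<le> K * integral Q (box_bump l t1 t2 p q n)" for n
  proof -
    obtain a b where "t1 < a" "b < t2" "torus_test l a b (box_bump l t1 t2 p q n)"
      using box_bump_test[OF t(2) l_pos] by metis
    with t show ?thesis by (intro le box_bump_bounds) auto
  qed
  then show "\<exists>N. \<forall>n\<ge>N. integral Q (\<lambda>z. c z * box_bump l t1 t2 p q n z) \<le> K * integral Q (box_bump l t1 t2 p q n)"
    by blast
qed

text \<open>Test functions give boxes and boxes give points. \<open>T'\<close> lies below
  \<open>T\<close> when \<open>c\<close> contains a forward time translate of \<open>\<Phi>\<close>: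
  the bound is then available only for tests whose translate still ends before
  \<open>T\<close>.\<close>

lemma pointwise_of_test_le:
  assumes c: "continuous_on UNIV c" and "T' \<le> T" "0 < T'"
    and le: "\<And>a b \<psi>. torus_test l a b \<psi> \<Longrightarrow> (\<And>z. 0 \<le> \<psi> z) \<Longrightarrow> 0 < a \<Longrightarrow> b < T' \<Longrightarrow>
      \<bar>integral Q (\<lambda>z. c z * \<psi> z)\<bar> \<le> K * integral Q \<psi>"
    and z: "z \<in> cbox (0, 0) (T', l)"
  shows "\<bar>c z\<bar> \<le> K"
proof -
  have ne: "box (0, 0) (T', l) \<noteq> {}"
    using l_pos \<open>0 < T'\<close> by (simp add: box_ne_empty Basis_prod_def inner_Basis Basis_vec_def inner_axis)
  have *: "d z \<le> K" if d: "continuous_on UNIV d"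
    and le: "\<And>a b \<psi>. torus_test l a b \<psi> \<Longrightarrow> (\<And>z. 0 \<le> \<psi> z) \<Longrightarrow> 0 < a \<Longrightarrow> b < T' \<Longrightarrow>
      integral Q (\<lambda>z. d z * \<psi> z) \<le> K * integral Q \<psi>" for d
  proof (rule continuous_le_of_integral_le[OF d z ne])
    fix P P' :: "real \<times> (real ^ 'n)"
    assume sub: "cbox P P' \<subseteq> box (0, 0) (T', l)" and lt: "\<forall>i\<in>Basis. P \<bullet> i < P' \<bullet> i"
    obtain t1 p t2 q where P: "P = (t1, p)" "P' = (t2, q)" by (cases P, cases P')
    have "t1 < t2" using lt P by (auto simp: Basis_prod_def)
    moreover have "p $ i < q $ i" for i
      using bspec[OF lt, of "(0, axis i 1)"] P by (simp add: Basis_prod_def inner_axis)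
    moreover have "P \<in> cbox P P'" "P' \<in> cbox P P'"
      using lt by (auto simp: mem_box less_imp_le)
    then have "P \<in> box (0, 0) (T', l)" "P' \<in> box (0, 0) (T', l)" using sub by auto
    ultimately show "integral (cbox P P') d \<le> K * measure lborel (cbox P P')"
      unfolding P using \<open>T' \<le> T\<close>
      by (intro box_of_test_le[OF d _ le]) (auto simp: mem_box_Pair mem_box_cart less_imp_le)
  qed
  have "c z \<le> K"
    by (rule *[OF c]) (use le in \<open>fastforce simp: abs_le_iff\<close>)
  moreover have "- c z \<le> K"
    by (rule *) (use c le in \<open>auto intro!: continuous_intros simp: abs_le_iff\<close>)
  ultimately show ?thesis by simp
qed

lemma continuous_translate: "continuous_on UNIV (\<lambda>z. \<Phi> (z + w))"
  by (rule continuous_on_compose2[OF cont]) (auto intro: continuous_intros)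

lemma periodic_translate: "periodic l (\<lambda>x. \<Phi> ((t, x) + w))"
  unfolding periodic_def
proof (intro allI)
  fix x i
  show "\<Phi> ((t, x + axis i (l $ i)) + w) = \<Phi> ((t, x) + w)"
    using per[of "t + fst w", unfolded periodic_def, rule_format, of "x + snd w" i]
    by (cases w) (simp add: add_ac)
qed

lemma pairing_shift_eq:
  assumes "torus_test l a b \<psi>" "v \<in> Basis" "0 \<le> s" "\<And>i. v = (0, axis i 1) \<Longrightarrow> s \<le> l $ i" "0 < a" "b + s * fst v < T"
  shows "pairing (shift (s *\<^sub>R v) \<psi>) = integral Q (\<lambda>z. \<Phi> (z + s *\<^sub>R v) * \<psi> z)"
proof -
  have "0 \<le> s * fst v" using assms fst_Basis by auto
  then show ?thesis unfolding pairing_def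
    using assms(5,6) by (intro integral_shift_test[OF cont per assms(1-4)]) auto
qed

text \<open>A Lipschitz bound obtained by duality: tested against \<open>\<psi>\<close>, the
  translate of \<open>\<Phi>\<close> becomes a translate of \<open>\<psi>\<close>, which
  \<open>pairing_diff1\<close> controls. The second difference is treated in the same way with
  \<open>pairing_diff2\<close>.\<close>

lemma first_difference:
  assumes v: "v \<in> Basis" and s: "0 \<le> s" "\<And>i. v = (0, axis i 1) \<Longrightarrow> s \<le> l $ i" "s * fst v < T"
    and z: "z \<in> cbox (0, 0) (T - s * fst v, l)"
  shows "\<bar>\<Phi> (z + s *\<^sub>R v) - \<Phi> z\<bar> \<le> M * s"
proof (rule pointwise_of_test_le[OF _ _ _ _ z])
  show "continuous_on UNIV (\<lambda>z. \<Phi> (z + s *\<^sub>R v) - \<Phi> z)"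
    by (intro continuous_intros continuous_translate cont)
  fix a b \<psi> assume \<psi>: "torus_test l a b \<psi>" "\<And>z. 0 \<le> \<psi> z" "0 < a" "b < T - s * fst v"
  then show "\<bar>integral Q (\<lambda>z. (\<Phi> (z + s *\<^sub>R v) - \<Phi> z) * \<psi> z)\<bar> \<le> M * s * integral Q \<psi>"
    using pairing_diff1(1)[OF \<psi>(1,2) v s(1,2)] pairing_shift_eq[OF \<psi>(1) v s(1,2)]
    unfolding integral_mult_test_diff[OF continuous_translate cont \<psi>(1)] by (simp add: pairing_def mult_ac)
qed (use s fst_Basis[OF v] in auto)

lemma second_difference:
  assumes v: "v \<in> Basis" "w \<in> Basis"
    and s: "0 \<le> s" "\<And>i. v = (0, axis i 1) \<Longrightarrow> s \<le> l $ i" and r: "0 \<le> r" "\<And>i. w = (0, axis i 1) \<Longrightarrow> r \<le> l $ i"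
    and T: "s * fst v + r * fst w < T"
    and z: "z \<in> cbox (0, 0) (T - (s * fst v + r * fst w), l)"
  shows "\<bar>(\<Phi> (z + r *\<^sub>R w + s *\<^sub>R v) - \<Phi> (z + s *\<^sub>R v)) - (\<Phi> (z + r *\<^sub>R w) - \<Phi> z)\<bar> \<le> M * r * s"
proof (rule pointwise_of_test_le[OF _ _ _ _ z])
  let ?E = "\<lambda>z. (\<Phi> (z + r *\<^sub>R w + s *\<^sub>R v) - \<Phi> (z + s *\<^sub>R v)) - (\<Phi> (z + r *\<^sub>R w) - \<Phi> z)"
  show "continuous_on UNIV ?E"
    unfolding add.assoc by (intro continuous_intros continuous_translate cont)
  have nonneg: "0 \<le> s * fst v" "0 \<le> r * fst w" using s r fst_Basis[OF v(1)] fst_Basis[OF v(2)] by auto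
  fix a b \<psi> assume \<psi>: "torus_test l a b \<psi>" "\<And>z. 0 \<le> \<psi> z" "0 < a" "b < T - (s * fst v + r * fst w)"
  have t: "torus_test l (a + r * fst w) (b + r * fst w) (shift (r *\<^sub>R w) \<psi>)"
    using torus_test_shift[OF \<psi>(1), of "r *\<^sub>R w"] by simp
  have "pairing (shift (s *\<^sub>R v) (shift (r *\<^sub>R w) \<psi>)) =
      integral Q (\<lambda>z. \<Phi> (z + s *\<^sub>R v) * shift (r *\<^sub>R w) \<psi> z)"
    using nonneg \<psi> by (intro pairing_shift_eq[OF t v(1) s]) auto
  also have "\<dots> = integral Q (\<lambda>z. \<Phi> (z + r *\<^sub>R w + s *\<^sub>R v) * \<psi> z)"
    using nonneg \<psi> r v
    by (intro integral_shift_test[OF continuous_translate periodic_translate \<psi>(1)]) auto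
  finally have 1: "pairing (shift (s *\<^sub>R v) (shift (r *\<^sub>R w) \<psi>)) =
      integral Q (\<lambda>z. \<Phi> (z + r *\<^sub>R w + s *\<^sub>R v) * \<psi> z)" .
  have 2: "pairing (shift (s *\<^sub>R v) \<psi>) = integral Q (\<lambda>z. \<Phi> (z + s *\<^sub>R v) * \<psi> z)"
    "pairing (shift (r *\<^sub>R w) \<psi>) = integral Q (\<lambda>z. \<Phi> (z + r *\<^sub>R w) * \<psi> z)"
    using nonneg \<psi> by (auto intro!: pairing_shift_eq[OF \<psi>(1) v(1) s] pairing_shift_eq[OF \<psi>(1) v(2) r])
  have "integral Q (\<lambda>z. ?E z * \<psi> z)
    = (pairing (shift (s *\<^sub>R v) (shift (r *\<^sub>R w) \<psi>)) - pairing (shift (s *\<^sub>R v) \<psi>))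
     - (pairing (shift (r *\<^sub>R w) \<psi>) - pairing \<psi>)"
    unfolding 1 2 pairing_def[of \<psi>] add.assoc
    by (subst integral_mult_test_diff[OF _ _ \<psi>(1)];
        (intro continuous_intros continuous_translate cont)?)+ simp
  then show "\<bar>integral Q (\<lambda>z. ?E z * \<psi> z)\<bar>
     \<le> M * r * s * integral Q \<psi>"
    using pairing_diff2[OF \<psi>(1,2) v s r \<psi>(3)] \<psi>(4) by (simp add: mult_ac)
qed (use s r T mult_nonneg_nonneg[OF s(1) fst_Basis[OF v(1)]] mult_nonneg_nonneg[OF r(1) fst_Basis[OF v(2)]] in auto)

end

section \<open>Weak derivatives\<close>

lemma spacetime_set_in_sets: "{0<..<T} \<times> cbox 0 (l :: real ^ 'n) \<in> sets lebesgue" for T :: real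
  by (auto intro!: sets_completionI_sets borel_Times)

lemma spacetime_set_negligible:
  fixes l :: "real ^ 'n" and T :: real
  shows "negligible ({0..T} \<times> cbox 0 l - {0<..<T} \<times> cbox 0 l)"
proof (rule negligible_subset)
  show "negligible ({z. z \<bullet> (1, 0) = 0} \<union> {z. z \<bullet> (1 :: real, 0 :: real ^ 'n) = T})"
    by (intro negligible_Un negligible_standard_hyperplane) (simp_all add: Basis_prod_def image_iff)
qed (auto simp: inner_prod_def)

lemma integrable_spacetime_continuous:
  assumes "continuous_on UNIV f"
  shows "integrable (spacetime T l) (f :: _ \<Rightarrow> real)"
proof -
  have "integrable (lebesgue_on (cbox (0, 0) (T, l))) f"
    by (intro continuous_imp_integrable continuous_on_subset[OF assms]) auto
  then show ?thesis unfolding spacetime_def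
    using set_integrable_subset[of lebesgue "cbox (0, 0) (T, l)" f "{0<..<T} \<times> cbox 0 l"]
      spacetime_set_in_sets[of T l] integrable_restrict_space[of "cbox (0, 0) (T, l)" lebesgue f]
      integrable_restrict_space[of "{0<..<T} \<times> cbox 0 l" lebesgue f]
    by (fastforce simp: set_integrable_def)
qed

lemma integral_spacetime_continuous:
  assumes "continuous_on UNIV f"
  shows "integral\<^sup>L (spacetime T l) f = integral (cbox (0, 0) (T, l)) (f :: _ \<Rightarrow> real)"
proof -
  have "integral\<^sup>L (spacetime T l) f = integral ({0<..<T} \<times> cbox 0 l) f"
    unfolding spacetime_def
    by (intro lebesgue_integral_eq_integral spacetime_set_in_sets
        integrable_spacetime_continuous[unfolded spacetime_def] assms)
  also have "\<dots> = integral (cbox (0, 0) (T, l)) f"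
    by (rule integral_spike_set; rule negligible_subset[OF spacetime_set_negligible[of T l]])
       (auto simp: cbox_Pair_eq)
  finally show ?thesis .
qed

lemma finite_multi_indices: "finite (multi_indices m :: 'a::euclidean_space list set)"
  using finite_lists_length_le[of "Basis :: 'a set" m] by (simp add: multi_indices_def)

lemma weak_deriv_spec:
  assumes "\<phi> \<in> Winf m T l" "\<alpha> \<in> multi_indices m"
  shows "weak_deriv T l \<alpha> \<phi> \<in> Linf (spacetime T l)" "is_weak_deriv T l \<alpha> \<phi> (weak_deriv T l \<alpha> \<phi>)"
proof -
  have "\<exists>g. g \<in> Linf (spacetime T l) \<and> is_weak_deriv T l \<alpha> \<phi> g"
    using assms unfolding Winf_def by blast
  from someI_ex[OF this]
  show "weak_deriv T l \<alpha> \<phi> \<in> Linf (spacetime T l)" "is_weak_deriv T l \<alpha> \<phi> (weak_deriv T l \<alpha> \<phi>)"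
    unfolding weak_deriv_def by auto
qed

lemma AE_abs_le_Linf_norm:
  assumes "g \<in> Linf M"
  shows "AE z in M. \<bar>g z\<bar> \<le> Linf_norm M g"
proof -
  have "AE z in M. ereal \<bar>g z\<bar> \<le> esssup M (\<lambda>z. ereal \<bar>g z\<bar>)" by (rule esssup_AE)
  moreover have "esssup M (\<lambda>z. ereal \<bar>g z\<bar>) < \<infinity>" using assms by (simp add: Linf_def)
  ultimately show ?thesis
    unfolding Linf_norm_def by (cases "esssup M (\<lambda>z. ereal \<bar>g z\<bar>)") (auto elim: eventually_mono)
qed

lemma AE_weak_deriv_le:
  assumes "\<phi> \<in> Winf m T l" "\<alpha> \<in> multi_indices m"
  shows "AE z in spacetime T l. \<bar>weak_deriv T l \<alpha> \<phi> z\<bar> \<le> \<bar>Winf_norm m T l \<phi>\<bar>"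
proof -
  have "Linf_norm (spacetime T l) (weak_deriv T l \<alpha> \<phi>) \<le> Winf_norm m T l \<phi>"
    unfolding Winf_norm_def using assms(2) by (intro Max_ge) (auto simp: finite_multi_indices)
  with AE_abs_le_Linf_norm[OF weak_deriv_spec(1)[OF assms]] show ?thesis
    by (auto elim!: eventually_mono)
qed

lemma integrable_weak_deriv_mult:
  assumes "\<phi> \<in> Winf m T l" "\<alpha> \<in> multi_indices m" "continuous_on UNIV \<psi>"
  shows "integrable (spacetime T l) (\<lambda>z. weak_deriv T l \<alpha> \<phi> z * \<psi> z)"
proof (rule Bochner_Integration.integrable_bound)
  let ?M = "\<bar>Winf_norm m T l \<phi>\<bar>"
  show "integrable (spacetime T l) (\<lambda>z. ?M * \<psi> z)"
    by (intro integrable_spacetime_continuous continuous_intros assms)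
  have "\<psi> \<in> borel_measurable (spacetime T l)"
    using integrable_spacetime_continuous[OF assms(3)] by auto
  moreover have "weak_deriv T l \<alpha> \<phi> \<in> borel_measurable (spacetime T l)"
    using weak_deriv_spec(1)[OF assms(1,2)] by (simp add: Linf_def)
  ultimately show "(\<lambda>z. weak_deriv T l \<alpha> \<phi> z * \<psi> z) \<in> borel_measurable (spacetime T l)"
    by simp
  show "AE z in spacetime T l. norm (weak_deriv T l \<alpha> \<phi> z * \<psi> z) \<le> norm (?M * \<psi> z)"
    using AE_weak_deriv_le[OF assms(1,2)]
    by eventually_elim (auto simp: abs_mult intro: mult_right_mono)
qed

lemma integral_weak_deriv_mult_le:
  assumes "\<phi> \<in> Winf m T l" "\<alpha> \<in> multi_indices m" "continuous_on UNIV \<psi>" "\<And>z. 0 \<le> \<psi> z"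
  shows "\<bar>integral\<^sup>L (spacetime T l) (\<lambda>z. weak_deriv T l \<alpha> \<phi> z * \<psi> z)\<bar>
    \<le> \<bar>Winf_norm m T l \<phi>\<bar> * integral (cbox (0, 0) (T, l)) \<psi>"
proof -
  let ?M = "\<bar>Winf_norm m T l \<phi>\<bar>"
  have "\<bar>integral\<^sup>L (spacetime T l) (\<lambda>z. weak_deriv T l \<alpha> \<phi> z * \<psi> z)\<bar>
      \<le> integral\<^sup>L (spacetime T l) (\<lambda>z. \<bar>weak_deriv T l \<alpha> \<phi> z * \<psi> z\<bar>)"
    by (rule integral_abs_bound)
  also have "\<dots> \<le> integral\<^sup>L (spacetime T l) (\<lambda>z. ?M * \<psi> z)"
  proof (rule integral_mono_AE)
    show "integrable (spacetime T l) (\<lambda>z. \<bar>weak_deriv T l \<alpha> \<phi> z * \<psi> z\<bar>)"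
      by (intro integrable_abs integrable_weak_deriv_mult[OF assms(1-3)])
    show "integrable (spacetime T l) (\<lambda>z. ?M * \<psi> z)"
      by (intro integrable_spacetime_continuous continuous_intros assms)
    show "AE z in spacetime T l. \<bar>weak_deriv T l \<alpha> \<phi> z * \<psi> z\<bar> \<le> ?M * \<psi> z"
      using AE_weak_deriv_le[OF assms(1,2)]
      by eventually_elim (auto simp: abs_mult assms(4) intro: mult_right_mono)
  qed
  also have "\<dots> = integral (cbox (0, 0) (T, l)) (\<lambda>z. ?M * \<psi> z)"
    by (intro integral_spacetime_continuous continuous_intros assms)
  finally show ?thesis by simp
qed

text \<open>Freezing \<open>\<phi>\<close> before 0 and after \<open>T\<close> yields a function
  that is continuous everywhere, as \<open>weakly_C11\<close> asks, and agrees with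
  \<open>\<phi>\<close> on \<open>[0, T]\<close>.\<close>

definition clamp_time :: "real \<Rightarrow> (real \<times> (real ^ 'n) \<Rightarrow> real) \<Rightarrow> real \<times> (real ^ 'n) \<Rightarrow> real" where
  "clamp_time T \<phi> z = \<phi> (max 0 (min T (fst z)), snd z)"

lemma clamp_time_eq: "0 \<le> t \<Longrightarrow> t \<le> T \<Longrightarrow> clamp_time T \<phi> (t, x) = \<phi> (t, x)"
  by (simp add: clamp_time_def)

lemma integral_weak_deriv_eq:
  assumes "\<phi> \<in> Winf m T l" "\<alpha> \<in> multi_indices m"
    and cont: "continuous_on UNIV (clamp_time T \<phi>)" "continuous_on UNIV (iter_deriv \<alpha> \<psi>)"
    and "\<psi> \<in> test_functions T l"
  shows "integral (cbox (0, 0) (T, l)) (\<lambda>z. clamp_time T \<phi> z * iter_deriv \<alpha> \<psi> z) =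
    (- 1) ^ length \<alpha> * integral\<^sup>L (spacetime T l) (\<lambda>z. weak_deriv T l \<alpha> \<phi> z * \<psi> z)"
proof -
  have "integral (cbox (0, 0) (T, l)) (\<lambda>z. clamp_time T \<phi> z * iter_deriv \<alpha> \<psi> z) =
      integral\<^sup>L (spacetime T l) (\<lambda>z. clamp_time T \<phi> z * iter_deriv \<alpha> \<psi> z)"
    by (intro integral_spacetime_continuous[symmetric] continuous_intros cont)
  also have "\<dots> = integral\<^sup>L (spacetime T l) (\<lambda>z. \<phi> z * iter_deriv \<alpha> \<psi> z)"
    by (rule Bochner_Integration.integral_cong) (auto simp: spacetime_def clamp_time_eq)
  finally show ?thesis
    using weak_deriv_spec(2)[OF assms(1,2)] assms(5) by (simp add: is_weak_deriv_def)
qed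

lemma iter_deriv_dirderiv: "iter_deriv [v] \<psi> = dirderiv v \<psi>" "iter_deriv [w, v] \<psi> = dirderiv w (dirderiv v \<psi>)"
  by (simp_all add: dirderiv_def)

lemma multi_indices_2:
  assumes "v \<in> Basis" "w \<in> Basis"
  shows "[v] \<in> multi_indices 2" "[w, v] \<in> multi_indices 2"
  using assms by (simp_all add: multi_indices_def)

lemma weakly_C11_clamp_time:
  fixes l :: "real ^ 'n"
  assumes T: "0 < T" and l: "\<And>i. 0 < l $ i"
    and \<phi>: "\<phi> \<in> Winf 2 T l" "continuous_on ({0..T} \<times> UNIV) \<phi>"
  shows "weakly_C11 T l \<bar>Winf_norm 2 T l \<phi>\<bar> (clamp_time T \<phi>)"
proof
  show cont: "continuous_on UNIV (clamp_time T \<phi>)"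
    unfolding clamp_time_def[abs_def]
    by (rule continuous_on_compose2[OF \<phi>(2)], intro continuous_intros) (use T in auto)
  show "periodic l (\<lambda>x. clamp_time T \<phi> (t, x))" for t
    unfolding periodic_def
  proof (intro allI)
    fix x i
    \<comment> \<open>\<open>Winf\<close> grants periodicity only for times in the open interval.
      The defect \<open>d\<close> is continuous on \<open>[0, T]\<close>, so it also vanishes at the
      endpoints.\<close>
    define d where "d = (\<lambda>t. \<phi> (t, x + axis i (l $ i)) - \<phi> (t, x))"
    define t' where "t' = max 0 (min T t)"
    have t': "t' \<in> closure {0<..<T}" using T by (auto simp: t'_def)
    have contd: "continuous_on {0..T} d"
      unfolding d_def by (intro continuous_intros continuous_on_compose2[OF \<phi>(2)]) auto
    have "d t' = 0"
    proof (rule continuous_constant_on_closure[OF _ _ t'])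
      show "d s = 0" if "s \<in> {0<..<T}" for s
        using \<phi>(1) that by (auto simp: Winf_def periodic_def d_def)
    qed (use T contd in auto)
    then show "clamp_time T \<phi> (t, x + axis i (l $ i)) = clamp_time T \<phi> (t, x)"
      by (simp add: clamp_time_def d_def t'_def)
  qed
  fix v w :: "real \<times> (real ^ 'n)" and a b \<psi>
  assume v: "v \<in> Basis" and \<psi>: "torus_test l a b \<psi>" "0 < a" "b < T" "\<And>z. 0 \<le> \<psi> z"
  have sm: "\<forall>m. Ck m \<psi>" using \<psi>(1) by (simp add: torus_test_def)
  note tf = test_functionsI[OF \<psi>(1,2,3)]
  show "\<bar>integral (cbox (0, 0) (T, l)) (\<lambda>z. clamp_time T \<phi> z * dirderiv v \<psi> z)\<bar>
      \<le> \<bar>Winf_norm 2 T l \<phi>\<bar> * integral (cbox (0, 0) (T, l)) \<psi>"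
    using integral_weak_deriv_mult_le[OF \<phi>(1) multi_indices_2(1)[OF v v] smooth_continuous_on[OF sm] \<psi>(4)]
      integral_weak_deriv_eq[OF \<phi>(1) multi_indices_2(1)[OF v v] cont _ tf]
      smooth_continuous_on[OF smooth_dirderiv[OF sm]]
    unfolding iter_deriv_dirderiv by simp
  assume w: "w \<in> Basis"
  show "\<bar>integral (cbox (0, 0) (T, l)) (\<lambda>z. clamp_time T \<phi> z * dirderiv w (dirderiv v \<psi>) z)\<bar>
      \<le> \<bar>Winf_norm 2 T l \<phi>\<bar> * integral (cbox (0, 0) (T, l)) \<psi>"
    using integral_weak_deriv_mult_le[OF \<phi>(1) multi_indices_2(2)[OF v w] smooth_continuous_on[OF sm] \<psi>(4)]
      integral_weak_deriv_eq[OF \<phi>(1) multi_indices_2(2)[OF v w] cont _ tf]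
      smooth_continuous_on[OF smooth_dirderiv[OF smooth_dirderiv[OF sm]]]
    unfolding iter_deriv_dirderiv by simp
qed (fact T l)+

text \<open>The link between the chosen representative of the weak derivative and values of
  \<open>\<phi>\<close>. For \<open>box_bump\<close> in place of the indicator this is
  \<open>pairing_taylor\<close>, as pairing with \<open>dirderiv v\<close> is minus the integral of
  the weak derivative; the essential bound of the latter allows the limit.\<close>

lemma weak_deriv_box_difference:
  fixes l :: "real ^ 'n"
  assumes T: "0 < T" and l: "\<And>i. 0 < l $ i"
    and \<phi>: "\<phi> \<in> Winf 2 T l" "continuous_on ({0..T} \<times> UNIV) \<phi>"
    and v: "v \<in> Basis" and s: "0 \<le> s" "\<And>i. v = (0, axis i 1) \<Longrightarrow> s \<le> l $ i"
    and t: "0 \<le> t1" "t1 < t2" "t2 + s * fst v \<le> T"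
    and pq: "\<And>i. 0 \<le> p $ i" "\<And>i. p $ i < q $ i" "\<And>i. q $ i \<le> l $ i"
  shows "\<bar>s * integral\<^sup>L (spacetime T l) (\<lambda>z. weak_deriv T l [v] \<phi> z * indicator (box (t1, p) (t2, q)) z)
      - integral (cbox (t1, p) (t2, q)) (\<lambda>z. clamp_time T \<phi> (z + s *\<^sub>R v) - clamp_time T \<phi> z)\<bar>
    \<le> \<bar>Winf_norm 2 T l \<phi>\<bar> * measure lborel (cbox (t1, p) (t2, q)) * s * s" (is "\<bar>s * ?L - ?R\<bar> \<le> _")
proof (rule LIMSEQ_le)
  let ?M = "\<bar>Winf_norm 2 T l \<phi>\<bar>" and ?Q = "cbox (0, 0) (T, l)"
  let ?\<psi> = "box_bump l t1 t2 p q" and ?g = "weak_deriv T l [v] \<phi>" and ?\<Phi> = "clamp_time T \<phi>"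
  interpret weakly_C11 T l ?M ?\<Phi> by (rule weakly_C11_clamp_time[OF T l \<phi>])
  note \<alpha> = multi_indices_2(1)[OF v v]
  have sv: "0 \<le> s * fst v" using s fst_Basis[OF v] by simp
  have cont\<Delta>: "continuous_on UNIV (\<lambda>z. ?\<Phi> (z + s *\<^sub>R v) - ?\<Phi> z)"
    by (intro continuous_intros continuous_translate cont)
  have test: "\<exists>a b. 0 < a \<and> b < T \<and> b + s * fst v < T \<and> torus_test l a b (?\<psi> n)" for n
  proof -
    obtain a b where "t1 < a" "b < t2" "torus_test l a b (?\<psi> n)"
      using box_bump_test[OF t(2) l] by metis
    with t sv show ?thesis by (intro exI[of _ a] exI[of _ b]) auto
  qed
  have cont\<psi>: "continuous_on UNIV (?\<psi> n)" for n
    using test[of n] smooth_continuous_on by (auto simp: torus_test_def)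
  have g: "?g \<in> borel_measurable (spacetime T l)"
    using weak_deriv_spec(1)[OF \<phi>(1) \<alpha>] by (simp add: Linf_def)
  have "(\<lambda>n. integral\<^sup>L (spacetime T l) (\<lambda>z. ?g z * ?\<psi> n z)) \<longlonglongrightarrow> ?L"
  proof (rule integral_dominated_convergence[where w = "\<lambda>_. ?M"])
    show "integrable (spacetime T l) (\<lambda>_. ?M)"
      by (intro integrable_spacetime_continuous continuous_intros)
    have "(indicator (box (t1, p) (t2, q)) :: _ \<Rightarrow> real) \<in> borel_measurable (spacetime T l)"
      unfolding spacetime_def by (intro measurable_restrict_space1 borel_measurable_indicator) simp
    with g show "(\<lambda>z. ?g z * indicator (box (t1, p) (t2, q)) z) \<in> borel_measurable (spacetime T l)"
      by (rule borel_measurable_times)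
    show "(\<lambda>z. ?g z * ?\<psi> n z) \<in> borel_measurable (spacetime T l)" for n
      using g integrable_spacetime_continuous[OF cont\<psi>] by auto
    show "AE z in spacetime T l. (\<lambda>n. ?g z * ?\<psi> n z) \<longlonglongrightarrow> ?g z * indicator (box (t1, p) (t2, q)) z"
      by (rule AE_I2) (auto simp: spacetime_def intro!: tendsto_intros box_bump_tendsto pq t)
    show "AE z in spacetime T l. norm (?g z * ?\<psi> n z) \<le> ?M" for n
      using AE_weak_deriv_le[OF \<phi>(1) \<alpha>]
    proof eventually_elim
      case (elim z)
      have "\<bar>?g z\<bar> * \<bar>?\<psi> n z\<bar> \<le> ?M * 1"
        using elim box_bump_bounds[of l t1 t2 p q n z] by (intro mult_mono) auto
      then show ?case by (simp add: abs_mult)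
    qed
  qed
  moreover have "(\<lambda>n. integral ?Q (\<lambda>z. (?\<Phi> (z + s *\<^sub>R v) - ?\<Phi> z) * ?\<psi> n z)) \<longlonglongrightarrow> ?R"
    using t sv pq by (intro integral_box_bump_tendsto[OF cont\<Delta>]) auto
  ultimately show "(\<lambda>n. \<bar>s * integral\<^sup>L (spacetime T l) (\<lambda>z. ?g z * ?\<psi> n z)
      - integral ?Q (\<lambda>z. (?\<Phi> (z + s *\<^sub>R v) - ?\<Phi> z) * ?\<psi> n z)\<bar>) \<longlonglongrightarrow> \<bar>s * ?L - ?R\<bar>"
    by (intro tendsto_intros)
  have "(\<lambda>n. integral ?Q (\<lambda>z. 1 * ?\<psi> n z)) \<longlonglongrightarrow> integral (cbox (t1, p) (t2, q)) (\<lambda>_. 1)"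
    using t sv pq by (intro integral_box_bump_tendsto) auto
  then show "(\<lambda>n. ?M * integral ?Q (?\<psi> n) * s * s) \<longlonglongrightarrow> ?M * measure lborel (cbox (t1, p) (t2, q)) * s * s"
    by (intro tendsto_intros) simp
  have "\<bar>s * integral\<^sup>L (spacetime T l) (\<lambda>z. ?g z * ?\<psi> n z)
      - integral ?Q (\<lambda>z. (?\<Phi> (z + s *\<^sub>R v) - ?\<Phi> z) * ?\<psi> n z)\<bar> \<le> ?M * integral ?Q (?\<psi> n) * s * s" for n
  proof -
    obtain a b where ab: "0 < a" "b < T" "b + s * fst v < T" and \<psi>: "torus_test l a b (?\<psi> n)"
      using test by blast
    have sm: "\<forall>m. Ck m (?\<psi> n)" using \<psi> by (simp add: torus_test_def)
    have "pairing (dirderiv v (?\<psi> n)) = - integral\<^sup>L (spacetime T l) (\<lambda>z. ?g z * ?\<psi> n z)"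
      using integral_weak_deriv_eq[OF \<phi>(1) \<alpha> cont _ test_functionsI[OF \<psi> ab(1,2)]]
        smooth_continuous_on[OF smooth_dirderiv[OF sm]]
      unfolding iter_deriv_dirderiv pairing_def by simp
    moreover have "integral ?Q (\<lambda>z. (?\<Phi> (z + s *\<^sub>R v) - ?\<Phi> z) * ?\<psi> n z) =
        pairing (shift (s *\<^sub>R v) (?\<psi> n)) - pairing (?\<psi> n)"
      unfolding integral_mult_test_diff[OF continuous_translate cont \<psi>]
      using pairing_shift_eq[OF \<psi> v s ab(1,3)] by (simp add: pairing_def)
    ultimately show ?thesis
      using pairing_taylor[OF \<psi> box_bump_bounds(1) v s ab(1,3)] by (simp add: abs_le_iff)
  qed
  then show "\<exists>N. \<forall>n\<ge>N. \<bar>s * integral\<^sup>L (spacetime T l) (\<lambda>z. ?g z * ?\<psi> n z)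
      - integral ?Q (\<lambda>z. (?\<Phi> (z + s *\<^sub>R v) - ?\<Phi> z) * ?\<psi> n z)\<bar> \<le> ?M * integral ?Q (?\<psi> n) * s * s"
    by blast
qed

section \<open>Analysis of the scheme: flux inequalities and estimates for cell values\<close>

section \<open>The upwind value of the flux\<close>

text \<open>The GRP flux as a function of the two traces and the two values of \<open>div_h\<close>.
  For \<open>dt = 0\<close> it is the Godunov flux of the Burgers equation.\<close>

definition grp_value :: "real \<Rightarrow> real \<Rightarrow> real \<Rightarrow> real \<Rightarrow> real \<Rightarrow> real" where
  "grp_value dt rm rp dm dp =
     (if rp - rm < 0 \<and> (rp + rm) / 2 > 0 \<or> 0 < rm \<and> rm \<le> rp then 1 / 2 * \<bar>rm\<bar>\<^sup>2 * (1 - dt * dm)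
      else if rp - rm < 0 \<and> (rp + rm) / 2 \<le> 0 \<or> rm \<le> rp \<and> rp < 0 then 1 / 2 * \<bar>rp\<bar>\<^sup>2 * (1 - dt * dp)
      else 0)"

lemma grp_value_time_part:
  assumes "\<bar>rm\<bar> \<le> R" "\<bar>rp\<bar> \<le> R" "0 \<le> dt"
  shows "\<bar>grp_value dt rm rp dm dp - grp_value 0 rm rp dm dp\<bar> \<le> R\<^sup>2 / 2 * (dt * (\<bar>dm\<bar> + \<bar>dp\<bar>))"
proof -
  have *: "\<bar>1 / 2 * \<bar>r\<bar>\<^sup>2 * (1 - dt * e) - 1 / 2 * \<bar>r\<bar>\<^sup>2 * (1 - 0 * e)\<bar> \<le> R\<^sup>2 / 2 * (dt * (\<bar>dm\<bar> + \<bar>dp\<bar>))"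
    if "\<bar>r\<bar> \<le> R" "\<bar>e\<bar> \<le> \<bar>dm\<bar> + \<bar>dp\<bar>" for r e
  proof -
    have "1 / 2 * \<bar>r\<bar>\<^sup>2 * (1 - dt * e) - 1 / 2 * \<bar>r\<bar>\<^sup>2 * (1 - 0 * e) = - (\<bar>r\<bar>\<^sup>2 / 2 * (dt * e))"
      by (simp add: field_simps)
    then have "\<bar>1 / 2 * \<bar>r\<bar>\<^sup>2 * (1 - dt * e) - 1 / 2 * \<bar>r\<bar>\<^sup>2 * (1 - 0 * e)\<bar> = \<bar>r\<bar>\<^sup>2 / 2 * (dt * \<bar>e\<bar>)"
      using \<open>0 \<le> dt\<close> by (simp add: abs_mult)
    also have "\<dots> \<le> R\<^sup>2 / 2 * (dt * (\<bar>dm\<bar> + \<bar>dp\<bar>))"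
      using that \<open>0 \<le> dt\<close> by (intro mult_mono divide_right_mono power_mono mult_left_mono) auto
    finally show ?thesis .
  qed
  have "0 \<le> R\<^sup>2 / 2 * (dt * (\<bar>dm\<bar> + \<bar>dp\<bar>))" using \<open>0 \<le> dt\<close> by simp
  then show ?thesis
    unfolding grp_value_def using *[OF assms(1), of dm] *[OF assms(2), of dp] by auto
qed

lemma abs_square_diff_le:
  fixes a r :: real
  assumes "\<bar>a\<bar> \<le> R" "\<bar>r\<bar> \<le> R" "\<bar>r - a\<bar> \<le> j"
  shows "\<bar>1 / 2 * r\<^sup>2 - a\<^sup>2 / 2\<bar> \<le> R * j"
proof -
  have "1 / 2 * r\<^sup>2 - a\<^sup>2 / 2 = (r + a) / 2 * (r - a)"
    by (simp add: power2_eq_square field_simps)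
  then have "\<bar>1 / 2 * r\<^sup>2 - a\<^sup>2 / 2\<bar> = \<bar>r + a\<bar> / 2 * \<bar>r - a\<bar>"
    by (simp only: abs_mult abs_divide abs_numeral)
  also have "\<dots> \<le> R * j" using assms by (intro mult_mono) auto
  finally show ?thesis .
qed

text \<open>Here \<open>a\<close>, \<open>b\<close> are the adjacent cell values, and the last two
  hypotheses are what minmod guarantees about the traces. In the sonic case, where the value is 0,
  the position of the traces forces 0 to be within \<open>\<bar>b - a\<bar>\<close> of
  \<open>a\<close>, so 0 can play the role of a trace.\<close>

lemma grp_value_consistent:
  assumes "\<bar>a\<bar> \<le> R" "\<bar>b\<bar> \<le> R" "\<bar>rm\<bar> \<le> R" "\<bar>rp\<bar> \<le> R"
    and "a \<le> b \<Longrightarrow> a \<le> rm \<and> rm \<le> (a + b) / 2 \<and> (a + b) / 2 \<le> rp \<and> rp \<le> b"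
    and "b \<le> a \<Longrightarrow> b \<le> rp \<and> rp \<le> (a + b) / 2 \<and> (a + b) / 2 \<le> rm \<and> rm \<le> a"
  shows "\<bar>grp_value 0 rm rp dm dp - a\<^sup>2 / 2\<bar> \<le> R * \<bar>b - a\<bar>"
proof -
  have rm: "\<bar>rm - a\<bar> \<le> \<bar>b - a\<bar>" and rp: "\<bar>rp - a\<bar> \<le> \<bar>b - a\<bar>"
    using assms(5,6) by (cases "a \<le> b"; force simp: abs_if)+
  show ?thesis
  proof (cases "rm \<le> 0 \<and> 0 \<le> rp \<and> rm \<le> rp")
    case True
    then have "\<bar>0 - a\<bar> \<le> \<bar>b - a\<bar>"
      using assms(5,6) by (cases "a \<le> b") (auto simp: abs_if)
    from abs_square_diff_le[OF assms(1) _ this] assms(1) True show ?thesis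
      by (auto simp: grp_value_def)
  next
    case False
    then have "grp_value 0 rm rp dm dp = 1 / 2 * rm\<^sup>2 \<or> grp_value 0 rm rp dm dp = 1 / 2 * rp\<^sup>2"
      by (auto simp: grp_value_def)
    then show ?thesis
      using abs_square_diff_le[OF assms(1,3) rm] abs_square_diff_le[OF assms(1,4) rp] by auto
  qed
qed

text \<open>For \<open>dt = 0\<close> the upwind value is the minimum of \<open>u^2 / 2\<close>
  between the traces if \<open>rm \<le> rp\<close> and the maximum otherwise. The mean
  \<open>?c\<close> lies between them, so comparison with \<open>?c\<^sup>2 / 2\<close> has the
  favourable sign after multiplication by \<open>b - a\<close>; the rest is the cubic error term in
  \<open>cube\<close>.\<close>

lemma grp_value_dissipative:
  assumes "a \<le> b \<Longrightarrow> a \<le> rm \<and> rm \<le> (a + b) / 2 \<and> (a + b) / 2 \<le> rp \<and> rp \<le> b"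
    and "b \<le> a \<Longrightarrow> b \<le> rp \<and> rp \<le> (a + b) / 2 \<and> (a + b) / 2 \<le> rm \<and> rm \<le> a"
    and C1: "C1 \<le> 1 / 24"
  shows "(grp_value 0 rm rp dm dp + (if b - a \<ge> 0 then 0 else (1 / 24 + C1) * (b - a)\<^sup>2)) * (b - a)
     - (b ^ 3 - a ^ 3) / 6 \<le> - C1 * \<bar>b - a\<bar> ^ 3"
proof -
  let ?c = "(a + b) / 2"
  let ?G = "grp_value 0 rm rp dm dp"
  have cube: "(b ^ 3 - a ^ 3) / 6 = ?c\<^sup>2 / 2 * (b - a) + (b - a) ^ 3 / 24"
    by (simp add: field_simps power2_eq_square power3_eq_cube)
  have sq: "x\<^sup>2 \<le> y\<^sup>2" if "\<bar>x\<bar> \<le> \<bar>y\<bar>" for x y :: real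
    using that by (simp add: abs_le_square_iff)
  show ?thesis
  proof (cases "a \<le> b")
    case True
    have "?G \<le> ?c\<^sup>2 / 2"
      using assms(1)[OF True] sq[of rm ?c] sq[of rp ?c] by (auto simp: grp_value_def abs_if)
    then have "?G * (b - a) \<le> ?c\<^sup>2 / 2 * (b - a)"
      using True by (intro mult_right_mono) auto
    moreover have "C1 * (b - a) ^ 3 \<le> 1 / 24 * (b - a) ^ 3"
      using True C1 by (intro mult_right_mono) auto
    ultimately show ?thesis
      using True unfolding cube by simp
  next
    case False
    then have "?G \<ge> ?c\<^sup>2 / 2"
    proof -
      have "b \<le> rp" "rp \<le> ?c" "?c \<le> rm" using assms(2) False by auto
      then have "rp + rm > 0 \<Longrightarrow> ?c\<^sup>2 \<le> rm\<^sup>2" "rp + rm \<le> 0 \<Longrightarrow> ?c\<^sup>2 \<le> rp\<^sup>2" "rm \<le> rp \<Longrightarrow> ?c = rp \<and> ?c = rm"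
        by (auto intro!: sq)
      then show ?thesis
        by (auto simp: grp_value_def)
    qed
    then have "?G * (b - a) \<le> ?c\<^sup>2 / 2 * (b - a)"
      using False by (intro mult_right_mono_neg) auto
    moreover have "(?G + (1 / 24 + C1) * (b - a)\<^sup>2) * (b - a) - (?c\<^sup>2 / 2 * (b - a) + (b - a) ^ 3 / 24)
        = (?G * (b - a) - ?c\<^sup>2 / 2 * (b - a)) + C1 * (b - a) ^ 3"
    proof -
      have "(G + (1 / 24 + C1) * x\<^sup>2) * x - (c * x + x ^ 3 / 24) = (G * x - c * x) + C1 * x ^ 3" for G x c :: real
        by (simp add: algebra_simps power2_eq_square power3_eq_cube)
      then show ?thesis .
    qed
    moreover have "C1 * (b - a) ^ 3 = - C1 * \<bar>b - a\<bar> ^ 3"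
    proof -
      have "(b - a) ^ 3 = - ((a - b) ^ 3)"
        by (simp add: power3_eq_cube algebra_simps)
      then show ?thesis using False by (simp add: abs_if)
    qed
    moreover have if_eq: "(if b - a \<ge> 0 then 0 else (1 / 24 + C1) * (b - a)\<^sup>2) = (1 / 24 + C1) * (b - a)\<^sup>2"
      using False by simp
    ultimately show ?thesis
      unfolding cube if_eq by linarith
  qed
qed

lemma minmod_between:
  shows "0 \<le> x \<Longrightarrow> 0 \<le> minmod x y \<and> minmod x y \<le> x" "0 \<le> y \<Longrightarrow> 0 \<le> minmod x y \<and> minmod x y \<le> y"
    "x \<le> 0 \<Longrightarrow> minmod x y \<le> 0 \<and> x \<le> minmod x y" "y \<le> 0 \<Longrightarrow> minmod x y \<le> 0 \<and> y \<le> minmod x y"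
    "\<bar>minmod x y\<bar> \<le> \<bar>y\<bar>"
  by (auto simp: minmod_def)

section \<open>Sums over a periodic lattice\<close>

text \<open>The estimates are carried out on cell indices alone: \<open>m $ i\<close> is the number
  of cells in direction \<open>i\<close>, and functions on the torus become periodic functions on
  the integer lattice.\<close>

locale periodic_lattice =
  fixes m :: "int ^ 'n"
  assumes m_pos: "\<And>i. 0 < m $ i"
begin

definition cells :: "(int ^ 'n) set" where
  "cells = {k. \<forall>i. 0 \<le> k $ i \<and> k $ i < m $ i}"

definition lperiodic :: "(int ^ 'n \<Rightarrow> 'b) \<Rightarrow> bool" where
  "lperiodic g \<longleftrightarrow> (\<forall>k i. g (k + axis i (m $ i)) = g k)"

lemma finite_cells: "finite cells"
proof -
  have "vec_nth ` cells \<subseteq> (\<Pi>\<^sub>E i\<in>UNIV. {0..<m $ i})"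
    by (auto simp: cells_def)
  then have "finite (vec_nth ` cells)"
    by (rule finite_subset) (auto intro: finite_PiE)
  then show ?thesis
    by (rule finite_imageD) (auto simp: inj_on_def vec_nth_inject)
qed

lemma sum_shift:
  assumes g: "lperiodic (g :: _ \<Rightarrow> real)"
  shows "(\<Sum>k\<in>cells. g (k + axis i 1)) = (\<Sum>k\<in>cells. g k)"
proof -
  \<comment> \<open>Shift with wrap-around, a permutation of \<open>cells\<close> with inverse
    \<open>R\<close>; the wrap-around is invisible to a periodic \<open>g\<close>.\<close>
  define S where "S = (\<lambda>k. if k $ i + 1 < m $ i then k + axis i 1 else k + axis i 1 - axis i (m $ i))"
  define R where "R = (\<lambda>k. if k $ i \<ge> 1 then k - axis i 1 else k - axis i 1 + axis i (m $ i))"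
  have per: "g (k - axis i (m $ i)) = g k" for k
    using g[unfolded lperiodic_def, rule_format, of "k - axis i (m $ i)" i] by simp
  have S: "S k \<in> cells" "R (S k) = k" and R: "R k \<in> cells" "S (R k) = k" if "k \<in> cells" for k
  proof -
    have k: "0 \<le> k $ j" "k $ j < m $ j" for j using that by (auto simp: cells_def)
    have Sj: "S k $ j = (if j = i then if k $ i + 1 < m $ i then k $ i + 1 else k $ i + 1 - m $ i else k $ j)" for j
      by (auto simp: S_def axis_def)
    have Rj: "R k $ j = (if j = i then if k $ i \<ge> 1 then k $ i - 1 else k $ i - 1 + m $ i else k $ j)" for j
      by (auto simp: R_def axis_def)
    show "S k \<in> cells" unfolding cells_def mem_Collect_eq Sj using k m_pos by (smt (verit))
    show "R k \<in> cells" unfolding cells_def mem_Collect_eq Rj using k m_pos by (smt (verit))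
    show "R (S k) = k" unfolding R_def using k[of i] m_pos[of i] by (auto simp: Sj) (auto simp: S_def)
    show "S (R k) = k" unfolding S_def using k[of i] m_pos[of i] by (auto simp: Rj) (auto simp: R_def)
  qed
  have "(\<Sum>k\<in>cells. g (k + axis i 1)) = (\<Sum>k\<in>cells. g (S k))"
    by (rule sum.cong) (simp_all add: S_def per)
  also have "\<dots> = (\<Sum>k\<in>cells. g k)"
    by (rule sum.reindex_bij_witness[where i = R and j = S]) (use S R in auto)
  finally show ?thesis .
qed


definition face_jump :: "(int ^ 'n \<Rightarrow> real) \<Rightarrow> int ^ 'n \<Rightarrow> 'n \<Rightarrow> real" where
  "face_jump U k i = \<bar>U (k + axis i 1) - U k\<bar>"

text \<open>All jumps needed to bound the flux at the face \<open>(k, i)\<close>. A minmod slope is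
  bounded by its forward jump alone, so the forward jumps of the two adjacent cells control both
  values of \<open>div_h\<close>.\<close>

definition near_jumps :: "(int ^ 'n \<Rightarrow> real) \<Rightarrow> int ^ 'n \<Rightarrow> 'n \<Rightarrow> real" where
  "near_jumps U k i = (\<Sum>j\<in>UNIV. face_jump U k j + face_jump U (k + axis i 1) j)"

lemma lperiodic_shift: "lperiodic g \<Longrightarrow> lperiodic (\<lambda>k. g (k + a))"
  unfolding lperiodic_def by (metis add.assoc add.commute)

lemma lperiodic_comp2: "lperiodic f \<Longrightarrow> lperiodic g \<Longrightarrow> lperiodic (\<lambda>k. c (f k) (g k))"
  by (simp add: lperiodic_def)

lemma lperiodic_face_jump: "lperiodic U \<Longrightarrow> lperiodic (\<lambda>k. face_jump U k i)"
  unfolding face_jump_def using lperiodic_comp2[OF lperiodic_shift, of U U "\<lambda>x y. \<bar>x - y\<bar>"] .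

lemma face_jump_nonneg: "0 \<le> face_jump U k i"
  by (simp add: face_jump_def)

lemma near_jumps_nonneg: "0 \<le> near_jumps U k i"
  unfolding near_jumps_def by (intro sum_nonneg add_nonneg_nonneg face_jump_nonneg)

lemma face_jump_le_near: "face_jump U k i \<le> near_jumps U k i"
proof -
  have "face_jump U k i \<le> face_jump U k i + face_jump U (k + axis i 1) i"
    by (simp add: face_jump_nonneg)
  also have "\<dots> \<le> near_jumps U k i"
    unfolding near_jumps_def by (rule member_le_sum) (auto intro: add_nonneg_nonneg face_jump_nonneg)
  finally show ?thesis .
qed

abbreviation (input) face_sum :: "(int ^ 'n \<Rightarrow> 'n \<Rightarrow> real) \<Rightarrow> real" where
  "face_sum g \<equiv> \<Sum>k\<in>cells. \<Sum>i\<in>UNIV. g k i"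

text \<open>The inner sum without shift does not depend on \<open>i\<close>, and the shifted one has
  the same total by periodicity; summing over \<open>i\<close> gives each of them once per
  direction.\<close>

lemma face_sum_near:
  assumes "\<And>j. lperiodic (\<lambda>k. g k j)"
  shows "face_sum (\<lambda>k i. \<Sum>j\<in>UNIV. g k j + g (k + axis i 1) j) = 2 * real CARD('n) * face_sum g"
proof -
  have "face_sum (\<lambda>k i. \<Sum>j\<in>UNIV. g (k + axis i 1) j) = (\<Sum>i\<in>UNIV. \<Sum>k\<in>cells. \<Sum>j\<in>UNIV. g (k + axis i 1) j)"
    by (rule sum.swap)
  also have "\<dots> = (\<Sum>i\<in>(UNIV::'n set). \<Sum>j\<in>UNIV. \<Sum>k\<in>cells. g k j)"
    by (subst sum.swap) (simp add: sum_shift[OF assms])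
  also have "\<dots> = real CARD('n) * face_sum g"
    by (subst (2) sum.swap) simp
  finally show ?thesis
    by (simp add: sum.distrib flip: sum_distrib_left)
qed

lemma face_sum_near_jumps:
  assumes "lperiodic U"
  shows "face_sum (near_jumps U) = 2 * real CARD('n) * face_sum (face_jump U)"
    "face_sum (\<lambda>k i. (near_jumps U k i)\<^sup>2) \<le> 4 * (real CARD('n))\<^sup>2 * face_sum (\<lambda>k i. (face_jump U k i)\<^sup>2)"
proof -
  show "face_sum (near_jumps U) = 2 * real CARD('n) * face_sum (face_jump U)"
    unfolding near_jumps_def by (rule face_sum_near) (rule lperiodic_face_jump[OF assms])
  have "(near_jumps U k i)\<^sup>2 \<le> 2 * real CARD('n) * (\<Sum>j\<in>UNIV. (face_jump U k j)\<^sup>2 + (face_jump U (k + axis i 1) j)\<^sup>2)" for k i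
  proof -
    have "(near_jumps U k i)\<^sup>2 \<le> real CARD('n) * (\<Sum>j\<in>UNIV. (face_jump U k j + face_jump U (k + axis i 1) j)\<^sup>2)"
      unfolding near_jumps_def
      using sum_squared_le_sum_of_squares[of "\<lambda>j. face_jump U k j + face_jump U (k + axis i 1) j" UNIV]
      by (simp add: mult.commute)
    also have "\<dots> \<le> real CARD('n) * (\<Sum>j\<in>UNIV. 2 * ((face_jump U k j)\<^sup>2 + (face_jump U (k + axis i 1) j)\<^sup>2))"
    proof (intro mult_left_mono sum_mono)
      fix j
      show "(face_jump U k j + face_jump U (k + axis i 1) j)\<^sup>2
          \<le> 2 * ((face_jump U k j)\<^sup>2 + (face_jump U (k + axis i 1) j)\<^sup>2)"
        using sum_squares_bound[of "face_jump U k j" "face_jump U (k + axis i 1) j"]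
        by (simp add: power2_sum)
    qed simp
    finally show ?thesis by (simp add: sum_distrib_left mult_ac)
  qed
  then have "face_sum (\<lambda>k i. (near_jumps U k i)\<^sup>2)
    \<le> face_sum (\<lambda>k i. 2 * real CARD('n) * (\<Sum>j\<in>UNIV. (face_jump U k j)\<^sup>2 + (face_jump U (k + axis i 1) j)\<^sup>2))"
    by (intro sum_mono)
  also have "\<dots> = 2 * real CARD('n) * face_sum (\<lambda>k i. \<Sum>j\<in>UNIV. (face_jump U k j)\<^sup>2 + (face_jump U (k + axis i 1) j)\<^sup>2)"
    by (simp add: sum_distrib_left)
  also have "\<dots> = 2 * real CARD('n) * (2 * real CARD('n) * face_sum (\<lambda>k i. (face_jump U k i)\<^sup>2))"
    using lperiodic_face_jump[OF assms]
    by (subst face_sum_near) (auto simp: lperiodic_def)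
  finally show "face_sum (\<lambda>k i. (near_jumps U k i)\<^sup>2) \<le> 4 * (real CARD('n))\<^sup>2 * face_sum (\<lambda>k i. (face_jump U k i)\<^sup>2)"
    by (simp add: power2_eq_square mult_ac)
qed

lemma face_sum_near_jumps_mult:
  assumes "lperiodic U"
  shows "face_sum (\<lambda>k i. near_jumps U k i * face_jump U k i)
    \<le> (4 * (real CARD('n))\<^sup>2 + 1) / 2 * face_sum (\<lambda>k i. (face_jump U k i)\<^sup>2)"
proof -
  have "face_sum (\<lambda>k i. near_jumps U k i * face_jump U k i)
      \<le> face_sum (\<lambda>k i. ((near_jumps U k i)\<^sup>2 + (face_jump U k i)\<^sup>2) / 2)"
  proof (intro sum_mono)
    fix k i
    show "near_jumps U k i * face_jump U k i \<le> ((near_jumps U k i)\<^sup>2 + (face_jump U k i)\<^sup>2) / 2"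
      using sum_squares_bound[of "near_jumps U k i" "face_jump U k i"] by simp
  qed
  also have "\<dots> = (face_sum (\<lambda>k i. (near_jumps U k i)\<^sup>2) + face_sum (\<lambda>k i. (face_jump U k i)\<^sup>2)) / 2"
    by (simp add: sum.distrib flip: sum_divide_distrib)
  also have "\<dots> \<le> (4 * (real CARD('n))\<^sup>2 * face_sum (\<lambda>k i. (face_jump U k i)\<^sup>2) + face_sum (\<lambda>k i. (face_jump U k i)\<^sup>2)) / 2"
    using face_sum_near_jumps(2)[OF assms] by simp
  finally show ?thesis by (simp add: algebra_simps add_divide_distrib)
qed

lemma face_sum_diff_eq_0:
  assumes "lperiodic (g :: _ \<Rightarrow> real)"
  shows "face_sum (\<lambda>k i. g (k + axis i 1) - g k) = 0"
  by (subst sum.swap) (simp add: sum_subtractf sum_shift[OF assms])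

end

section \<open>Energy estimate\<close>

text \<open>Depending on whether \<open>s \<le> \<epsilon> * x\<close>, one of the two terms on the
  right alone suffices. It serves to absorb squared jumps into the cubic dissipation.\<close>

lemma young_square:
  fixes x s \<epsilon> :: real
  assumes "0 < \<epsilon>" "0 \<le> x" "0 \<le> s"
  shows "s * x\<^sup>2 \<le> \<epsilon> * x ^ 3 + s ^ 3 / \<epsilon>\<^sup>2"
proof (cases "s \<le> \<epsilon> * x")
  case True
  then have "s * x\<^sup>2 \<le> \<epsilon> * x * x\<^sup>2" by (intro mult_right_mono) auto
  moreover have "0 \<le> s ^ 3 / \<epsilon>\<^sup>2" using assms by simp
  ultimately show ?thesis by (simp add: power3_eq_cube power2_eq_square mult.assoc)
next
  case False
  then have "x \<le> s / \<epsilon>" using assms by (simp add: field_simps)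
  then have "s * x\<^sup>2 \<le> s * (s / \<epsilon>)\<^sup>2" using assms by (intro mult_left_mono power_mono) auto
  moreover have "0 \<le> \<epsilon> * x ^ 3" using assms by simp
  ultimately show ?thesis by (simp add: power3_eq_cube power2_eq_square field_simps)
qed

text \<open>Again one term suffices, according to whether \<open>s \<le> x\<close>. With
  \<open>s ^ 3 = h\<close> it trades a first power of a jump for cubes and earns the factor
  \<open>s\<close>, which is the final rate.\<close>

lemma young_linear:
  fixes x s :: real
  assumes "0 \<le> x" "0 \<le> s"
  shows "s ^ 3 * x \<le> s * (x ^ 3 + s ^ 3)"
proof (cases "s \<le> x")
  case True
  then have "s * (s\<^sup>2 * x) \<le> s * (x\<^sup>2 * x)"
    using assms by (intro mult_left_mono mult_right_mono power_mono) auto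
  moreover have "0 \<le> s * s ^ 3" using assms by simp
  ultimately show ?thesis by (simp add: power3_eq_cube power2_eq_square algebra_simps)
next
  case False
  then have "s ^ 3 * x \<le> s ^ 3 * s" using assms by (intro mult_left_mono) auto
  moreover have "0 \<le> s * x ^ 3" using assms by simp
  ultimately show ?thesis by (simp add: algebra_simps)
qed

context periodic_lattice
begin

lemma face_sum_linear:
  "face_sum (\<lambda>k i. c * f k i + g k i / d) = c * face_sum f + face_sum g / d"
  by (simp add: sum.distrib sum_distrib_left sum_divide_distrib)

text \<open>
  Testing the scheme with the discrete time derivative \<open>V\<close> itself bounds it by the jumps.
\<close>

lemma time_derivative_le_jumps:
  fixes F :: "int ^ 'n \<Rightarrow> 'n \<Rightarrow> real"
  assumes U: "lperiodic U" "\<And>k. \<bar>U k\<bar> \<le> R" and V: "lperiodic V" and h: "0 < h"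
    and F: "\<And>k i. \<bar>F k i - (U k)\<^sup>2 / 2\<bar> \<le> A * near_jumps U k i"
    and scheme: "h * (\<Sum>k\<in>cells. V k * V k) = face_sum (\<lambda>k i. F k i * (V (k + axis i 1) - V k))"
  shows "h * (\<Sum>k\<in>cells. (V k)\<^sup>2)
    \<le> 16 * real CARD('n) ^ 3 * (A + R)\<^sup>2 / h * face_sum (\<lambda>k i. (face_jump U k i)\<^sup>2)"
proof -
  let ?d = "real CARD('n)"
  \<comment> \<open>The weight in Young's inequality. The terms with \<open>V\<close> sum to
    \<open>2 * ?d\<close> times the squares of \<open>V\<close>, so division by \<open>4 * X\<close>
    leaves \<open>h / 2\<close> of them, half of the left-hand side.\<close>
  define X where "X = ?d / h"
  have X: "0 < X" using h by (simp add: X_def)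
  have R: "0 \<le> R" using U(2)[of 0] by linarith
  \<comment> \<open>Subtracting the difference of \<open>U\<^sup>2 / 2 * V\<close>, which telescopes
    to 0, replaces the flux by quantities that vanish with the jumps.\<close>
  have point: "F k i * (V (k + axis i 1) - V k)
      - ((U (k + axis i 1))\<^sup>2 / 2 * V (k + axis i 1) - (U k)\<^sup>2 / 2 * V k)
    \<le> 2 * X * (A + R)\<^sup>2 * (near_jumps U k i)\<^sup>2 + ((V (k + axis i 1))\<^sup>2 + (V k)\<^sup>2) / (4 * X)" for k i
  proof -
    let ?N = "near_jumps U k i" and ?V = "V (k + axis i 1)" and ?U = "U (k + axis i 1)"
    have young: "(A + R) * ?N * \<bar>v\<bar> \<le> X * (A + R)\<^sup>2 * ?N\<^sup>2 + v\<^sup>2 / (4 * X)" for v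
    proof -
      have "0 \<le> (2 * X * ((A + R) * ?N) - \<bar>v\<bar>)\<^sup>2" by simp
      then have "4 * X * ((A + R) * ?N * \<bar>v\<bar>) \<le> 4 * X * (X * (A + R)\<^sup>2 * ?N\<^sup>2 + v\<^sup>2 / (4 * X))"
        using X by (simp add: power2_diff power_mult_distrib algebra_simps power2_eq_square)
      then show ?thesis using X by (simp add: mult_le_cancel_left_pos)
    qed
    have "\<bar>?U\<^sup>2 / 2 - (U k)\<^sup>2 / 2\<bar> \<le> R * ?N"
    proof -
      have "\<bar>1 / 2 * ?U\<^sup>2 - (U k)\<^sup>2 / 2\<bar> \<le> R * face_jump U k i"
        by (rule abs_square_diff_le) (auto simp: U face_jump_def)
      also have "\<dots> \<le> R * ?N" by (intro mult_left_mono face_jump_le_near R)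
      finally show ?thesis by simp
    qed
    then have 1: "\<bar>(?U\<^sup>2 / 2 - (U k)\<^sup>2 / 2) * ?V\<bar> \<le> R * ?N * \<bar>?V\<bar>"
      unfolding abs_mult by (rule mult_right_mono) simp
    have 2: "\<bar>(F k i - (U k)\<^sup>2 / 2) * (?V - V k)\<bar> \<le> A * ?N * (\<bar>?V\<bar> + \<bar>V k\<bar>)"
      unfolding abs_mult
    proof (rule mult_mono[OF F])
      show "0 \<le> A * ?N" using F[of k i] by linarith
    qed auto
    have "0 \<le> R * ?N * \<bar>V k\<bar>" using R near_jumps_nonneg by simp
    have "F k i * (?V - V k) - (?U\<^sup>2 / 2 * ?V - (U k)\<^sup>2 / 2 * V k)
        = (F k i - (U k)\<^sup>2 / 2) * (?V - V k) - (?U\<^sup>2 / 2 - (U k)\<^sup>2 / 2) * ?V"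
      by (simp add: field_simps)
    also have "\<dots> \<le> (A + R) * ?N * \<bar>?V\<bar> + (A + R) * ?N * \<bar>V k\<bar>"
    proof -
      have "(A + R) * ?N * \<bar>?V\<bar> + (A + R) * ?N * \<bar>V k\<bar> =
          A * ?N * (\<bar>?V\<bar> + \<bar>V k\<bar>) + R * ?N * \<bar>?V\<bar> + R * ?N * \<bar>V k\<bar>"
        by (simp add: algebra_simps)
      then show ?thesis
        using abs_ge_minus_self[of "(?U\<^sup>2 / 2 - (U k)\<^sup>2 / 2) * ?V"]
          abs_ge_self[of "(F k i - (U k)\<^sup>2 / 2) * (?V - V k)"] 1 2 \<open>0 \<le> R * ?N * \<bar>V k\<bar>\<close>
        by (smt (verit))
    qed
    also have "\<dots> \<le> 2 * X * (A + R)\<^sup>2 * ?N\<^sup>2 + (?V\<^sup>2 + (V k)\<^sup>2) / (4 * X)"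
      using young[of ?V] young[of "V k"] by (simp add: add_divide_distrib)
    finally show ?thesis .
  qed
  have telescope: "face_sum (\<lambda>k i. (U (k + axis i 1))\<^sup>2 / 2 * V (k + axis i 1) - (U k)\<^sup>2 / 2 * V k) = 0"
    using face_sum_diff_eq_0[of "\<lambda>k. (U k)\<^sup>2 / 2 * V k"] U V by (simp add: lperiodic_def)
  have VV: "face_sum (\<lambda>k i. (V (k + axis i 1))\<^sup>2 + (V k)\<^sup>2) = 2 * ?d * (\<Sum>k\<in>cells. (V k)\<^sup>2)"
    using sum_shift[of "\<lambda>k. (V k)\<^sup>2"] V
    by (simp add: sum.distrib sum_distrib_left sum.swap[of _ UNIV cells] lperiodic_def mult.assoc)
  have "h * (\<Sum>k\<in>cells. (V k)\<^sup>2) = face_sum (\<lambda>k i. F k i * (V (k + axis i 1) - V k)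
      - ((U (k + axis i 1))\<^sup>2 / 2 * V (k + axis i 1) - (U k)\<^sup>2 / 2 * V k))"
  proof -
    have "h * (\<Sum>k\<in>cells. (V k)\<^sup>2) = face_sum (\<lambda>k i. F k i * (V (k + axis i 1) - V k)) - 0"
      using scheme by (simp only: power2_eq_square diff_0_right)
    then show ?thesis unfolding telescope[symmetric] sum_subtractf[symmetric] .
  qed
  also have "\<dots> \<le> face_sum (\<lambda>k i. 2 * X * (A + R)\<^sup>2 * (near_jumps U k i)\<^sup>2
      + ((V (k + axis i 1))\<^sup>2 + (V k)\<^sup>2) / (4 * X))"
    by (intro sum_mono point)
  also have "\<dots> = 2 * X * (A + R)\<^sup>2 * face_sum (\<lambda>k i. (near_jumps U k i)\<^sup>2)
      + face_sum (\<lambda>k i. (V (k + axis i 1))\<^sup>2 + (V k)\<^sup>2) / (4 * X)"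
    by (rule face_sum_linear)
  also have "\<dots> \<le> 2 * X * (A + R)\<^sup>2 * (4 * ?d\<^sup>2 * face_sum (\<lambda>k i. (face_jump U k i)\<^sup>2))
      + h / 2 * (\<Sum>k\<in>cells. (V k)\<^sup>2)"
  proof (rule add_mono)
    show "2 * X * (A + R)\<^sup>2 * face_sum (\<lambda>k i. (near_jumps U k i)\<^sup>2)
      \<le> 2 * X * (A + R)\<^sup>2 * (4 * ?d\<^sup>2 * face_sum (\<lambda>k i. (face_jump U k i)\<^sup>2))"
      using X by (intro mult_left_mono face_sum_near_jumps(2) U) auto
    show "face_sum (\<lambda>k i. (V (k + axis i 1))\<^sup>2 + (V k)\<^sup>2) / (4 * X) \<le> h / 2 * (\<Sum>k\<in>cells. (V k)\<^sup>2)"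
      unfolding VV X_def using h by simp
  qed
  finally have "h * (\<Sum>k\<in>cells. (V k)\<^sup>2) / 2 \<le>
      2 * X * (A + R)\<^sup>2 * (4 * ?d\<^sup>2 * face_sum (\<lambda>k i. (face_jump U k i)\<^sup>2))" by simp
  moreover have "16 * ?d ^ 3 * (A + R)\<^sup>2 / h * S = 2 * (2 * X * (A + R)\<^sup>2 * (4 * ?d\<^sup>2 * S))" for S
    by (simp add: X_def power2_eq_square power3_eq_cube)
  ultimately show ?thesis by simp
qed

text \<open>The energy is half the squared norm divided by the face measure, hence the factor
  \<open>h\<close>. Expanding \<open>U' = U + dt * V\<close>, the cross term is the scheme tested
  with \<open>U\<close>, from which the telescoping potential \<open>U ^ 3 / 6\<close> is
  subtracted; the term \<open>dt\<^sup>2 * V\<^sup>2\<close> is the price of the explicit step, paid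
  by \<open>time_derivative_le_jumps\<close>.\<close>

lemma energy_step:
  fixes F :: "int ^ 'n \<Rightarrow> 'n \<Rightarrow> real"
  assumes U: "lperiodic U" "\<And>k. \<bar>U k\<bar> \<le> R" and U': "lperiodic U'" and h: "0 < h" and dt: "0 < dt"
    and F: "\<And>k i. \<bar>F k i - (U k)\<^sup>2 / 2\<bar> \<le> A * near_jumps U k i"
    and diss: "\<And>k i. F k i * (U (k + axis i 1) - U k) - ((U (k + axis i 1)) ^ 3 - (U k) ^ 3) / 6
      \<le> - C1 * face_jump U k i ^ 3 + B * (dt / h) * (near_jumps U k i * face_jump U k i)"
    and B: "0 \<le> B"
    and scheme: "\<And>P. lperiodic P \<Longrightarrow>
      h * (\<Sum>k\<in>cells. P k * ((U' k - U k) / dt)) = face_sum (\<lambda>k i. F k i * (P (k + axis i 1) - P k))"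
  shows "h / 2 * (\<Sum>k\<in>cells. (U' k)\<^sup>2) - h / 2 * (\<Sum>k\<in>cells. (U k)\<^sup>2)
    \<le> dt * (- C1 * face_sum (\<lambda>k i. face_jump U k i ^ 3)
      + (B * ((4 * (real CARD('n))\<^sup>2 + 1) / 2) + 8 * real CARD('n) ^ 3 * (A + R)\<^sup>2) * (dt / h)
         * face_sum (\<lambda>k i. (face_jump U k i)\<^sup>2))"
proof -
  let ?d = "real CARD('n)"
  let ?S2 = "face_sum (\<lambda>k i. (face_jump U k i)\<^sup>2)" and ?S3 = "face_sum (\<lambda>k i. face_jump U k i ^ 3)"
  define V where "V = (\<lambda>k. (U' k - U k) / dt)"
  have V: "lperiodic V" using U U' by (simp add: V_def lperiodic_def)
  have sV: "h * (\<Sum>k\<in>cells. (V k)\<^sup>2) \<le> 16 * ?d ^ 3 * (A + R)\<^sup>2 / h * ?S2"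
    by (rule time_derivative_le_jumps[OF U V h F]) (use scheme[OF V] in \<open>simp add: V_def\<close>)
  have telescope: "face_sum (\<lambda>k i. ((U (k + axis i 1)) ^ 3 - (U k) ^ 3) / 6) = 0"
    using face_sum_diff_eq_0[of "\<lambda>k. (U k) ^ 3 / 6"] U by (simp add: lperiodic_def diff_divide_distrib)
  have "h * (\<Sum>k\<in>cells. U k * V k) = face_sum (\<lambda>k i. F k i * (U (k + axis i 1) - U k)
      - ((U (k + axis i 1)) ^ 3 - (U k) ^ 3) / 6)"
    using scheme[OF U(1)] telescope by (simp add: sum_subtractf V_def)
  also have "\<dots> \<le> face_sum (\<lambda>k i. - C1 * face_jump U k i ^ 3
      + B * (dt / h) * (near_jumps U k i * face_jump U k i))"
    by (intro sum_mono diss)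
  also have "\<dots> = - C1 * ?S3 + B * (dt / h) * face_sum (\<lambda>k i. near_jumps U k i * face_jump U k i)"
    unfolding sum.distrib sum_distrib_left ..
  also have "\<dots> \<le> - C1 * ?S3 + B * (dt / h) * ((4 * ?d\<^sup>2 + 1) / 2 * ?S2)"
    using B h dt by (intro add_left_mono mult_left_mono face_sum_near_jumps_mult U) auto
  finally have sU: "h * (\<Sum>k\<in>cells. U k * V k) \<le> - C1 * ?S3 + B * (dt / h) * ((4 * ?d\<^sup>2 + 1) / 2 * ?S2)" .
  have "(U' k)\<^sup>2 = (U k)\<^sup>2 + 2 * dt * (U k * V k) + dt\<^sup>2 * (V k)\<^sup>2" for k
  proof -
    have "U' k = U k + dt * V k" using dt by (simp add: V_def)
    then show ?thesis by (simp add: power2_sum power_mult_distrib)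
  qed
  then have "(\<Sum>k\<in>cells. (U' k)\<^sup>2) =
      (\<Sum>k\<in>cells. (U k)\<^sup>2) + 2 * dt * (\<Sum>k\<in>cells. U k * V k) + dt\<^sup>2 * (\<Sum>k\<in>cells. (V k)\<^sup>2)"
    by (simp add: sum.distrib sum_distrib_left)
  then have "h / 2 * (\<Sum>k\<in>cells. (U' k)\<^sup>2) - h / 2 * (\<Sum>k\<in>cells. (U k)\<^sup>2)
    = dt * (h * (\<Sum>k\<in>cells. U k * V k)) + dt * (dt / 2) * (h * (\<Sum>k\<in>cells. (V k)\<^sup>2))"
    by (simp add: power2_eq_square algebra_simps)
  also have "\<dots> \<le> dt * (- C1 * ?S3 + B * (dt / h) * ((4 * ?d\<^sup>2 + 1) / 2 * ?S2))
      + dt * (dt / 2) * (16 * ?d ^ 3 * (A + R)\<^sup>2 / h * ?S2)"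
    using dt by (intro add_mono mult_left_mono sU sV) auto
  finally show ?thesis by (simp add: algebra_simps)
qed

text \<open>The parameter \<open>s\<close> is the cube root of \<open>h\<close>, so that all
  exponents are integers. The energy differences telescope over the time steps, and the final energy
  is dropped because it is nonnegative.\<close>

lemma sum_cubed_jumps_le:
  fixes F :: "nat \<Rightarrow> int ^ 'n \<Rightarrow> 'n \<Rightarrow> real"
  assumes U: "\<And>n. n \<le> M \<Longrightarrow> lperiodic (U n)" "\<And>n k. n \<le> M \<Longrightarrow> \<bar>U n k\<bar> \<le> R"
    and s: "0 < s" and dt: "0 < dt" "dt \<le> C2 * s ^ 4" and C: "0 < C1" "0 \<le> C2"
    and F: "\<And>n k i. n < M \<Longrightarrow> \<bar>F n k i - (U n k)\<^sup>2 / 2\<bar> \<le> A * near_jumps (U n) k i"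
    and diss: "\<And>n k i. n < M \<Longrightarrow> F n k i * (U n (k + axis i 1) - U n k)
      - ((U n (k + axis i 1)) ^ 3 - (U n k) ^ 3) / 6
      \<le> - C1 * face_jump (U n) k i ^ 3 + B * (dt / s ^ 3) * (near_jumps (U n) k i * face_jump (U n) k i)"
    and B: "0 \<le> B"
    and scheme: "\<And>n P. n < M \<Longrightarrow> lperiodic P \<Longrightarrow>
      s ^ 3 * (\<Sum>k\<in>cells. P k * ((U (Suc n) k - U n k) / dt))
        = face_sum (\<lambda>k i. F n k i * (P (k + axis i 1) - P k))"
    and K_def: "K = C2 * (B * ((4 * (real CARD('n))\<^sup>2 + 1) / 2) + 8 * real CARD('n) ^ 3 * (A + R)\<^sup>2)"
  shows "C1 / 2 * (\<Sum>n<M. dt * face_sum (\<lambda>k i. face_jump (U n) k i ^ 3))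
    \<le> s ^ 3 * real (card cells) * (R\<^sup>2 / 2
        + real M * dt * (K * real CARD('n) / (C1 / (2 * (K + 1)))\<^sup>2))"
proof -
  let ?d = "real CARD('n)"
  \<comment> \<open>Chosen so that \<open>K * \<epsilon> \<le> C1 / 2\<close>: absorption costs at
    most half of the dissipation. The summand 1 avoids division by 0 if
    \<open>K = 0\<close>.\<close>
  define \<epsilon> where "\<epsilon> = C1 / (2 * (K + 1))"
  define E where "E = (\<lambda>n. s ^ 3 / 2 * (\<Sum>k\<in>cells. (U n k)\<^sup>2))"
  define Z where "Z = s ^ 3 * real (card cells) * (K * ?d / \<epsilon>\<^sup>2)"
  have K: "0 \<le> K" unfolding K_def using B C by (intro mult_nonneg_nonneg add_nonneg_nonneg) auto
  have \<epsilon>: "0 < \<epsilon>" "K * \<epsilon> \<le> C1 / 2" using K C by (auto simp: \<epsilon>_def field_simps)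
  have step: "E (Suc n) - E n \<le> dt * (- (C1 / 2) * face_sum (\<lambda>k i. face_jump (U n) k i ^ 3) + Z)" if "n < M" for n
  proof -
    let ?S2 = "face_sum (\<lambda>k i. (face_jump (U n) k i)\<^sup>2)" and ?S3 = "face_sum (\<lambda>k i. face_jump (U n) k i ^ 3)"
    let ?B = "B * ((4 * ?d\<^sup>2 + 1) / 2) + 8 * ?d ^ 3 * (A + R)\<^sup>2"
    have B': "0 \<le> ?B" using B by simp
    have S: "0 \<le> ?S2" "0 \<le> ?S3" by (auto intro!: sum_nonneg simp: face_jump_nonneg)
    have "E (Suc n) - E n \<le> dt * (- C1 * ?S3 + ?B * (dt / s ^ 3) * ?S2)"
      unfolding E_def using that s dt
      by (intro energy_step[where F = "F n"] U F diss B scheme) auto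
    also have "\<dots> \<le> dt * (- C1 * ?S3 + K * (s * ?S2))"
    proof (intro mult_left_mono add_left_mono)
      \<comment> \<open>The time step restriction enters here: \<open>dt / h\<close> is of order
        \<open>s\<close>, which makes \<open>young_square\<close> applicable.\<close>
      have "dt / s ^ 3 \<le> C2 * s" using dt s by (simp add: field_simps power_numeral_reduce)
      then have "?B * (dt / s ^ 3) * ?S2 \<le> ?B * (C2 * s) * ?S2"
        using B' S by (intro mult_right_mono mult_left_mono) auto
      then show "?B * (dt / s ^ 3) * ?S2 \<le> K * (s * ?S2)" by (simp add: K_def mult_ac)
    qed (use dt in auto)
    also have "\<dots> \<le> dt * (- C1 * ?S3 + K * (\<epsilon> * ?S3 + real (card cells) * ?d * (s ^ 3 / \<epsilon>\<^sup>2)))"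
    proof (intro mult_left_mono add_left_mono)
      have "s * ?S2 = face_sum (\<lambda>k i. s * (face_jump (U n) k i)\<^sup>2)"
        by (simp add: sum_distrib_left)
      also have "\<dots> \<le> face_sum (\<lambda>k i. \<epsilon> * face_jump (U n) k i ^ 3 + s ^ 3 / \<epsilon>\<^sup>2)"
        using s \<epsilon> by (intro sum_mono young_square face_jump_nonneg) auto
      also have "\<dots> = \<epsilon> * ?S3 + real (card cells) * ?d * (s ^ 3 / \<epsilon>\<^sup>2)"
        by (simp add: sum.distrib sum_distrib_left)
      finally show "s * ?S2 \<le> \<epsilon> * ?S3 + real (card cells) * ?d * (s ^ 3 / \<epsilon>\<^sup>2)" .
    qed (use K dt in auto)
    also have "\<dots> = dt * (- C1 * ?S3 + (K * \<epsilon>) * ?S3 + Z)"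
      by (simp add: Z_def algebra_simps)
    also have "\<dots> \<le> dt * (- (C1 / 2) * ?S3 + Z)"
      using mult_right_mono[OF \<epsilon>(2) S(2)] dt by (intro mult_left_mono) auto
    finally show ?thesis .
  qed
  have "E M - E 0 = (\<Sum>n<M. E (Suc n) - E n)" by (rule sum_lessThan_telescope[symmetric])
  also have "\<dots> \<le> (\<Sum>n<M. dt * (- (C1 / 2) * face_sum (\<lambda>k i. face_jump (U n) k i ^ 3) + Z))"
    by (intro sum_mono step) auto
  also have "\<dots> = - (C1 / 2) * (\<Sum>n<M. dt * face_sum (\<lambda>k i. face_jump (U n) k i ^ 3)) + real M * dt * Z"
    by (simp add: sum.distrib sum_distrib_left algebra_simps sum_subtractf)
  finally have "C1 / 2 * (\<Sum>n<M. dt * face_sum (\<lambda>k i. face_jump (U n) k i ^ 3)) \<le> E 0 - E M + real M * dt * Z"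
    by simp
  also have "\<dots> \<le> E 0 + real M * dt * Z"
    using s by (simp add: E_def sum_nonneg)
  also have "E 0 \<le> s ^ 3 / 2 * (\<Sum>k\<in>cells. R\<^sup>2)"
    unfolding E_def using s U(2)[of 0]
    by (intro mult_left_mono sum_mono) (auto simp: abs_le_square_iff[symmetric] intro: order_trans[OF _ abs_ge_self])
  finally show ?thesis by (simp add: Z_def \<epsilon>_def algebra_simps)
qed

end

section \<open>From functions on the torus to cell values, and conclusion\<close>

section \<open>Traces and fluxes on the mesh\<close>

text \<open>\<open>S\<close> lies between the union of the open boxes and that of the closed ones,
  which differ by a null set. Hence \<open>f\<close> has to be known only inside the open boxes, and
  the choice of half-open cells does not matter.\<close>

lemma integral_lebesgue_cover:
  fixes f :: "'a::euclidean_space \<Rightarrow> real"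
  assumes S: "S \<in> sets lebesgue" and I: "finite I"
    and cover: "S \<subseteq> (\<Union>i\<in>I. cbox (a i) (b i))" and sub: "\<And>i. i \<in> I \<Longrightarrow> box (a i) (b i) \<subseteq> S"
    and disj: "\<And>i j. i \<in> I \<Longrightarrow> j \<in> I \<Longrightarrow> i \<noteq> j \<Longrightarrow> box (a i) (b i) \<inter> box (a j) (b j) = {}"
    and F: "\<And>i z. i \<in> I \<Longrightarrow> z \<in> box (a i) (b i) \<Longrightarrow> f z = F i z"
    and int: "\<And>i. i \<in> I \<Longrightarrow> integrable lebesgue (\<lambda>z. indicator (box (a i) (b i)) z * F i z)"
  shows "integral\<^sup>L (lebesgue_on S) f = (\<Sum>i\<in>I. integral\<^sup>L lebesgue (\<lambda>z. indicator (box (a i) (b i)) z * F i z))"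
proof -
  let ?N = "\<Union>i\<in>I. cbox (a i) (b i) - box (a i) (b i)"
  let ?G = "\<lambda>z. \<Sum>i\<in>I. indicator (box (a i) (b i)) z * F i z"
  have "negligible ?N"
    by (rule negligible_Union) (auto simp: I negligible_frontier_interval)
  then have "AE z in lebesgue. z \<notin> ?N"
    using AE_not_in[of ?N lebesgue] by (simp only: negligible_iff_null_sets)
  moreover have "?G z = indicator S z *\<^sub>R f z" if z: "z \<notin> ?N" for z
  proof (cases "z \<in> S")
    case True
    with cover z obtain i where i: "i \<in> I" "z \<in> box (a i) (b i)" by auto
    have "?G z = (\<Sum>j\<in>I. if j = i then F i z else 0)"
      by (rule sum.cong) (use i disj in \<open>auto simp: indicator_def\<close>)
    with i I True F show ?thesis by simp
  next
    case False
    with sub have "z \<notin> box (a i) (b i)" if "i \<in> I" for i using that by blast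
    with False show ?thesis by (simp add: indicator_def)
  qed
  ultimately have ae: "AE z in lebesgue. ?G z = indicator S z *\<^sub>R f z"
    by (rule eventually_mono)
  have meas: "?G \<in> borel_measurable lebesgue"
    using int by (intro borel_measurable_sum) auto
  have "integral\<^sup>L (lebesgue_on S) f = integral\<^sup>L lebesgue (\<lambda>z. indicator S z *\<^sub>R f z)"
    using S by (intro integral_restrict_space) auto
  also have "\<dots> = integral\<^sup>L lebesgue ?G"
    by (rule integral_cong_AE[symmetric]; (rule meas ae borel_measurable_AE[OF meas ae])?)
  also have "\<dots> = (\<Sum>i\<in>I. integral\<^sup>L lebesgue (\<lambda>z. indicator (box (a i) (b i)) z * F i z))"
    by (rule Bochner_Integration.integral_sum) (rule int)
  finally show ?thesis .
qed

lemma integral_indicator_box_continuous: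
  fixes g :: "'a::euclidean_space \<Rightarrow> real"
  assumes g: "continuous_on UNIV g"
  shows "integrable lebesgue (\<lambda>z. indicator (box a b) z * g z)"
    "integral\<^sup>L lebesgue (\<lambda>z. indicator (box a b) z * g z) = integral (cbox a b) g"
proof -
  have "g absolutely_integrable_on cbox a b"
    by (intro absolutely_integrable_continuous continuous_on_subset[OF g]) auto
  then have int: "set_integrable lebesgue (box a b) g"
    by (rule set_integrable_subset) (auto simp: box_subset_cbox)
  then show "integrable lebesgue (\<lambda>z. indicator (box a b) z * g z)"
    by (simp add: set_integrable_def)
  show "integral\<^sup>L lebesgue (\<lambda>z. indicator (box a b) z * g z) = integral (cbox a b) g"
    using set_lebesgue_integral_eq_integral(2)[OF int]
    by (simp add: set_lebesgue_integral_def integral_open_interval)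
qed

lemma cell_index_eq_iff:
  assumes "0 < h"
  shows "cell_index h x = k \<longleftrightarrow> x \<in> cell h k"
  using assms
  by (simp add: cell_index_def cell_def vec_eq_iff floor_eq_iff pos_le_divide_eq pos_divide_less_eq mult.commute)

lemma cell_center_in_cell: "0 < h \<Longrightarrow> cell_center h k \<in> cell h k"
  by (simp add: cell_center_def cell_def)

lemma cell_center_shift: "cell_center h (k + axis i c) = cell_center h k + axis i (h * of_int c)"
  by (simp add: cell_center_def vec_eq_iff axis_def algebra_simps)

lemma face_center_plus:
  assumes "0 < h" "0 < \<delta>" "\<delta> < h"
  shows "cell_index h (face_center h (k, i) + \<delta> *\<^sub>R axis i 1) = k + axis i 1"
proof -
  have "(face_center h (k, i) + \<delta> *\<^sub>R axis i 1) $ j =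
      h * of_int ((k + axis i 1) $ j) + (if j = i then \<delta> else h / 2)" for j
    by (simp add: face_center_def cell_center_def axis_def algebra_simps)
  then show ?thesis
    unfolding cell_index_eq_iff[OF assms(1)] using assms by (simp add: cell_def algebra_simps)
qed

lemma face_center_minus:
  assumes "0 < h" "0 < \<delta>" "\<delta> < h"
  shows "cell_index h (face_center h (k, i) - \<delta> *\<^sub>R axis i 1) = k"
proof -
  have "(face_center h (k, i) - \<delta> *\<^sub>R axis i 1) $ j =
      h * of_int (k $ j) + (if j = i then h - \<delta> else h / 2)" for j
    by (simp add: face_center_def cell_center_def axis_def algebra_simps)
  then show ?thesis
    unfolding cell_index_eq_iff[OF assms(1)] using assms by (simp add: cell_def algebra_simps)
qed

lemma trace_plus_eqI:
  assumes "0 < h" "(g \<longlongrightarrow> L) (at_right 0)"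
    "\<And>\<delta>. 0 < \<delta> \<Longrightarrow> \<delta> < h \<Longrightarrow> v (face_center h (k, i) + \<delta> *\<^sub>R axis i 1) = g \<delta>"
  shows "trace_plus h v (k, i) = L"
proof -
  have "eventually (\<lambda>\<delta>. g \<delta> = v (face_center h (k, i) + \<delta> *\<^sub>R axis i 1)) (at_right 0)"
    unfolding eventually_at_right_field using assms(1,3) by (intro exI[of _ h]) auto
  from Lim_transform_eventually[OF assms(2) this] show ?thesis
    unfolding trace_plus_def by (simp add: tendsto_Lim)
qed

lemma trace_minus_eqI:
  assumes "0 < h" "(g \<longlongrightarrow> L) (at_right 0)"
    "\<And>\<delta>. 0 < \<delta> \<Longrightarrow> \<delta> < h \<Longrightarrow> v (face_center h (k, i) - \<delta> *\<^sub>R axis i 1) = g \<delta>"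
  shows "trace_minus h v (k, i) = L"
proof -
  have "eventually (\<lambda>\<delta>. g \<delta> = v (face_center h (k, i) - \<delta> *\<^sub>R axis i 1)) (at_right 0)"
    unfolding eventually_at_right_field using assms(1,3) by (intro exI[of _ h]) auto
  from Lim_transform_eventually[OF assms(2) this] show ?thesis
    unfolding trace_minus_def by (simp add: tendsto_Lim)
qed

lemma traces_of_cell_index:
  assumes "0 < h"
  shows "trace_plus h (\<lambda>x. G (cell_index h x)) (k, i) = G (k + axis i 1)"
    "trace_minus h (\<lambda>x. G (cell_index h x)) (k, i) = G k"
  by (rule trace_plus_eqI[OF assms tendsto_const] trace_minus_eqI[OF assms tendsto_const],
      simp add: face_center_plus face_center_minus assms)+

text \<open>On the normal through the face centre, \<open>x - cell_center\<close> is parallel to the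
  \<open>i\<close>-th axis, so only the \<open>i\<close>-th slope contributes, at distance
  \<open>h / 2\<close> in the limit.\<close>

lemma traces_reconstruct:
  assumes "0 < h"
  shows "trace_plus h (reconstruct h u) (k, i)
      = u (cell_center h (k + axis i 1)) - h / 2 * slope h u (k + axis i 1) $ i"
    "trace_minus h (reconstruct h u) (k, i) = u (cell_center h k) + h / 2 * slope h u k $ i"
proof -
  have 1: "face_center h (k, i) + \<delta> *\<^sub>R axis i 1 - cell_center h (k + axis i 1) = axis i (\<delta> - h / 2)" for \<delta>
    unfolding cell_center_shift by (simp add: face_center_def vec_eq_iff axis_def)
  have 2: "face_center h (k, i) - \<delta> *\<^sub>R axis i 1 - cell_center h k = axis i (h / 2 - \<delta>)" for \<delta>
    by (simp add: face_center_def vec_eq_iff axis_def)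
  have "((\<lambda>\<delta>. u (cell_center h (k + axis i 1)) + (\<delta> - h / 2) * slope h u (k + axis i 1) $ i)
      \<longlongrightarrow> u (cell_center h (k + axis i 1)) + (0 - h / 2) * slope h u (k + axis i 1) $ i) (at_right 0)"
    by (intro tendsto_intros)
  then show "trace_plus h (reconstruct h u) (k, i)
      = u (cell_center h (k + axis i 1)) - h / 2 * slope h u (k + axis i 1) $ i"
    using assms by (intro trace_plus_eqI[OF assms])
      (auto simp: reconstruct_def face_center_plus 1 inner_axis' Let_def)
  have "((\<lambda>\<delta>. u (cell_center h k) + (h / 2 - \<delta>) * slope h u k $ i)
      \<longlongrightarrow> u (cell_center h k) + (h / 2 - 0) * slope h u k $ i) (at_right 0)"
    by (intro tendsto_intros)
  then show "trace_minus h (reconstruct h u) (k, i) = u (cell_center h k) + h / 2 * slope h u k $ i"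
    using assms by (intro trace_minus_eqI[OF assms])
      (auto simp: reconstruct_def face_center_minus 2 inner_axis' Let_def)
qed

lemma Qh_eq_cell_index:
  assumes "0 < h" "u \<in> Qh l h"
  shows "u x = u (cell_center h (cell_index h x))"
  using assms cell_index_eq_iff[OF assms(1), of x "cell_index h x"] by (auto simp: Qh_def)

lemma jump_Qh:
  assumes "0 < h" "u \<in> Qh l h"
  shows "jump h u (k, i) = u (cell_center h (k + axis i 1)) - u (cell_center h k)"
proof -
  have "u = (\<lambda>x. u (cell_center h (cell_index h x)))"
    using Qh_eq_cell_index[OF assms] by blast
  then show ?thesis
    unfolding jump_def using traces_of_cell_index[OF assms(1), of "\<lambda>k. u (cell_center h k)" k i] by simp
qed

lemma grp_flux_new_eq:
  assumes "0 < h" "u \<in> Qh l h"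
  shows "grp_flux_new C1 h dt u (k, i) =
    grp_value dt (u (cell_center h k) + h / 2 * slope h u k $ i)
      (u (cell_center h (k + axis i 1)) - h / 2 * slope h u (k + axis i 1) $ i)
      (\<Sum>j\<in>UNIV. slope h u k $ j) (\<Sum>j\<in>UNIV. slope h u (k + axis i 1) $ j)
    + (if u (cell_center h (k + axis i 1)) - u (cell_center h k) \<ge> 0 then 0
       else (1 / 24 + C1) * (u (cell_center h (k + axis i 1)) - u (cell_center h k))\<^sup>2)"
proof -
  have div: "trace_plus h (div_h h u) (k, i) = (\<Sum>j\<in>UNIV. slope h u (k + axis i 1) $ j)"
    "trace_minus h (div_h h u) (k, i) = (\<Sum>j\<in>UNIV. slope h u k $ j)"
    unfolding div_h_def[abs_def] by (rule traces_of_cell_index[OF assms(1)])+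
  have if_add: "(if P then G else G + q) = G + (if P then 0 else q)" for P and G q :: real
    by simp
  show ?thesis
    unfolding grp_flux_new_def grp_flux_def Let_def grp_value_def jump_Qh[OF assms]
      jump_def[of h "reconstruct h u"] avg_def traces_reconstruct[OF assms(1)] div
    by (rule if_add)
qed

context periodic_lattice
begin

text \<open>The only two facts about the GRP flux that the lattice estimates use: consistency up to
  nearby jumps, and dissipation up to the \<open>dt\<close>-part of the flux.\<close>

lemma grp_flux_bounds:
  fixes l :: "real ^ 'n"
  assumes h: "0 < h" and u: "u \<in> Qh l h" and R: "\<And>k. \<bar>u (cell_center h k)\<bar> \<le> R"
    and dt: "0 \<le> dt" "dt / h \<le> C" and C1: "0 < C1" "C1 \<le> 1 / 24"
  defines "U \<equiv> \<lambda>k. u (cell_center h k)"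
  shows "\<bar>grp_flux_new C1 h dt u (k, i) - (U k)\<^sup>2 / 2\<bar> \<le> (2 * R + R\<^sup>2 / 2 * C) * near_jumps U k i"
    and "grp_flux_new C1 h dt u (k, i) * (U (k + axis i 1) - U k) - ((U (k + axis i 1)) ^ 3 - (U k) ^ 3) / 6
      \<le> - C1 * face_jump U k i ^ 3 + R\<^sup>2 / 2 * (dt / h) * (near_jumps U k i * face_jump U k i)"
proof -
  define a b where "a = U k" and "b = U (k + axis i 1)"
  define rm rp where "rm = a + h / 2 * slope h u k $ i" and "rp = b - h / 2 * slope h u (k + axis i 1) $ i"
  define dm dp where "dm = (\<Sum>j\<in>UNIV. slope h u k $ j)" and "dp = (\<Sum>j\<in>UNIV. slope h u (k + axis i 1) $ j)"
  have slope: "slope h u k' $ j = minmod ((U k' - U (k' - axis j 1)) / h) ((U (k' + axis j 1) - U k') / h)" for k' j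
    by (simp add: slope_def jump_Qh[OF h u] U_def)
  have slope_le: "\<bar>slope h u k' $ j\<bar> \<le> face_jump U k' j / h" for k' j
    unfolding slope using minmod_between(5)[of _ "(U (k' + axis j 1) - U k') / h"] h
    by (simp add: face_jump_def)
  have div: "\<bar>dm\<bar> + \<bar>dp\<bar> \<le> near_jumps U k i / h"
  proof -
    have "\<bar>dm\<bar> + \<bar>dp\<bar> \<le> (\<Sum>j\<in>UNIV. \<bar>slope h u k $ j\<bar>) + (\<Sum>j\<in>UNIV. \<bar>slope h u (k + axis i 1) $ j\<bar>)"
      unfolding dm_def dp_def by (intro add_mono sum_abs)
    also have "\<dots> \<le> (\<Sum>j\<in>UNIV. face_jump U k j / h) + (\<Sum>j\<in>UNIV. face_jump U (k + axis i 1) j / h)"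
      by (intro add_mono sum_mono slope_le)
    finally show ?thesis
      by (simp add: near_jumps_def sum.distrib add_divide_distrib sum_divide_distrib)
  qed
  have sm: "slope h u k $ i = minmod ((U k - U (k - axis i 1)) / h) ((b - a) / h)"
    and sp: "slope h u (k + axis i 1) $ i = minmod ((b - a) / h) ((U (k + axis i 1 + axis i 1) - b) / h)"
    by (simp_all add: slope a_def b_def)
  have half: "h / 2 * x \<le> h / 2 * y" if "x \<le> y" for x y
    using that h by simp
  have half_diff: "h / 2 * ((b - a) / h) = (b - a) / 2"
    using h by simp
  \<comment> \<open>Both slopes lie between 0 and \<open>(b - a) / h\<close>, because this quotient
    is an argument of both minmods. Over half a cell the reconstruction therefore covers at most
    half the jump and does not pass the mean.\<close>
  have up: "a \<le> rm \<and> rm \<le> (a + b) / 2 \<and> (a + b) / 2 \<le> rp \<and> rp \<le> b" if "a \<le> b"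
  proof -
    have "0 \<le> (b - a) / h" using that h by simp
    from minmod_between(2)[OF this] minmod_between(1)[OF this]
    have "0 \<le> slope h u k $ i" "slope h u k $ i \<le> (b - a) / h"
      "0 \<le> slope h u (k + axis i 1) $ i" "slope h u (k + axis i 1) $ i \<le> (b - a) / h"
      by (simp_all add: sm sp)
    from this[THEN half] show ?thesis
      unfolding rm_def rp_def half_diff mult_zero_right by (intro conjI; argo)
  qed
  have down: "b \<le> rp \<and> rp \<le> (a + b) / 2 \<and> (a + b) / 2 \<le> rm \<and> rm \<le> a" if "b \<le> a"
  proof -
    have "(b - a) / h \<le> 0" using that h by (simp add: divide_nonpos_pos)
    from minmod_between(4)[OF this] minmod_between(3)[OF this]
    have "slope h u k $ i \<le> 0" "(b - a) / h \<le> slope h u k $ i"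
      "slope h u (k + axis i 1) $ i \<le> 0" "(b - a) / h \<le> slope h u (k + axis i 1) $ i"
      by (simp_all add: sm sp)
    from this[THEN half] show ?thesis
      unfolding rm_def rp_def half_diff mult_zero_right by (intro conjI; argo)
  qed
  have ab: "\<bar>a\<bar> \<le> R" "\<bar>b\<bar> \<le> R" using R by (auto simp: a_def b_def U_def)
  have rmp: "\<bar>rm\<bar> \<le> R" "\<bar>rp\<bar> \<le> R"
    using up down ab by (cases "a \<le> b"; auto)+
  have R0: "0 \<le> R" using ab by linarith
  have D: "face_jump U k i = \<bar>b - a\<bar>" by (simp add: face_jump_def a_def b_def)
  \<comment> \<open>The flux splits into the Godunov part, the stabilization \<open>q\<close> and
    the part \<open>e\<close> that carries the entire dependence on \<open>dt\<close>.\<close>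
  define e where "e = grp_value dt rm rp dm dp - grp_value 0 rm rp dm dp"
  define q where "q = (if b - a \<ge> 0 then 0 else (1 / 24 + C1) * (b - a)\<^sup>2)"
  have flux: "grp_flux_new C1 h dt u (k, i) = grp_value 0 rm rp dm dp + q + e"
    unfolding grp_flux_new_eq[OF h u] e_def q_def rm_def rp_def dm_def dp_def a_def b_def U_def by simp
  have e: "\<bar>e\<bar> \<le> R\<^sup>2 / 2 * (dt / h) * near_jumps U k i"
  proof -
    have "\<bar>e\<bar> \<le> R\<^sup>2 / 2 * (dt * (\<bar>dm\<bar> + \<bar>dp\<bar>))"
      unfolding e_def by (rule grp_value_time_part[OF rmp dt(1)])
    also have "\<dots> \<le> R\<^sup>2 / 2 * (dt * (near_jumps U k i / h))"
      using dt by (intro mult_left_mono div) auto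
    finally show ?thesis by simp
  qed
  \<comment> \<open>One factor of the squared jump is at most \<open>2 * R\<close>, and
    \<open>1 / 24 + C1 \<le> 1 / 12\<close>.\<close>
  have q: "\<bar>q\<bar> \<le> R * \<bar>b - a\<bar>"
  proof -
    have "\<bar>q\<bar> \<le> (1 / 24 + C1) * (\<bar>b - a\<bar> * \<bar>b - a\<bar>)"
      using C1 by (simp add: q_def power2_eq_square)
    also have "\<dots> \<le> 1 / 12 * (\<bar>b - a\<bar> * \<bar>b - a\<bar>)"
      using C1 by (intro mult_right_mono) auto
    also have "\<dots> \<le> 1 / 12 * (2 * R * \<bar>b - a\<bar>)"
      using ab by (intro mult_left_mono mult_right_mono) auto
    also have "\<dots> \<le> R * \<bar>b - a\<bar>"
      using mult_nonneg_nonneg[OF R0 abs_ge_zero[of "b - a"]] by simp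
    finally show ?thesis .
  qed
  have "\<bar>grp_flux_new C1 h dt u (k, i) - (U k)\<^sup>2 / 2\<bar> \<le> \<bar>grp_value 0 rm rp dm dp - a\<^sup>2 / 2\<bar> + \<bar>q\<bar> + \<bar>e\<bar>"
    unfolding flux a_def by linarith
  also have "\<dots> \<le> R * \<bar>b - a\<bar> + R * \<bar>b - a\<bar> + R\<^sup>2 / 2 * (dt / h) * near_jumps U k i"
    by (intro add_mono grp_value_consistent ab rmp up down q e)
  also have "\<dots> \<le> R * near_jumps U k i + R * near_jumps U k i + R\<^sup>2 / 2 * C * near_jumps U k i"
    using face_jump_le_near[of U k i] dt near_jumps_nonneg[of U k i] R0 unfolding D
    by (intro add_mono mult_left_mono mult_right_mono) auto
  finally show "\<bar>grp_flux_new C1 h dt u (k, i) - (U k)\<^sup>2 / 2\<bar> \<le> (2 * R + R\<^sup>2 / 2 * C) * near_jumps U k i"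
    by (simp add: algebra_simps)
  have "grp_flux_new C1 h dt u (k, i) * (b - a) - (b ^ 3 - a ^ 3) / 6
      = ((grp_value 0 rm rp dm dp + q) * (b - a) - (b ^ 3 - a ^ 3) / 6) + e * (b - a)"
    unfolding flux by (simp add: algebra_simps)
  also have "\<dots> \<le> - C1 * \<bar>b - a\<bar> ^ 3 + R\<^sup>2 / 2 * (dt / h) * near_jumps U k i * \<bar>b - a\<bar>"
  proof (rule add_mono)
    show "(grp_value 0 rm rp dm dp + q) * (b - a) - (b ^ 3 - a ^ 3) / 6 \<le> - C1 * \<bar>b - a\<bar> ^ 3"
      unfolding q_def by (rule grp_value_dissipative[OF up down C1(2)])
    have "e * (b - a) \<le> \<bar>e\<bar> * \<bar>b - a\<bar>" using abs_ge_self[of "e * (b - a)"] by (simp add: abs_mult)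
    also have "\<dots> \<le> R\<^sup>2 / 2 * (dt / h) * near_jumps U k i * \<bar>b - a\<bar>"
      by (intro mult_right_mono e) auto
    finally show "e * (b - a) \<le> R\<^sup>2 / 2 * (dt / h) * near_jumps U k i * \<bar>b - a\<bar>" .
  qed
  finally show "grp_flux_new C1 h dt u (k, i) * (U (k + axis i 1) - U k) - ((U (k + axis i 1)) ^ 3 - (U k) ^ 3) / 6
      \<le> - C1 * face_jump U k i ^ 3 + R\<^sup>2 / 2 * (dt / h) * (near_jumps U k i * face_jump U k i)"
    unfolding D a_def b_def by (simp add: mult.assoc)
qed

end

section \<open>Consistency of the scheme on the lattice\<close>

context periodic_lattice
begin

lemma abs_cell_sum_le:
  assumes "\<And>k. k \<in> cells \<Longrightarrow> \<bar>f k\<bar> \<le> B"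
  shows "\<bar>\<Sum>k\<in>cells. f k\<bar> \<le> real (card cells) * B"
  by (rule order_trans[OF sum_abs sum_bounded_above[of cells "\<lambda>k. \<bar>f k\<bar>" B]]) (rule assms)

lemma face_sum_affine:
  "face_sum (\<lambda>k i. c * f k i + e) = c * face_sum f + real (card cells) * (real CARD('n) * e)"
  by (simp add: sum.distrib sum_distrib_left)

text \<open>In the application \<open>a n\<close> and \<open>a'\<close> are cell integrals of
  \<open>\<phi>\<close> at time \<open>n * dt\<close> and at \<open>\<tau>\<close>,
  \<open>gt\<close> and \<open>gx\<close> are integrals of its weak derivatives over space-time
  boxes, \<open>v\<close> is the cell volume and \<open>L\<close> the norm of \<open>\<phi>\<close>.
  Only finitely many numbers remain, and every error is \<open>L * v * card cells\<close> times a
  multiple of \<open>s\<close>.\<close>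

lemma consistency_error_le:
  fixes F :: "nat \<Rightarrow> int ^ 'n \<Rightarrow> 'n \<Rightarrow> real" and a :: "nat \<Rightarrow> int ^ 'n \<Rightarrow> real"
  assumes U: "\<And>n. n \<le> M \<Longrightarrow> lperiodic (U n)" "\<And>n k. n \<le> M \<Longrightarrow> \<bar>U n k\<bar> \<le> R"
    and s: "0 < s" "s \<le> 1" and dt: "0 < dt" "dt \<le> C2 * s ^ 4" and T: "real M * dt \<le> T"
    and v: "0 \<le> v" and L: "0 \<le> L" and A: "0 \<le> A"
    and F: "\<And>n k i. n < M \<Longrightarrow> \<bar>F n k i - (U n k)\<^sup>2 / 2\<bar> \<le> A * near_jumps (U n) k i"
    and scheme: "\<And>n P. n < M \<Longrightarrow> lperiodic P \<Longrightarrow>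
      s ^ 3 * (\<Sum>k\<in>cells. P k * ((U (Suc n) k - U n k) / dt))
        = face_sum (\<lambda>k i. F n k i * (P (k + axis i 1) - P k))"
    and cubed: "(\<Sum>n<M. dt * face_sum (\<lambda>k i. face_jump (U n) k i ^ 3)) \<le> s ^ 3 * real (card cells) * Z"
    and a: "\<And>n. lperiodic (a n)"
    and a_space: "\<And>n k i. n < M \<Longrightarrow> k \<in> cells \<Longrightarrow> \<bar>a (Suc n) (k + axis i 1) - a (Suc n) k\<bar> \<le> L * s ^ 3 * v"
    and a_time: "\<And>k. k \<in> cells \<Longrightarrow> \<bar>a' k - a M k\<bar> \<le> L * dt * v"
    and gt: "\<And>n k. n < M \<Longrightarrow> k \<in> cells \<Longrightarrow> \<bar>gt n k - (a (Suc n) k - a n k)\<bar> \<le> 2 * L * dt * dt * v"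
    and gx: "\<And>n k i. n < M \<Longrightarrow> k \<in> cells \<Longrightarrow>
      \<bar>gx n k i - dt / s ^ 3 * (a (Suc n) (k + axis i 1) - a (Suc n) k)\<bar> \<le> L * (s ^ 3 + dt) * dt * v"
    and last: "\<And>k. k \<in> cells \<Longrightarrow> \<bar>gt M k\<bar> \<le> L * dt * v" "\<And>k i. k \<in> cells \<Longrightarrow> \<bar>gx M k i\<bar> \<le> L * dt * v"
  shows "\<bar>(\<Sum>k\<in>cells. U M k * a' k) - (\<Sum>k\<in>cells. U 0 k * a 0 k)
      - (\<Sum>n\<le>M. \<Sum>k\<in>cells. U n k * gt n k + (U n k)\<^sup>2 / 2 * (\<Sum>i\<in>UNIV. gx n k i))\<bar>
    \<le> L * (v * real (card cells)) * (2 * R * C2 + real CARD('n) * R\<^sup>2 / 2 * C2 + 2 * R * C2 * T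
        + real CARD('n) * R\<^sup>2 / 2 * (1 + C2) * T + 2 * real CARD('n) * A * (Z + T * real CARD('n))) * s"
    (is "\<bar>?I\<bar> \<le> _")
proof -
  let ?d = "real CARD('n)" and ?c = "real (card cells)"
  let ?D = "\<lambda>n k i. a (Suc n) (k + axis i 1) - a (Suc n) k"
  have R: "0 \<le> R" using U(2)[of 0 0] by simp
  have UR: "\<bar>U n k * x\<bar> \<le> R * y" if "n \<le> M" "\<bar>x\<bar> \<le> y" for n k x y
    using U(2)[OF that(1), of k] that R unfolding abs_mult by (intro mult_mono) auto
  have U2: "(U n k)\<^sup>2 \<le> R\<^sup>2" if "n \<le> M" for n k
    using U(2)[OF that, of k] power_mono[of "\<bar>U n k\<bar>" R 2] by simp
  have UR2: "\<bar>(U n k)\<^sup>2 / 2 * x\<bar> \<le> R\<^sup>2 / 2 * y" if "n \<le> M" "\<bar>x\<bar> \<le> y" for n k x y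
    using U2[OF that(1), of k] that unfolding abs_mult by (intro mult_mono) auto
  have C2: "0 \<le> C2" using dt s by (smt (verit) zero_less_mult_pos2 zero_less_power)
  have T0: "0 \<le> T" using T dt by (smt (verit) mult_nonneg_nonneg of_nat_0_le_iff)
  have s4: "s ^ 4 \<le> s" "s ^ 3 \<le> s"
    using s power_decreasing[of 1 4 s] power_decreasing[of 1 3 s] by auto
  have dts: "dt \<le> C2 * s" using dt(2) mult_left_mono[OF s4(1) C2] by linarith
  \<comment> \<open>\<open>E1\<close> and \<open>E2\<close> belong to the incomplete last step.
    Summation by parts in time splits a complete step into \<open>E3\<close>, with the increment of
    \<open>a\<close> at the old value of \<open>U\<close>, and \<open>E4\<close>, with the increment
    of \<open>U\<close> at the new value of \<open>a\<close>; the latter is the scheme tested with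
    \<open>a (Suc n)\<close>.\<close>
  define E1 where "E1 = (\<Sum>k\<in>cells. U M k * (a' k - a M k))"
  define E2 where "E2 = (\<Sum>k\<in>cells. U M k * gt M k + (U M k)\<^sup>2 / 2 * (\<Sum>i\<in>UNIV. gx M k i))"
  define E3 where "E3 = (\<lambda>n. \<Sum>k\<in>cells. U n k * (a (Suc n) k - a n k - gt n k))"
  define E4 where "E4 = (\<lambda>n. \<Sum>k\<in>cells. (U (Suc n) k - U n k) * a (Suc n) k - (U n k)\<^sup>2 / 2 * (\<Sum>i\<in>UNIV. gx n k i))"
  have I_eq: "?I = E1 - E2 + ((\<Sum>n<M. E3 n) + (\<Sum>n<M. E4 n))"
  proof -
    have step: "E3 n + E4 n = (\<Sum>k\<in>cells. U (Suc n) k * a (Suc n) k) - (\<Sum>k\<in>cells. U n k * a n k)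
        - (\<Sum>k\<in>cells. U n k * gt n k + (U n k)\<^sup>2 / 2 * (\<Sum>i\<in>UNIV. gx n k i))" for n
      unfolding E3_def E4_def sum.distrib[symmetric] sum_subtractf[symmetric]
      by (intro sum.cong) (simp_all add: algebra_simps)
    have "(\<Sum>n<M. E3 n + E4 n) = ((\<Sum>k\<in>cells. U M k * a M k) - (\<Sum>k\<in>cells. U 0 k * a 0 k))
        - (\<Sum>n<M. \<Sum>k\<in>cells. U n k * gt n k + (U n k)\<^sup>2 / 2 * (\<Sum>i\<in>UNIV. gx n k i))"
      unfolding step sum_subtractf
      using sum_lessThan_telescope[of "\<lambda>n. \<Sum>k\<in>cells. U n k * a n k" M] by (simp add: sum_subtractf)
    moreover have "E1 = (\<Sum>k\<in>cells. U M k * a' k) - (\<Sum>k\<in>cells. U M k * a M k)"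
      unfolding E1_def sum_subtractf[symmetric] by (simp add: right_diff_distrib)
    ultimately show ?thesis
      unfolding E2_def lessThan_Suc_atMost[symmetric] sum.distrib[symmetric] by simp
  qed
  have E1_le: "\<bar>E1\<bar> \<le> ?c * (R * (L * dt * v))"
    unfolding E1_def by (intro abs_cell_sum_le UR a_time) auto
  have E2_le: "\<bar>E2\<bar> \<le> ?c * (R * (L * dt * v) + R\<^sup>2 / 2 * (?d * (L * dt * v)))"
    unfolding E2_def
  proof (intro abs_cell_sum_le order_trans[OF abs_triangle_ineq] add_mono UR UR2 last)
    fix k assume k: "k \<in> cells"
    show "\<bar>\<Sum>i\<in>UNIV. gx M k i\<bar> \<le> ?d * (L * dt * v)"
      using sum_bounded_above[of UNIV "\<lambda>i. \<bar>gx M k i\<bar>", OF last(2)[OF k]]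
      by (intro order_trans[OF sum_abs]) simp
  qed auto
  have E3_le: "\<bar>\<Sum>n<M. E3 n\<bar> \<le> ?c * (R * (2 * L * dt * v)) * T"
  proof -
    have "\<bar>\<Sum>n<M. E3 n\<bar> \<le> (\<Sum>n<M. ?c * (R * (2 * L * dt * dt * v)))"
      unfolding E3_def using gt
      by (intro order_trans[OF sum_abs] sum_mono abs_cell_sum_le UR) (auto simp: abs_minus_commute)
    also have "\<dots> = ?c * (R * (2 * L * dt * v)) * (real M * dt)" by simp
    also have "\<dots> \<le> ?c * (R * (2 * L * dt * v)) * T"
      using R L dt v by (intro mult_left_mono T) auto
    finally show ?thesis .
  qed
  have E4_le: "\<bar>\<Sum>n<M. E4 n\<bar> \<le> 2 * ?d * A * L * v * (s * ?c * (Z + T * ?d))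
      + ?c * (?d * (R\<^sup>2 / 2 * (L * (s ^ 3 + dt) * v))) * T"
  proof -
    have E4: "\<bar>E4 n\<bar> \<le> A * L * v * (dt * (2 * ?d * face_sum (face_jump (U n))))
        + ?c * (?d * (R\<^sup>2 / 2 * (L * (s ^ 3 + dt) * v))) * dt" if n: "n < M" for n
    proof -
      have "s ^ 3 * (\<Sum>k\<in>cells. a (Suc n) k * ((U (Suc n) k - U n k) / dt)) = face_sum (\<lambda>k i. F n k i * ?D n k i)"
        by (rule scheme[OF n a])
      then have "(\<Sum>k\<in>cells. (U (Suc n) k - U n k) * a (Suc n) k) = dt / s ^ 3 * face_sum (\<lambda>k i. F n k i * ?D n k i)"
        using dt s by (simp add: sum_divide_distrib[symmetric] field_simps)
      then have "E4 n = face_sum (\<lambda>k i. dt / s ^ 3 * (F n k i * ?D n k i) - (U n k)\<^sup>2 / 2 * gx n k i)"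
        by (simp add: E4_def sum_subtractf sum_distrib_left)
      \<comment> \<open>Inserting the exact flux of \<open>U n k\<close> separates the inconsistency
        of the flux, small with the jumps, from the quadrature error of \<open>gx\<close>.\<close>
      also have "\<dots> = face_sum (\<lambda>k i. dt / s ^ 3 * ((F n k i - (U n k)\<^sup>2 / 2) * ?D n k i)
          - (U n k)\<^sup>2 / 2 * (gx n k i - dt / s ^ 3 * ?D n k i))"
        by (intro sum.cong) (simp_all add: algebra_simps)
      finally have E4_eq: "E4 n = face_sum (\<lambda>k i. dt / s ^ 3 * ((F n k i - (U n k)\<^sup>2 / 2) * ?D n k i)
          - (U n k)\<^sup>2 / 2 * (gx n k i - dt / s ^ 3 * ?D n k i))" .
      have "\<bar>E4 n\<bar> \<le> face_sum (\<lambda>k i. dt / s ^ 3 * (A * near_jumps (U n) k i * (L * s ^ 3 * v))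
          + R\<^sup>2 / 2 * (L * (s ^ 3 + dt) * dt * v))"
        unfolding E4_eq
      proof (intro order_trans[OF sum_abs] sum_mono order_trans[OF abs_triangle_ineq4] add_mono)
        fix k i assume k: "k \<in> cells"
        have "\<bar>(F n k i - (U n k)\<^sup>2 / 2) * ?D n k i\<bar> \<le> A * near_jumps (U n) k i * (L * s ^ 3 * v)"
          unfolding abs_mult using A near_jumps_nonneg
          by (intro mult_mono F n a_space k) auto
        moreover have nonneg: "0 \<le> dt / s ^ 3" using dt s by simp
        ultimately show "\<bar>dt / s ^ 3 * ((F n k i - (U n k)\<^sup>2 / 2) * ?D n k i)\<bar>
            \<le> dt / s ^ 3 * (A * near_jumps (U n) k i * (L * s ^ 3 * v))"
          unfolding abs_mult[of "dt / s ^ 3"] abs_of_nonneg[OF nonneg] by (rule mult_left_mono)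
        show "\<bar>(U n k)\<^sup>2 / 2 * (gx n k i - dt / s ^ 3 * ?D n k i)\<bar> \<le> R\<^sup>2 / 2 * (L * (s ^ 3 + dt) * dt * v)"
          by (rule UR2[OF less_imp_le[OF n] gx[OF n k]])
      qed
      also have "\<dots> = A * L * v * (dt * face_sum (near_jumps (U n)))
          + ?c * (?d * (R\<^sup>2 / 2 * (L * (s ^ 3 + dt) * v))) * dt"
      proof -
        have cancel: "dt / q * (A * x * (L * q * v)) = A * L * v * dt * x" if "q \<noteq> 0" for q x
          using that by (simp add: field_simps)
        have "s ^ 3 \<noteq> 0" using s by simp
        then show ?thesis
          unfolding cancel[OF \<open>s ^ 3 \<noteq> 0\<close>] face_sum_affine by (simp only: mult_ac)
      qed
      finally show ?thesis
        using n by (simp add: face_sum_near_jumps(1)[OF U(1)])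
    qed
    have "\<bar>\<Sum>n<M. E4 n\<bar> \<le> (\<Sum>n<M. A * L * v * (dt * (2 * ?d * face_sum (face_jump (U n))))
        + ?c * (?d * (R\<^sup>2 / 2 * (L * (s ^ 3 + dt) * v))) * dt)"
      by (intro order_trans[OF sum_abs] sum_mono E4) auto
    also have "\<dots> = 2 * ?d * A * L * v * (\<Sum>n<M. dt * face_sum (face_jump (U n)))
        + ?c * (?d * (R\<^sup>2 / 2 * (L * (s ^ 3 + dt) * v))) * (real M * dt)"
    proof -
      have "A * L * v * (dt * (2 * ?d * x)) = 2 * ?d * A * L * v * (dt * x)" for x
        by simp
      then show ?thesis by (simp only: sum.distrib sum_distrib_left[symmetric]) simp
    qed
    also have "\<dots> \<le> 2 * ?d * A * L * v * (s * ?c * (Z + T * ?d))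
        + ?c * (?d * (R\<^sup>2 / 2 * (L * (s ^ 3 + dt) * v))) * T"
    proof (intro add_mono mult_left_mono T)
      \<comment> \<open>The factor \<open>s ^ 3\<close> makes \<open>young_linear\<close> applicable
        and is cancelled at the end, since the bound on the cubed jumps carries it too.\<close>
      have "s ^ 3 * (\<Sum>n<M. dt * face_sum (face_jump (U n))) = (\<Sum>n<M. dt * face_sum (\<lambda>k i. s ^ 3 * face_jump (U n) k i))"
        by (simp add: sum_distrib_left mult_ac)
      also have "\<dots> \<le> (\<Sum>n<M. dt * face_sum (\<lambda>k i. s * (face_jump (U n) k i ^ 3 + s ^ 3)))"
        using s dt by (intro sum_mono mult_left_mono young_linear face_jump_nonneg) auto
      also have "\<dots> = s * ((\<Sum>n<M. dt * face_sum (\<lambda>k i. face_jump (U n) k i ^ 3)) + real M * dt * ?c * ?d * s ^ 3)"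
      proof -
        have "face_sum (\<lambda>k i. s * (face_jump (U n) k i ^ 3 + s ^ 3)) =
            s * face_sum (\<lambda>k i. face_jump (U n) k i ^ 3) + ?c * (?d * (s * s ^ 3))" for n
          unfolding distrib_left by (rule face_sum_affine)
        then have "(\<Sum>n<M. dt * face_sum (\<lambda>k i. s * (face_jump (U n) k i ^ 3 + s ^ 3))) =
            (\<Sum>n<M. s * (dt * face_sum (\<lambda>k i. face_jump (U n) k i ^ 3)) + dt * (?c * (?d * (s * s ^ 3))))"
          by (simp add: algebra_simps)
        also have "\<dots> = s * (\<Sum>n<M. dt * face_sum (\<lambda>k i. face_jump (U n) k i ^ 3))
            + real M * (dt * (?c * (?d * (s * s ^ 3))))"
          by (simp only: sum.distrib sum_distrib_left[symmetric]) simp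
        finally show ?thesis by (simp add: algebra_simps)
      qed
      also have "\<dots> \<le> s * (s ^ 3 * ?c * Z + T * ?c * ?d * s ^ 3)"
        using s by (intro mult_left_mono add_mono cubed mult_right_mono T) auto
      also have "\<dots> = s ^ 3 * (s * ?c * (Z + T * ?d))" by (simp add: algebra_simps)
      finally show "(\<Sum>n<M. dt * face_sum (face_jump (U n))) \<le> s * ?c * (Z + T * ?d)"
        using s by simp
    qed (use A L v s dt in auto)
    finally show ?thesis .
  qed
  have "\<bar>?I\<bar> \<le> \<bar>E1\<bar> + \<bar>E2\<bar> + \<bar>\<Sum>n<M. E3 n\<bar> + \<bar>\<Sum>n<M. E4 n\<bar>"
    unfolding I_eq by arith
  also have "\<dots> \<le> ?c * (R * (L * dt * v)) + ?c * (R * (L * dt * v) + R\<^sup>2 / 2 * (?d * (L * dt * v)))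
      + ?c * (R * (2 * L * dt * v)) * T + (2 * ?d * A * L * v * (s * ?c * (Z + T * ?d))
      + ?c * (?d * (R\<^sup>2 / 2 * (L * (s ^ 3 + dt) * v))) * T)"
    by (intro add_mono E1_le E2_le E3_le E4_le)
  also have "\<dots> = L * (v * ?c) * ((2 * R + ?d * R\<^sup>2 / 2 + 2 * R * T) * dt
      + ?d * R\<^sup>2 / 2 * T * (s ^ 3 + dt) + 2 * ?d * A * (Z + T * ?d) * s)"
    by (simp add: algebra_simps)
  also have "\<dots> \<le> L * (v * ?c) * ((2 * R + ?d * R\<^sup>2 / 2 + 2 * R * T) * (C2 * s)
      + ?d * R\<^sup>2 / 2 * T * (s + C2 * s) + 2 * ?d * A * (Z + T * ?d) * s)"
    using R T0 L v dts s4
    by (intro mult_left_mono add_right_mono add_mono) auto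
  finally show ?thesis by (simp add: algebra_simps)
qed

end

section \<open>Weak derivatives integrated over boxes\<close>

lemma abs_integral_cbox_le:
  fixes f :: "'a::euclidean_space \<Rightarrow> real"
  assumes f: "continuous_on UNIV f" and B: "\<And>z. z \<in> box a b \<Longrightarrow> \<bar>f z\<bar> \<le> B"
  shows "\<bar>integral (cbox a b) f\<bar> \<le> B * measure lborel (cbox a b)"
proof -
  have int: "f integrable_on box a b" "(\<lambda>_. B) integrable_on box a b"
    unfolding integrable_on_open_interval
    by (intro integrable_continuous continuous_on_subset[OF f]; simp)+
  have "norm (integral (box a b) f) \<le> integral (box a b) (\<lambda>_. B)"
    by (rule integral_norm_bound_integral[OF int]) (use B in auto)
  then show ?thesis by (simp add: integral_open_interval mult.commute)
qed

lemma integral_diff_continuous: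
  fixes f g :: "'a::euclidean_space \<Rightarrow> real"
  assumes "continuous_on UNIV f" "continuous_on UNIV g"
  shows "integral (cbox a b) f - integral (cbox a b) g = integral (cbox a b) (\<lambda>z. f z - g z)"
  by (rule Henstock_Kurzweil_Integration.integral_diff[symmetric])
     (auto intro: integrable_continuous continuous_on_subset[OF assms(1)] continuous_on_subset[OF assms(2)])

lemma box_subset_torus:
  fixes x :: "real ^ 'n"
  assumes "x \<in> box p q" "\<And>i. 0 \<le> p $ i" "\<And>i. q $ i \<le> l $ i"
  shows "x \<in> cbox 0 l"
proof -
  have "0 \<le> x $ i \<and> x $ i \<le> l $ i" for i
    using assms(1) assms(2)[of i] assms(3)[of i] by (auto simp: mem_box_cart dest!: spec[of _ i])
  then show ?thesis by (simp add: mem_box_cart)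
qed

lemma integral_time_const:
  fixes c :: "'a::euclidean_space \<Rightarrow> real" and t1 t2 :: real
  assumes c: "continuous_on UNIV c" and "t1 \<le> t2"
  shows "integral (cbox (t1, p) (t2, q)) (\<lambda>z. c (snd z)) = (t2 - t1) * integral (cbox p q) c"
proof -
  have "integral (cbox (t1, p) (t2, q)) (\<lambda>z. c (snd z)) = integral (cbox t1 t2) (\<lambda>_. integral (cbox p q) c)"
    by (subst integral_prod_continuous)
       (auto intro!: continuous_on_compose2[OF c] continuous_intros)
  with \<open>t1 \<le> t2\<close> show ?thesis by simp
qed

text \<open>The third bound uses no difference quotient; it is what the incomplete last time step
  gets.\<close>

lemma weak_deriv_indicator_box:
  assumes \<phi>: "\<phi> \<in> Winf m T l" "\<alpha> \<in> multi_indices m" and sub: "box (t1, p) (t2, q) \<subseteq> {0<..<T} \<times> cbox 0 l"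
  defines "I \<equiv> \<lambda>z. indicator (box (t1, p) (t2, q)) z * weak_deriv T l \<alpha> \<phi> z"
  shows "integrable lebesgue I"
    "integral\<^sup>L (spacetime T l) (\<lambda>z. weak_deriv T l \<alpha> \<phi> z * indicator (box (t1, p) (t2, q)) z) = integral\<^sup>L lebesgue I"
    "\<bar>integral\<^sup>L lebesgue I\<bar> \<le> \<bar>Winf_norm m T l \<phi>\<bar> * measure lborel (cbox (t1, p) (t2, q))"
proof -
  let ?S = "{0<..<T} \<times> cbox 0 l" and ?B = "box (t1, p) (t2, q)" and ?g = "weak_deriv T l \<alpha> \<phi>"
  let ?M = "\<bar>Winf_norm m T l \<phi>\<bar>"
  have S: "?S \<inter> space lebesgue \<in> sets lebesgue" using spacetime_set_in_sets[of T l] by simp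
  have "integrable (spacetime T l) (\<lambda>z. ?g z * 1)"
    by (rule integrable_weak_deriv_mult[OF \<phi>]) simp
  then have "set_integrable lebesgue ?S ?g"
    unfolding spacetime_def integrable_restrict_space[OF S] set_integrable_def by simp
  then have "set_integrable lebesgue ?B ?g"
    by (rule set_integrable_subset) (use sub in auto)
  then show int: "integrable lebesgue I"
    by (simp add: I_def set_integrable_def)
  have "indicator ?S z *\<^sub>R (?g z * indicator ?B z) = I z" for z
    using sub by (auto simp: I_def indicator_def)
  then show "integral\<^sup>L (spacetime T l) (\<lambda>z. ?g z * indicator ?B z) = integral\<^sup>L lebesgue I"
    unfolding spacetime_def integral_restrict_space[OF S] by simp
  have ae: "AE z in lebesgue. z \<in> ?S \<longrightarrow> \<bar>?g z\<bar> \<le> ?M"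
    using AE_weak_deriv_le[OF \<phi>] unfolding spacetime_def AE_restrict_space_iff[OF S] .
  have "\<bar>integral\<^sup>L lebesgue I\<bar> \<le> integral\<^sup>L lebesgue (\<lambda>z. \<bar>I z\<bar>)"
    by (rule integral_abs_bound)
  also have "\<dots> \<le> integral\<^sup>L lebesgue (\<lambda>z. indicator ?B z * ?M)"
  proof (rule integral_mono_AE)
    show "AE z in lebesgue. \<bar>I z\<bar> \<le> indicator ?B z * ?M"
      using ae
    proof eventually_elim
      case (elim z)
      with sub show ?case by (cases "z \<in> ?B") (auto simp: I_def)
    qed
  qed (use int integral_indicator_box_continuous(1)[of "\<lambda>_. ?M"] in auto)
  also have "\<dots> = ?M * measure lborel (cbox (t1, p) (t2, q))"
    by (subst integral_indicator_box_continuous(2)) (auto simp: mult.commute)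
  finally show "\<bar>integral\<^sup>L lebesgue I\<bar> \<le> ?M * measure lborel (cbox (t1, p) (t2, q))" .
qed

lemma content_time_box:
  fixes p q :: "'a::euclidean_space" and t1 t2 :: real
  assumes "t1 \<le> t2"
  shows "measure lborel (cbox (t1, p) (t2, q)) = (t2 - t1) * measure lborel (cbox p q)"
  using assms by (simp add: content_Pair)

text \<open>The time shift is the length of the box itself, so that \<open>t1\<close> is shifted to
  \<open>t2\<close>. Replacing the increment of \<open>\<Phi>\<close> from time \<open>r\<close> by
  the one from \<open>t1\<close> costs a second difference in time; the shifted box must still end
  before \<open>T\<close>.\<close>

lemma weak_dt_box:
  fixes l :: "real ^ 'n"
  assumes T: "0 < T" and l: "\<And>i. 0 < l $ i"
    and \<phi>: "\<phi> \<in> Winf 2 T l" "continuous_on ({0..T} \<times> UNIV) \<phi>"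
    and t: "0 \<le> t1" "t1 < t2" "t2 + (t2 - t1) \<le> T"
    and pq: "\<And>i. 0 \<le> p $ i" "\<And>i. p $ i < q $ i" "\<And>i. q $ i \<le> l $ i"
  defines "\<Phi> \<equiv> clamp_time T \<phi>"
  shows "\<bar>integral\<^sup>L (spacetime T l) (\<lambda>z. weak_dt T l \<phi> z * indicator (box (t1, p) (t2, q)) z)
      - (integral (cbox p q) (\<lambda>x. \<Phi> (t2, x)) - integral (cbox p q) (\<lambda>x. \<Phi> (t1, x)))\<bar>
    \<le> 2 * \<bar>Winf_norm 2 T l \<phi>\<bar> * (t2 - t1) * (t2 - t1) * measure lborel (cbox p q)" (is "\<bar>?G - ?A\<bar> \<le> _")
proof -
  let ?M = "\<bar>Winf_norm 2 T l \<phi>\<bar>" and ?s = "t2 - t1" and ?B = "cbox (t1, p) (t2, q)"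
  let ?E = "\<lambda>z. (\<Phi> (z + ?s *\<^sub>R (1, 0)) - \<Phi> z) - (\<Phi> (t2, snd z) - \<Phi> (t1, snd z))"
  interpret weakly_C11 T l ?M \<Phi> unfolding \<Phi>_def by (rule weakly_C11_clamp_time[OF T l \<phi>])
  have v: "((1, 0) :: real \<times> (real ^ 'n)) \<in> Basis" by (simp add: Basis_prod_def image_iff)
  have c\<Phi>: "continuous_on S (\<lambda>x. \<Phi> (f x))" if "continuous_on S f" for S and f :: "'b::topological_space \<Rightarrow> _"
    by (rule continuous_on_compose2[OF cont that]) auto
  have c1: "continuous_on UNIV (\<lambda>z. \<Phi> (z + ?s *\<^sub>R (1, 0)) - \<Phi> z)"
    by (intro continuous_intros c\<Phi>)
  have c2: "continuous_on UNIV (\<lambda>z :: real \<times> (real ^ 'n). \<Phi> (t2, snd z) - \<Phi> (t1, snd z))"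
    by (intro continuous_intros c\<Phi>)
  have c3: "continuous_on UNIV (\<lambda>x. \<Phi> (t, x))" for t
    by (intro continuous_intros c\<Phi>)
  let ?I = "integral ?B (\<lambda>z. \<Phi> (z + ?s *\<^sub>R (1, 0)) - \<Phi> z)"
  have 1: "\<bar>?s * ?G - ?I\<bar> \<le> ?M * measure lborel ?B * ?s * ?s"
    unfolding \<Phi>_def using t pq by (intro weak_deriv_box_difference[OF T l \<phi> v]) auto
  have "?s * ?A = integral ?B (\<lambda>z. \<Phi> (t2, snd z) - \<Phi> (t1, snd z))"
  proof -
    have "?s * ?A = ?s * integral (cbox p q) (\<lambda>x. \<Phi> (t2, x) - \<Phi> (t1, x))"
      by (simp only: integral_diff_continuous[OF c3 c3])
    also have "\<dots> = integral ?B (\<lambda>z. \<Phi> (t2, snd z) - \<Phi> (t1, snd z))"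
      using t by (intro integral_time_const[symmetric] continuous_on_diff c3) auto
    finally show ?thesis .
  qed
  then have "?I - ?s * ?A = integral ?B ?E"
    by (simp only: integral_diff_continuous[OF c1 c2])
  moreover have "\<bar>\<dots>\<bar> \<le> (?M * ?s * ?s) * measure lborel ?B"
  proof (rule abs_integral_cbox_le)
    show "continuous_on UNIV ?E"
      by (rule continuous_on_diff[OF c1 c2])
    fix z assume z: "z \<in> box (t1, p) (t2, q)"
    obtain r x where zx: "z = (r, x)" by fastforce
    with z have r: "t1 < r" "r < t2" and "x \<in> box p q" by (auto simp: mem_box_Pair)
    then have x: "x \<in> cbox 0 l" using pq by (intro box_subset_torus)
    have "\<bar>(\<Phi> ((t1, x) + (r - t1) *\<^sub>R (1, 0) + ?s *\<^sub>R (1, 0)) - \<Phi> ((t1, x) + ?s *\<^sub>R (1, 0)))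
        - (\<Phi> ((t1, x) + (r - t1) *\<^sub>R (1, 0)) - \<Phi> (t1, x))\<bar> \<le> ?M * (r - t1) * ?s"
      by (rule second_difference[OF v v]) (use r t x in auto)
    then have "\<bar>?E z\<bar> \<le> ?M * (r - t1) * ?s"
      by (simp add: zx algebra_simps)
    also have "\<dots> \<le> ?M * ?s * ?s" using r by (intro mult_right_mono mult_left_mono) auto
    finally show "\<bar>?E z\<bar> \<le> ?M * ?s * ?s" .
  qed
  ultimately have 2: "\<bar>?I - ?s * ?A\<bar> \<le> (?M * ?s * ?s) * measure lborel ?B"
    by simp
  have "?s * \<bar>?G - ?A\<bar> = \<bar>?s * ?G - ?s * ?A\<bar>"
    using t by (simp add: abs_mult flip: right_diff_distrib)
  also have "\<dots> \<le> \<bar>?s * ?G - ?I\<bar> + \<bar>?I - ?s * ?A\<bar>"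
    by linarith
  also have "\<dots> \<le> ?M * measure lborel ?B * ?s * ?s + (?M * ?s * ?s) * measure lborel ?B"
    by (rule add_mono[OF 1 2])
  also have "\<dots> = ?s * (2 * ?M * ?s * ?s * measure lborel (cbox p q))"
    using t by (simp add: content_time_box)
  finally show ?thesis by (rule mult_left_le_imp_le) (use t in auto)
qed

text \<open>The spatial difference is frozen at the end \<open>t2\<close>, the level at which the
  scheme is tested; this costs a mixed second difference.\<close>

lemma weak_dx_box:
  fixes l :: "real ^ 'n"
  assumes T: "0 < T" and l: "\<And>i. 0 < l $ i"
    and \<phi>: "\<phi> \<in> Winf 2 T l" "continuous_on ({0..T} \<times> UNIV) \<phi>"
    and t: "0 \<le> t1" "t1 < t2" "t2 \<le> T" and s: "0 < s" "s \<le> l $ i"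
    and pq: "\<And>i. 0 \<le> p $ i" "\<And>i. p $ i < q $ i" "\<And>i. q $ i \<le> l $ i"
  defines "\<Phi> \<equiv> clamp_time T \<phi>"
  shows "\<bar>integral\<^sup>L (spacetime T l) (\<lambda>z. weak_dx T l i \<phi> z * indicator (box (t1, p) (t2, q)) z)
      - (t2 - t1) / s * (integral (cbox p q) (\<lambda>x. \<Phi> (t2, x + axis i s)) - integral (cbox p q) (\<lambda>x. \<Phi> (t2, x)))\<bar>
    \<le> \<bar>Winf_norm 2 T l \<phi>\<bar> * (s + (t2 - t1)) * (t2 - t1) * measure lborel (cbox p q)" (is "\<bar>?G - ?r / s * ?A\<bar> \<le> _")
proof -
  let ?M = "\<bar>Winf_norm 2 T l \<phi>\<bar>" and ?B = "cbox (t1, p) (t2, q)"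
  let ?e = "(0, axis i 1) :: real \<times> (real ^ 'n)"
  let ?E = "\<lambda>z. (\<Phi> (z + s *\<^sub>R ?e) - \<Phi> z) - (\<Phi> (t2, snd z + axis i s) - \<Phi> (t2, snd z))"
  interpret weakly_C11 T l ?M \<Phi> unfolding \<Phi>_def by (rule weakly_C11_clamp_time[OF T l \<phi>])
  have v: "((1, 0) :: real \<times> (real ^ 'n)) \<in> Basis" "?e \<in> Basis"
    by (auto simp: Basis_prod_def Basis_vec_def)
  have c3: "continuous_on UNIV (\<lambda>x. \<Phi> (t, x + y))" "continuous_on UNIV (\<lambda>x. \<Phi> (t, x))" for t y
    by (intro continuous_on_compose2[OF cont] continuous_intros; simp)+
  have c1: "continuous_on UNIV (\<lambda>z. \<Phi> (z + s *\<^sub>R ?e) - \<Phi> z)"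
    by (intro continuous_on_diff continuous_translate cont)
  have c2: "continuous_on UNIV (\<lambda>z :: real \<times> (real ^ 'n). \<Phi> (t2, snd z + axis i s) - \<Phi> (t2, snd z))"
    by (intro continuous_on_diff continuous_on_compose2[OF cont] continuous_intros; simp)
  have se: "s *\<^sub>R ?e = (0, axis i s)" by (simp add: vec_eq_iff axis_def)
  let ?I = "integral ?B (\<lambda>z. \<Phi> (z + s *\<^sub>R ?e) - \<Phi> z)"
  have 1: "\<bar>s * ?G - ?I\<bar> \<le> ?M * measure lborel ?B * s * s"
    unfolding \<Phi>_def using t pq s by (intro weak_deriv_box_difference[OF T l \<phi> v(2)]) (auto simp: axis_eq_axis)
  have "?r * ?A = integral ?B (\<lambda>z. \<Phi> (t2, snd z + axis i s) - \<Phi> (t2, snd z))"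
  proof -
    have "?r * ?A = ?r * integral (cbox p q) (\<lambda>x. \<Phi> (t2, x + axis i s) - \<Phi> (t2, x))"
      by (simp only: integral_diff_continuous[OF c3])
    also have "\<dots> = integral ?B (\<lambda>z. \<Phi> (t2, snd z + axis i s) - \<Phi> (t2, snd z))"
      using t by (intro integral_time_const[symmetric] continuous_on_diff c3) auto
    finally show ?thesis .
  qed
  then have "?I - ?r * ?A = integral ?B ?E"
    by (simp only: integral_diff_continuous[OF c1 c2])
  moreover have "\<bar>\<dots>\<bar> \<le> (?M * ?r * s) * measure lborel ?B"
  proof (rule abs_integral_cbox_le)
    show "continuous_on UNIV ?E"
      by (rule continuous_on_diff[OF c1 c2])
    fix z assume z: "z \<in> box (t1, p) (t2, q)"
    obtain r x where zx: "z = (r, x)" by fastforce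
    with z have r: "t1 < r" "r < t2" and "x \<in> box p q" by (auto simp: mem_box_Pair)
    then have x: "x \<in> cbox 0 l" using pq by (intro box_subset_torus)
    have "\<bar>(\<Phi> ((r, x) + (t2 - r) *\<^sub>R (1, 0) + s *\<^sub>R ?e) - \<Phi> ((r, x) + s *\<^sub>R ?e))
        - (\<Phi> ((r, x) + (t2 - r) *\<^sub>R (1, 0)) - \<Phi> (r, x))\<bar> \<le> ?M * (t2 - r) * s"
      by (rule second_difference[OF v(2,1)]) (use r t x s in \<open>auto simp: axis_eq_axis\<close>)
    then have "\<bar>?E z\<bar> \<le> ?M * (t2 - r) * s"
      unfolding se zx by (simp add: algebra_simps)
    also have "\<dots> \<le> ?M * ?r * s" using r s by (intro mult_right_mono mult_left_mono) auto
    finally show "\<bar>?E z\<bar> \<le> ?M * ?r * s" .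
  qed
  ultimately have 2: "\<bar>?I - ?r * ?A\<bar> \<le> (?M * ?r * s) * measure lborel ?B"
    by simp
  have "s * \<bar>?G - ?r / s * ?A\<bar> = \<bar>s * (?G - ?r / s * ?A)\<bar>"
    using s by (simp add: abs_mult)
  also have "\<dots> = \<bar>s * ?G - ?r * ?A\<bar>"
    using s by (simp add: right_diff_distrib)
  also have "\<dots> \<le> \<bar>s * ?G - ?I\<bar> + \<bar>?I - ?r * ?A\<bar>"
    by linarith
  also have "\<dots> \<le> ?M * measure lborel ?B * s * s + (?M * ?r * s) * measure lborel ?B"
    by (rule add_mono[OF 1 2])
  also have "\<dots> = s * (?M * (s + ?r) * ?r * measure lborel (cbox p q))"
    using t by (simp add: content_time_box algebra_simps)
  finally show ?thesis using s(1) by (rule mult_left_le_imp_le)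
qed

section \<open>The mesh of the torus\<close>

definition cell_lo :: "real \<Rightarrow> int ^ 'n \<Rightarrow> real ^ 'n" where
  "cell_lo h k = (\<chi> i. h * of_int (k $ i))"

definition cell_hi :: "real \<Rightarrow> int ^ 'n \<Rightarrow> real ^ 'n" where
  "cell_hi h k = (\<chi> i. h * (of_int (k $ i) + 1))"

abbreviation "open_cell h k \<equiv> box (cell_lo h k) (cell_hi h k)"

abbreviation "closed_cell h k \<equiv> cbox (cell_lo h k) (cell_hi h k)"

lemma box_subset_cell: "open_cell h k \<subseteq> cell h k"
  by (auto simp: cell_def cell_lo_def cell_hi_def mem_box_cart less_imp_le)

lemma cell_lo_less_hi: "0 < h \<Longrightarrow> cell_lo h k $ i < cell_hi h k $ i"
  by (simp add: cell_lo_def cell_hi_def)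

lemma measure_cell:
  fixes k :: "int ^ 'n"
  assumes "0 < h"
  shows "measure lborel (closed_cell h k) = h ^ CARD('n)"
proof -
  have "closed_cell h k \<noteq> {}"
    using cell_lo_less_hi[OF assms, of k] by (auto simp: interval_ne_empty_cart less_imp_le)
  then show ?thesis
    by (simp add: content_cbox_cart cell_lo_def cell_hi_def algebra_simps)
qed

lemma disjoint_cell_boxes:
  assumes "0 < h" "k \<noteq> k'"
  shows "open_cell h k \<inter> open_cell h k' = {}"
proof (rule equals0I)
  fix x assume "x \<in> open_cell h k \<inter> open_cell h k'"
  then have "x \<in> cell h k" "x \<in> cell h k'" using box_subset_cell by blast+
  then show False using cell_index_eq_iff[OF assms(1)] assms(2) by metis
qed

lemma integral_cell_shift:
  "integral (cbox (cell_lo h (k + axis i c)) (cell_hi h (k + axis i c))) g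
    = integral (closed_cell h k) (\<lambda>x. g (x + axis i (h * of_int c)))"
  for g :: "real ^ 'n \<Rightarrow> real"
proof -
  have "cell_lo h (k + axis i c) - axis i (h * of_int c) = cell_lo h k"
    "cell_hi h (k + axis i c) - axis i (h * of_int c) = cell_hi h k"
    by (simp_all add: cell_lo_def cell_hi_def vec_eq_iff axis_def algebra_simps)
  then show ?thesis
    using integral_shift_cbox[of "cell_lo h (k + axis i c)" "axis i (h * of_int c)" "cell_hi h (k + axis i c)" g]
    by simp
qed

locale torus_grid = periodic_lattice m for m :: "int ^ 'n" +
  fixes l :: "real ^ 'n" and h :: real
  assumes h_pos: "0 < h" and l_eq: "\<And>i. l $ i = of_int (m $ i) * h"
begin

lemma mesh_eq_cells: "mesh l h = cells"
proof -
  have "h * of_int j < of_int (m $ i) * h \<longleftrightarrow> j < m $ i" for j i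
    using h_pos by (simp add: mult.commute)
  then show ?thesis by (simp add: mesh_def cells_def l_eq)
qed

lemma l_pos: "0 < l $ i"
  using h_pos m_pos[of i] by (simp add: l_eq)

lemma h_le_l: "h \<le> l $ i"
proof -
  have "1 * h \<le> of_int (m $ i) * h" using m_pos[of i] h_pos by (intro mult_right_mono) auto
  then show ?thesis by (simp add: l_eq)
qed

lemma cell_bounds:
  assumes "k \<in> cells"
  shows "0 \<le> cell_lo h k $ i" "cell_hi h k $ i \<le> l $ i"
proof -
  have k: "0 \<le> k $ i" "k $ i < m $ i" using assms by (auto simp: cells_def)
  then have "k $ i + 1 \<le> m $ i" by linarith
  then have "(of_int (k $ i + 1) :: real) \<le> of_int (m $ i)" by (simp only: of_int_le_iff)
  then have "h * of_int (k $ i + 1) \<le> h * of_int (m $ i)" using h_pos by (intro mult_left_mono) auto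
  then show "0 \<le> cell_lo h k $ i" "cell_hi h k $ i \<le> l $ i"
    using k h_pos by (simp_all add: cell_lo_def cell_hi_def l_eq mult.commute)
qed

lemma cells_cover: "cbox 0 l \<subseteq> (\<Union>k\<in>cells. closed_cell h k)"
proof
  fix x assume x: "x \<in> cbox 0 l"
  \<comment> \<open>On the outer faces, where \<open>x $ i = l $ i\<close>, the floor is
    \<open>m $ i\<close> and would leave \<open>cells\<close>; the minimum selects the last cell,
    whose closure contains \<open>x\<close>.\<close>
  define k where "k = (\<chi> i. min \<lfloor>x $ i / h\<rfloor> (m $ i - 1))"
  have "0 \<le> k $ i \<and> k $ i < m $ i \<and> h * of_int (k $ i) \<le> x $ i \<and> x $ i \<le> h * (of_int (k $ i) + 1)" for i
  proof -
    have x: "0 \<le> x $ i" "x $ i \<le> of_int (m $ i) * h" using x by (simp_all add: mem_box_cart l_eq)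
    have "0 \<le> \<lfloor>x $ i / h\<rfloor>" using x h_pos by simp
    then have k: "0 \<le> k $ i" "k $ i < m $ i" using m_pos[of i] by (auto simp: k_def)
    have "x $ i / h \<le> of_int (m $ i)" using x h_pos by (simp add: pos_divide_le_eq)
    moreover have "x $ i / h \<le> of_int \<lfloor>x $ i / h\<rfloor> + 1" by linarith
    ultimately have "x $ i / h \<le> of_int (k $ i) + 1" by (auto simp: k_def min_def)
    moreover have "of_int (k $ i) \<le> x $ i / h"
      using le_floor_iff[of "k $ i" "x $ i / h"] by (simp add: k_def)
    ultimately show ?thesis
      using k h_pos by (simp add: pos_divide_le_eq pos_le_divide_eq mult.commute)
  qed
  then have "k \<in> cells" "x \<in> closed_cell h k"
    by (simp_all add: cells_def mem_box_cart cell_lo_def cell_hi_def)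
  then show "x \<in> (\<Union>k\<in>cells. closed_cell h k)" by blast
qed

text \<open>A cell value times a continuous function covers the integrals of the solution against
  \<open>\<phi>\<close> as well as, with \<open>g = 1\<close>, the time term of the scheme.\<close>

lemma integral_torus_cells:
  fixes c :: "int ^ 'n \<Rightarrow> real"
  assumes g: "continuous_on UNIV g" and f: "\<And>k x. k \<in> cells \<Longrightarrow> x \<in> cell h k \<Longrightarrow> f x = c k * g x"
  shows "integral\<^sup>L (lebesgue_on (cbox 0 l)) f
    = (\<Sum>k\<in>cells. c k * integral (closed_cell h k) g)"
proof -
  have cont: "continuous_on UNIV (\<lambda>x. c k * g x)" for k
    by (intro continuous_intros g)
  have "integral\<^sup>L (lebesgue_on (cbox 0 l)) f
      = (\<Sum>k\<in>cells. integral\<^sup>L lebesgue (\<lambda>x. indicator (open_cell h k) x * (c k * g x)))"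
  proof (rule integral_lebesgue_cover[OF _ finite_cells cells_cover])
    show "open_cell h k \<subseteq> cbox 0 l" if "k \<in> cells" for k
      using box_subset_torus cell_bounds[OF that] by blast
    show "f x = c k * g x" if "k \<in> cells" "x \<in> open_cell h k" for k x
      using f that box_subset_cell by blast
  qed (use disjoint_cell_boxes[OF h_pos] integral_indicator_box_continuous(1)[OF cont] in auto)
  then show ?thesis
    by (simp add: integral_indicator_box_continuous(2)[OF cont])
qed

text \<open>The number of cells enters the error bound only through this product, which is why the
  constant is independent of \<open>h\<close>.\<close>

lemma area_eq: "integral\<^sup>L (lebesgue_on (cbox 0 l)) (\<lambda>_. 1 :: real) = h ^ CARD('n) * real (card cells)"
proof -
  have "integral\<^sup>L (lebesgue_on (cbox 0 l)) (\<lambda>_. 1 :: real)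
      = (\<Sum>k\<in>cells. 1 * integral (closed_cell h k) (\<lambda>_. 1))"
    by (rule integral_torus_cells) auto
  then show ?thesis by (simp add: measure_cell h_pos)
qed

lemma cell_index_periodic: "cell_index h (x + axis i (l $ i)) = cell_index h x + axis i (m $ i)"
proof -
  have "\<lfloor>(x $ j + axis i (l $ i) $ j) / h\<rfloor> = \<lfloor>x $ j / h\<rfloor> + axis i (m $ i) $ j" for j
    using h_pos by (auto simp: axis_def l_eq add_divide_distrib)
  then show ?thesis by (simp add: cell_index_def vec_eq_iff)
qed

lemma lperiodic_cell_values:
  assumes "u \<in> Qh l h"
  shows "lperiodic (\<lambda>k. u (cell_center h k))"
  using assms unfolding lperiodic_def Qh_def periodic_def
  by (simp add: cell_center_shift l_eq mult.commute)

text \<open>The scheme tested with \<open>P\<close> composed with \<open>cell_index\<close>, after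
  division by the common face measure; of the cell volume only one factor \<open>h\<close>
  remains.\<close>

lemma scheme_on_cells:
  assumes sol: "stabilized_grp_solution l C1 h dt N u0 u" and n: "n < N" and dt: "0 < dt" and P: "lperiodic P"
  shows "h * (\<Sum>k\<in>cells. P k *
      ((u (real (Suc n) * dt) (cell_center h k) - u (real n * dt) (cell_center h k)) / dt))
    = face_sum (\<lambda>k i. grp_flux_new C1 h dt (u (real n * dt)) (k, i) * (P (k + axis i 1) - P k))"
proof -
  let ?t = "real n * dt" and ?\<phi> = "\<lambda>x. P (cell_index h x)" and ?w = "h ^ (CARD('n) - 1)"
  have t: "?t + dt = real (Suc n) * dt" by (simp add: algebra_simps)
  have le: "real n * dt \<le> real N * dt" "real (Suc n) * dt \<le> real N * dt"
    using n dt by (auto intro!: mult_right_mono simp del: of_nat_Suc)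
  have Q: "u ?t \<in> Qh l h" "u (?t + dt) \<in> Qh l h"
    using sol le dt unfolding stabilized_grp_solution_def t by (auto simp del: of_nat_Suc)
  have \<phi>: "?\<phi> \<in> Qh l h"
  proof -
    have "P (cell_index h x) = P (cell_index h (cell_center h k))" if "x \<in> cell h k" for x k
      using that cell_index_eq_iff[OF h_pos] cell_center_in_cell[OF h_pos] by metis
    moreover have "periodic l ?\<phi>"
      using P unfolding periodic_def lperiodic_def by (simp add: cell_index_periodic)
    ultimately show ?thesis unfolding Qh_def by blast
  qed
  have "integral\<^sup>L (lebesgue_on (cbox 0 l)) (\<lambda>x. ?\<phi> x * ((u (?t + dt) x - u ?t x) / dt))
      = face_integral l h (\<lambda>\<sigma>. grp_flux_new C1 h dt (u ?t) \<sigma> * jump h ?\<phi> \<sigma>)"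
    using sol n \<phi> unfolding stabilized_grp_solution_def Let_def by force
  moreover have "integral\<^sup>L (lebesgue_on (cbox 0 l)) (\<lambda>x. ?\<phi> x * ((u (?t + dt) x - u ?t x) / dt))
      = (\<Sum>k\<in>cells. P k * ((u (?t + dt) (cell_center h k) - u ?t (cell_center h k)) / dt) * h ^ CARD('n))"
  proof (subst integral_torus_cells)
    show "?\<phi> x * ((u (?t + dt) x - u ?t x) / dt) =
        P k * ((u (?t + dt) (cell_center h k) - u ?t (cell_center h k)) / dt) * 1"
      if "x \<in> cell h k" for k x
      using that Q cell_index_eq_iff[OF h_pos, of x k] by (auto simp: Qh_def)
  qed (auto simp: measure_cell h_pos)
  moreover have "face_integral l h (\<lambda>\<sigma>. grp_flux_new C1 h dt (u ?t) \<sigma> * jump h ?\<phi> \<sigma>)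
      = ?w * face_sum (\<lambda>k i. grp_flux_new C1 h dt (u ?t) (k, i) * (P (k + axis i 1) - P k))"
    unfolding face_integral_def faces_def mesh_eq_cells
    by (simp add: sum.cartesian_product' sum_distrib_left jump_def traces_of_cell_index[OF h_pos])
  moreover have "h ^ CARD('n) = ?w * h"
    by (simp add: power_eq_if)
  ultimately have "?w * (h * (\<Sum>k\<in>cells. P k * ((u (?t + dt) (cell_center h k) - u ?t (cell_center h k)) / dt)))
      = ?w * face_sum (\<lambda>k i. grp_flux_new C1 h dt (u ?t) (k, i) * (P (k + axis i 1) - P k))"
    by (simp add: sum_distrib_left mult_ac)
  then show ?thesis using h_pos unfolding t by simp
qed

end

section \<open>The consistency error\<close>

lemma nat_floor_bounds:
  fixes t dt :: real
  assumes "0 \<le> t" "0 < dt"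
  shows "real (nat \<lfloor>t / dt\<rfloor>) * dt \<le> t" "t < real (Suc (nat \<lfloor>t / dt\<rfloor>)) * dt"
proof -
  have "0 \<le> t / dt" using assms by simp
  then have "real (nat \<lfloor>t / dt\<rfloor>) \<le> t / dt" "t / dt < real (Suc (nat \<lfloor>t / dt\<rfloor>))"
    by linarith+
  then show "real (nat \<lfloor>t / dt\<rfloor>) * dt \<le> t" "t < real (Suc (nat \<lfloor>t / dt\<rfloor>)) * dt"
    using assms(2) by (simp_all add: pos_le_divide_eq pos_divide_less_eq)
qed

lemma first_order_multi_indices:
  "[(1 :: real, 0 :: real ^ 'n)] \<in> multi_indices 2" "[(0 :: real, axis i (1 :: real))] \<in> multi_indices 2"
  by (auto simp: multi_indices_def Basis_prod_def Basis_vec_def)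

context torus_grid
begin

lemma cell_box_subset_torus:
  assumes "x \<in> open_cell h k" "k \<in> cells"
  shows "x \<in> cbox 0 l"
  by (rule box_subset_torus[OF assms(1)]) (rule cell_bounds[OF assms(2)])+

text \<open>Inside each box the solution is a single number, which can be taken out of the integral.
  The slab \<open>n = M\<close> is cut at \<open>\<tau>\<close>; if \<open>\<tau>\<close> is a
  multiple of \<open>dt\<close>, its boxes are empty.\<close>

lemma weak_formulation_cells:
  fixes M :: nat and dt \<tau> T :: real and u :: "real \<Rightarrow> real ^ 'n \<Rightarrow> real"
  defines "B \<equiv> \<lambda>n k. box (real n * dt, cell_lo h k) (min (real (Suc n) * dt) \<tau>, cell_hi h k)"
  assumes \<phi>: "\<phi> \<in> Winf 2 T l" and \<tau>: "0 \<le> \<tau>" "\<tau> < T" and dt: "0 < dt" and M: "M = nat \<lfloor>\<tau> / dt\<rfloor>"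
    and u: "\<And>n t k x. n \<le> M \<Longrightarrow> real n * dt \<le> t \<Longrightarrow> t < real (Suc n) * dt \<Longrightarrow> k \<in> cells \<Longrightarrow> x \<in> cell h k \<Longrightarrow>
      u t x = U n k"
  shows "integral\<^sup>L (lebesgue_on ({0..\<tau>} \<times> cbox 0 l))
      (\<lambda>(t, x). u t x * weak_dt T l \<phi> (t, x) + burgers (u t x) * (\<Sum>i\<in>UNIV. weak_dx T l i \<phi> (t, x)))
    = (\<Sum>n\<le>M. \<Sum>k\<in>cells. U n k * integral\<^sup>L lebesgue (\<lambda>z. indicator (B n k) z * weak_dt T l \<phi> z)
        + (U n k)\<^sup>2 / 2 * (\<Sum>i\<in>UNIV. integral\<^sup>L lebesgue (\<lambda>z. indicator (B n k) z * weak_dx T l i \<phi> z)))"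
proof -
  define F where "F = (\<lambda>(n, k) z. U n k * weak_dt T l \<phi> z + (U n k)\<^sup>2 / 2 * (\<Sum>i\<in>UNIV. weak_dx T l i \<phi> z))"
  define lo hi where "lo = (\<lambda>(n, k :: int ^ 'n). (real n * dt, cell_lo h k))"
    and "hi = (\<lambda>(n, k :: int ^ 'n). (min (real (Suc n) * dt) \<tau>, cell_hi h k))"
  let ?I = "{..M} \<times> cells"
  have B_sub: "B n k \<subseteq> {0<..<T} \<times> cbox 0 l" if "k \<in> cells" for n k
  proof -
    have "0 \<le> real n * dt" using dt by simp
    then show ?thesis
      using \<tau> cell_box_subset_torus[OF _ that] unfolding B_def
      by (auto simp: mem_box_Pair simp del: of_nat_Suc)
  qed
  note \<alpha> = first_order_multi_indices
  have int: "integrable lebesgue (\<lambda>z. indicator (B n k) z * weak_deriv T l \<alpha> \<phi> z)"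
    if "\<alpha> \<in> multi_indices 2" "k \<in> cells" for \<alpha> n k
    unfolding B_def by (rule weak_deriv_indicator_box(1)[OF \<phi> that(1) B_sub[OF that(2), unfolded B_def]])
  have F_eq: "indicator (B n k) z * F (n, k) z = U n k * (indicator (B n k) z * weak_dt T l \<phi> z)
      + (U n k)\<^sup>2 / 2 * (\<Sum>i\<in>UNIV. indicator (B n k) z * weak_dx T l i \<phi> z)" for n k z
    by (simp add: F_def sum_distrib_left algebra_simps)
  have box_eq: "box (lo (n, k)) (hi (n, k)) = B n k" for n k
    by (simp add: lo_def hi_def B_def)
  have "integral\<^sup>L (lebesgue_on ({0..\<tau>} \<times> cbox 0 l))
      (\<lambda>(t, x). u t x * weak_dt T l \<phi> (t, x) + burgers (u t x) * (\<Sum>i\<in>UNIV. weak_dx T l i \<phi> (t, x)))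
    = (\<Sum>j\<in>?I. integral\<^sup>L lebesgue (\<lambda>z. indicator (box (lo j) (hi j)) z * F j z))"
  proof (rule integral_lebesgue_cover)
    show "{0..\<tau>} \<times> cbox 0 l \<in> sets lebesgue"
      by (intro sets_completionI_sets) (auto intro!: borel_Times)
    show "finite ?I" by (simp add: finite_cells)
    show "{0..\<tau>} \<times> cbox 0 l \<subseteq> (\<Union>j\<in>?I. cbox (lo j) (hi j))"
    proof clarify
      fix t x assume t: "t \<in> {0..\<tau>}" and x: "x \<in> cbox 0 l"
      obtain k where k: "k \<in> cells" "x \<in> closed_cell h k" using cells_cover x by blast
      \<comment> \<open>The slab of \<open>t\<close>, at most \<open>M\<close> because the floor is
        monotone. At \<open>t = \<tau>\<close> the point lies on the upper face of its slab, so
        closed boxes are used for the cover.\<close>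
      let ?n = "nat \<lfloor>t / dt\<rfloor>"
      have "?n \<le> M" unfolding M using t dt by (intro nat_mono floor_mono divide_right_mono) auto
      moreover have "(t, x) \<in> cbox (lo (?n, k)) (hi (?n, k))"
        using nat_floor_bounds[of t dt] t dt k by (simp add: lo_def hi_def)
      ultimately show "(t, x) \<in> (\<Union>j\<in>?I. cbox (lo j) (hi j))" using k by blast
    qed
    show "box (lo j) (hi j) \<subseteq> {0..\<tau>} \<times> cbox 0 l" if "j \<in> ?I" for j
    proof -
      obtain n k where j: "j = (n, k)" "k \<in> cells" using \<open>j \<in> ?I\<close> by auto
      have "0 \<le> real n * dt" using dt by simp
      then show ?thesis
        using cell_box_subset_torus[OF _ j(2)] unfolding j lo_def hi_def
        by (auto simp: mem_box_Pair simp del: of_nat_Suc)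
    qed
    show "box (lo i) (hi i) \<inter> box (lo j) (hi j) = {}" if "i \<noteq> j" for i j
    proof (rule equals0I)
      fix z assume z: "z \<in> box (lo i) (hi i) \<inter> box (lo j) (hi j)"
      obtain t x where tx: "z = (t, x)" by fastforce
      obtain n k n' k' where ij: "i = (n, k)" "j = (n', k')" by (cases i, cases j)
      have x: "x \<in> open_cell h k" "x \<in> open_cell h k'"
        and t: "real n * dt < t" "t < real (Suc n) * dt" "real n' * dt < t" "t < real (Suc n') * dt"
        using z by (auto simp: tx ij lo_def hi_def mem_box_Pair)
      have "k = k'" using disjoint_cell_boxes[OF h_pos, of k k'] x by auto
      moreover have "real n * dt < real (Suc n') * dt" "real n' * dt < real (Suc n) * dt" using t by linarith+
      then have "n = n'" using dt by (simp del: of_nat_Suc)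
      ultimately show False using that ij by simp
    qed
    show "(case z of (t, x) \<Rightarrow> u t x * weak_dt T l \<phi> (t, x) + burgers (u t x) * (\<Sum>i\<in>UNIV. weak_dx T l i \<phi> (t, x)))
        = F j z" if "j \<in> ?I" "z \<in> box (lo j) (hi j)" for j z
    proof -
      obtain n k where j: "j = (n, k)" "n \<le> M" "k \<in> cells" using \<open>j \<in> ?I\<close> by auto
      obtain t x where z: "z = (t, x)" by fastforce
      have "x \<in> cell h k" and "real n * dt < t" "t < real (Suc n) * dt"
        using that(2) box_subset_cell[of h k] by (auto simp: z j lo_def hi_def mem_box_Pair)
      then have "u t x = U n k" using j by (intro u) auto
      then show ?thesis by (simp add: z j F_def burgers_def)
    qed
    show "integrable lebesgue (\<lambda>z. indicator (box (lo j) (hi j)) z * F j z)" if "j \<in> ?I" for j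
    proof -
      obtain n k where j: "j = (n, k)" "k \<in> cells" using \<open>j \<in> ?I\<close> by auto
      show ?thesis unfolding j box_eq F_eq
        by (intro Bochner_Integration.integrable_add integrable_mult_right Bochner_Integration.integrable_sum
            int j \<alpha>)
    qed
  qed
  also have "\<dots> = (\<Sum>n\<le>M. \<Sum>k\<in>cells. integral\<^sup>L lebesgue (\<lambda>z. indicator (B n k) z * F (n, k) z))"
    by (simp add: sum.cartesian_product' box_eq)
  also have "\<dots> = (\<Sum>n\<le>M. \<Sum>k\<in>cells. U n k * integral\<^sup>L lebesgue (\<lambda>z. indicator (B n k) z * weak_dt T l \<phi> z)
        + (U n k)\<^sup>2 / 2 * (\<Sum>i\<in>UNIV. integral\<^sup>L lebesgue (\<lambda>z. indicator (B n k) z * weak_dx T l i \<phi> z)))"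
  proof (intro sum.cong refl)
    fix n k assume k: "k \<in> cells"
    have sum_eq: "integral\<^sup>L lebesgue (\<lambda>z. \<Sum>i\<in>UNIV. indicator (B n k) z * weak_dx T l i \<phi> z)
        = (\<Sum>i\<in>UNIV. integral\<^sup>L lebesgue (\<lambda>z. indicator (B n k) z * weak_dx T l i \<phi> z))"
      by (intro Bochner_Integration.integral_sum int k \<alpha>)
    show "integral\<^sup>L lebesgue (\<lambda>z. indicator (B n k) z * F (n, k) z)
      = U n k * integral\<^sup>L lebesgue (\<lambda>z. indicator (B n k) z * weak_dt T l \<phi> z)
        + (U n k)\<^sup>2 / 2 * (\<Sum>i\<in>UNIV. integral\<^sup>L lebesgue (\<lambda>z. indicator (B n k) z * weak_dx T l i \<phi> z))"
      unfolding F_eq sum_eq[symmetric]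
    proof (subst Bochner_Integration.integral_add)
      show "integrable lebesgue (\<lambda>z. U n k * (indicator (B n k) z * weak_dt T l \<phi> z))"
        by (intro integrable_mult_right int k \<alpha>)
      show "integrable lebesgue (\<lambda>z. (U n k)\<^sup>2 / 2 * (\<Sum>i\<in>UNIV. indicator (B n k) z * weak_dx T l i \<phi> z))"
        by (intro integrable_mult_right Bochner_Integration.integrable_sum int k \<alpha>)
    qed (simp only: integral_mult_right_zero)
  qed
  finally show ?thesis .
qed

end

lemma uniform_meshE:
  fixes l :: "real ^ 'n"
  assumes "uniform_mesh l h"
  obtains m :: "int ^ 'n" where "torus_grid m l h"
proof -
  from assms obtain f :: "'n \<Rightarrow> nat" where f: "\<And>i. 0 < f i" "\<And>i. l $ i = real (f i) * h"
    unfolding uniform_mesh_def by metis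
  have "torus_grid (\<chi> i. int (f i)) l h"
    using assms f by unfold_locales (auto simp: uniform_mesh_def)
  then show ?thesis by (rule that)
qed

lemma cube_root_powr:
  fixes h :: real
  assumes "0 < h"
  shows "(h powr (1 / 3)) ^ 3 = h" "(h powr (1 / 3)) ^ 4 = h powr (4 / 3)"
  using assms by (simp_all add: powr_power)

context torus_grid
begin

text \<open>\<open>A\<close> is the flux consistency constant for \<open>dt / h \<le> C2\<close>,
  \<open>K\<close> the factor of \<open>s\<close> times the squared jumps in the energy step, and
  \<open>Z T\<close> bounds the time sum of the cubed jumps relative to
  \<open>h * card cells\<close>. None of them involves \<open>h\<close>, \<open>dt\<close> or
  \<open>\<tau>\<close>.\<close>

lemma consistency:
  fixes C1 C2 R :: real
  defines "d \<equiv> real CARD('n)"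
  defines "A \<equiv> 2 * R + R\<^sup>2 / 2 * C2"
  defines "K \<equiv> C2 * (R\<^sup>2 / 2 * ((4 * d\<^sup>2 + 1) / 2) + 8 * d ^ 3 * (A + R)\<^sup>2)"
  defines "Z \<equiv> \<lambda>T. 2 / C1 * (R\<^sup>2 / 2 + T * (K * d / (C1 / (2 * (K + 1)))\<^sup>2))"
  assumes C1: "0 < C1" "C1 \<le> 1 / 24" and T: "0 < T" and dt: "0 < dt" "real N * dt = T" "dt \<le> C2 * h powr (4 / 3)"
    and h: "h \<le> 1" and sol: "stabilized_grp_solution l C1 h dt N u0 u"
    and R: "\<And>t x. 0 \<le> t \<Longrightarrow> t < T \<Longrightarrow> \<bar>u t x\<bar> \<le> R" and \<tau>: "0 < \<tau>" "\<tau> < T"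
    and \<phi>: "\<phi> \<in> Winf 2 T l" "continuous_on ({0..T} \<times> UNIV) \<phi>"
  shows "\<bar>integral\<^sup>L (lebesgue_on (cbox 0 l)) (\<lambda>x. u \<tau> x * \<phi> (\<tau>, x))
      - integral\<^sup>L (lebesgue_on (cbox 0 l)) (\<lambda>x. u 0 x * \<phi> (0, x))
      - integral\<^sup>L (lebesgue_on ({0..\<tau>} \<times> cbox 0 l))
          (\<lambda>(t, x). u t x * weak_dt T l \<phi> (t, x) + burgers (u t x) * (\<Sum>i\<in>UNIV. weak_dx T l i \<phi> (t, x)))\<bar>
    \<le> \<bar>Winf_norm 2 T l \<phi>\<bar> * integral\<^sup>L (lebesgue_on (cbox 0 l)) (\<lambda>_. 1 :: real)
        * (2 * R * C2 + d * R\<^sup>2 / 2 * C2 + 2 * R * C2 * T + d * R\<^sup>2 / 2 * (1 + C2) * T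
            + 2 * d * A * (Z T + T * d)) * h powr (1 / 3)"
proof -
  let ?L = "\<bar>Winf_norm 2 T l \<phi>\<bar>" and ?v = "h ^ CARD('n)"
  define \<Phi> where "\<Phi> = clamp_time T \<phi>"
  interpret weakly_C11 T l ?L \<Phi> unfolding \<Phi>_def by (rule weakly_C11_clamp_time[OF T l_pos \<phi>])
  have \<Phi>_eq: "\<Phi> (t, x) = \<phi> (t, x)" if "0 \<le> t" "t \<le> T" for t x
    unfolding \<Phi>_def by (rule clamp_time_eq[OF that])
  have c\<Phi>: "continuous_on UNIV (\<lambda>x. \<Phi> (t, x))" "continuous_on UNIV (\<lambda>x. \<Phi> (t, x + y))" for t y
    by (intro continuous_on_compose2[OF cont] continuous_intros; simp)+
  define s where "s = h powr (1 / 3)"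
  have s: "0 < s" "s \<le> 1" "s ^ 3 = h" "s ^ 4 = h powr (4 / 3)"
    using h_pos h powr_mono_both[of 0 "1/3" h 1] by (auto simp: s_def cube_root_powr powr_le1)
  have dts: "dt \<le> C2 * s ^ 4" using dt(3) s(4) by simp
  have C2: "0 \<le> C2"
    using dt(1) dts s(1) zero_less_mult_pos2[of C2 "s ^ 4"] by fastforce
  have dth: "dt / h \<le> C2"
  proof -
    have "dt \<le> C2 * (s * h)" using dts unfolding s(3)[symmetric] by (simp add: power_numeral_reduce)
    also have "\<dots> \<le> C2 * (1 * h)" using C2 s h_pos by (intro mult_left_mono mult_right_mono) auto
    finally show ?thesis using h_pos by (simp add: pos_divide_le_eq)
  qed
  define M where "M = nat \<lfloor>\<tau> / dt\<rfloor>"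
  have M: "real M * dt \<le> \<tau>" "\<tau> < real (Suc M) * dt"
    unfolding M_def using nat_floor_bounds[of \<tau> dt] \<tau> dt by auto
  \<comment> \<open>Strict because \<open>\<tau> < T\<close>; so the step containing
    \<open>\<tau>\<close> ends no later than \<open>T\<close>.\<close>
  have MN: "M < N"
  proof -
    have "real M * dt < real N * dt" using M \<tau> dt by linarith
    then show ?thesis using dt(1) by simp
  qed
  have step: "real n * dt \<le> real n' * dt" if "n \<le> n'" for n n'
    using that dt(1) by (intro mult_right_mono) auto
  have SucN: "real (Suc n) * dt \<le> T" if "n \<le> M" for n
    using step[of "Suc n" N] that MN dt(2) by simp
  have nM: "real n * dt \<le> \<tau>" if "n \<le> M" for n using step[OF that] M by linarith
  have n0: "0 \<le> real n * dt" for n using dt(1) by simp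
  define U where "U = (\<lambda>n k. u (real n * dt) (cell_center h k))"
  define F where "F = (\<lambda>n k i. grp_flux_new C1 h dt (u (real n * dt)) (k, i))"
  have Q: "u (real n * dt) \<in> Qh l h" if "n \<le> N" for n
    using sol step[OF that] n0 unfolding stabilized_grp_solution_def by auto
  have Uper: "lperiodic (U n)" if "n \<le> M" for n
    unfolding U_def using that MN by (intro lperiodic_cell_values Q) auto
  have UR: "\<bar>U n k\<bar> \<le> R" if "n \<le> M" for n k
    unfolding U_def using nM[OF that] n0 \<tau> by (intro R) auto
  have R0: "0 \<le> R" using UR[of 0 0] by simp
  have u_const: "u t = u (real n * dt)" if "n \<le> M" "real n * dt \<le> t" "t < real (Suc n) * dt" for n t
    using sol that MN unfolding stabilized_grp_solution_def by (auto simp del: of_nat_Suc)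
  have u_cell: "u t x = U n k" if "n \<le> M" "real n * dt \<le> t" "t < real (Suc n) * dt" "k \<in> cells" "x \<in> cell h k" for n t k x
    using Q[of n] that MN unfolding u_const[OF that(1-3)] U_def by (auto simp: Qh_def)
  have F: "\<bar>F n k i - (U n k)\<^sup>2 / 2\<bar> \<le> A * near_jumps (U n) k i"
    "F n k i * (U n (k + axis i 1) - U n k) - ((U n (k + axis i 1)) ^ 3 - (U n k) ^ 3) / 6
      \<le> - C1 * face_jump (U n) k i ^ 3 + R\<^sup>2 / 2 * (dt / s ^ 3) * (near_jumps (U n) k i * face_jump (U n) k i)"
    if "n < M" for n k i
    unfolding F_def U_def A_def s(3)
    using that MN dt(1) dth C1 UR[of n] by (intro grp_flux_bounds[OF h_pos Q]; simp add: U_def)+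
  have scheme: "s ^ 3 * (\<Sum>k\<in>cells. P k * ((U (Suc n) k - U n k) / dt))
      = face_sum (\<lambda>k i. F n k i * (P (k + axis i 1) - P k))" if "n < M" "lperiodic P" for n P
    unfolding s(3) U_def F_def using that MN dt(1) by (intro scheme_on_cells[OF sol]) auto
  have "C1 / 2 * (\<Sum>n<M. dt * face_sum (\<lambda>k i. face_jump (U n) k i ^ 3))
      \<le> s ^ 3 * real (card cells) * (R\<^sup>2 / 2 + real M * dt * (K * d / (C1 / (2 * (K + 1)))\<^sup>2))"
    unfolding d_def
    by (rule sum_cubed_jumps_le[where U = U and F = F and M = M and A = A and B = "R\<^sup>2 / 2",
          OF Uper UR s(1) dt(1) dts C1(1) C2 F(1) F(2) _ scheme])
       (auto simp: K_def d_def)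
  also have "\<dots> \<le> s ^ 3 * real (card cells) * (R\<^sup>2 / 2 + T * (K * d / (C1 / (2 * (K + 1)))\<^sup>2))"
  proof (intro mult_left_mono add_left_mono mult_right_mono)
    show "real M * dt \<le> T" using M \<tau> by linarith
    have "0 \<le> K" unfolding K_def d_def using C2 by (intro mult_nonneg_nonneg add_nonneg_nonneg) auto
    then show "0 \<le> K * d / (C1 / (2 * (K + 1)))\<^sup>2" by (simp add: d_def)
  qed (use s in auto)
  finally have cubed: "(\<Sum>n<M. dt * face_sum (\<lambda>k i. face_jump (U n) k i ^ 3)) \<le> s ^ 3 * real (card cells) * Z T"
    using C1 by (simp add: Z_def field_simps)
  define a where "a = (\<lambda>n k. integral (closed_cell h k) (\<lambda>x. \<Phi> (real n * dt, x)))"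
  define a' where "a' = (\<lambda>k. integral (closed_cell h k) (\<lambda>x. \<Phi> (\<tau>, x)))"
  define B where "B = (\<lambda>n (k :: int ^ 'n). box (real n * dt, cell_lo h k) (min (real (Suc n) * dt) \<tau>, cell_hi h k))"
  define gt where "gt = (\<lambda>n k. integral\<^sup>L lebesgue (\<lambda>z. indicator (B n k) z * weak_dt T l \<phi> z))"
  define gx where "gx = (\<lambda>n k i. integral\<^sup>L lebesgue (\<lambda>z. indicator (B n k) z * weak_dx T l i \<phi> z))"
  have a_per: "lperiodic (a n)" for n
    unfolding lperiodic_def
  proof (intro allI)
    fix k i
    have "h * of_int (m $ i) = l $ i" by (simp add: l_eq mult.commute)
    then show "a n (k + axis i (m $ i)) = a n k"
      using per unfolding a_def integral_cell_shift by (simp add: periodic_def)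
  qed
  have a_space: "\<bar>a (Suc n) (k + axis i 1) - a (Suc n) k\<bar> \<le> ?L * s ^ 3 * ?v"
    if "n < M" "k \<in> cells" for n k i
  proof -
    let ?t = "real (Suc n) * dt"
    have "a (Suc n) (k + axis i 1) - a (Suc n) k =
        integral (closed_cell h k) (\<lambda>x. \<Phi> (?t, x + axis i h) - \<Phi> (?t, x))"
      unfolding a_def integral_cell_shift by (simp add: integral_diff_continuous c\<Phi> del: of_nat_Suc)
    moreover have "\<bar>\<dots>\<bar> \<le> (?L * h) * measure lborel (closed_cell h k)"
    proof (rule abs_integral_cbox_le)
      fix x assume "x \<in> open_cell h k"
      then have x: "x \<in> cbox 0 l" by (rule cell_box_subset_torus) (rule that)
      have e: "h *\<^sub>R (0, axis i 1) = ((0, axis i h) :: real \<times> (real ^ 'n))" by (simp add: vec_eq_iff axis_def)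
      have "\<bar>\<Phi> ((?t, x) + h *\<^sub>R (0, axis i 1)) - \<Phi> (?t, x)\<bar> \<le> ?L * h"
        by (rule first_difference)
           (use h_pos h_le_l T SucN[of n] n0[of "Suc n"] that x in \<open>auto simp: Basis_prod_def Basis_vec_def simp del: of_nat_Suc\<close>)
      then show "\<bar>\<Phi> (?t, x + axis i h) - \<Phi> (?t, x)\<bar> \<le> ?L * h" unfolding e by simp
    qed (intro continuous_intros c\<Phi>)
    ultimately show ?thesis by (simp add: measure_cell h_pos s(3))
  qed
  have a_time: "\<bar>a' k - a M k\<bar> \<le> ?L * dt * ?v" if "k \<in> cells" for k
  proof -
    let ?r = "\<tau> - real M * dt"
    have "a' k - a M k = integral (closed_cell h k) (\<lambda>x. \<Phi> (\<tau>, x) - \<Phi> (real M * dt, x))"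
      unfolding a_def a'_def by (simp add: integral_diff_continuous c\<Phi>)
    moreover have "\<bar>\<dots>\<bar> \<le> (?L * dt) * measure lborel (closed_cell h k)"
    proof (rule abs_integral_cbox_le)
      fix x assume "x \<in> open_cell h k"
      then have x: "x \<in> cbox 0 l" by (rule cell_box_subset_torus) (rule that)
      have "\<bar>\<Phi> ((real M * dt, x) + ?r *\<^sub>R (1, 0)) - \<Phi> (real M * dt, x)\<bar> \<le> ?L * ?r"
        by (rule first_difference) (use M \<tau> n0[of M] x in \<open>auto simp: Basis_prod_def image_iff\<close>)
      also have "\<dots> \<le> ?L * dt" using M by (intro mult_left_mono) (auto simp: algebra_simps)
      finally show "\<bar>\<Phi> (\<tau>, x) - \<Phi> (real M * dt, x)\<bar> \<le> ?L * dt" by simp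
    qed (intro continuous_intros c\<Phi>)
    ultimately show ?thesis by (simp add: measure_cell h_pos)
  qed
  have B_sub: "box (real n * dt, cell_lo h k) (min (real (Suc n) * dt) \<tau>, cell_hi h k) \<subseteq> {0<..<T} \<times> cbox 0 l"
    if "k \<in> cells" for n k
    using \<tau> cell_box_subset_torus[OF _ that] n0[of n] by (auto simp: mem_box_Pair simp del: of_nat_Suc)
  note \<alpha> = first_order_multi_indices
  have B_eq: "B n k = box (real n * dt, cell_lo h k) (real (Suc n) * dt, cell_hi h k)" if "n < M" for n k
    using nM[of "Suc n"] that by (simp add: B_def min_absorb1 del: of_nat_Suc)
  have gt_eq: "gt n k = integral\<^sup>L (spacetime T l) (\<lambda>z. weak_dt T l \<phi> z * indicator (B n k) z)"
    and gx_eq: "gx n k i = integral\<^sup>L (spacetime T l) (\<lambda>z. weak_dx T l i \<phi> z * indicator (B n k) z)"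
    if "k \<in> cells" for n k i
    using weak_deriv_indicator_box(2)[OF \<phi>(1) \<alpha>(1) B_sub[OF that]]
      weak_deriv_indicator_box(2)[OF \<phi>(1) \<alpha>(2) B_sub[OF that]]
    unfolding gt_def gx_def B_def by simp_all
  have len: "real (Suc n) * dt - real n * dt = dt" for n by (simp add: algebra_simps)
  have lt: "real n * dt < real (Suc n) * dt" for n
    using len[of n] dt(1) by linarith
  have gt_le: "\<bar>gt n k - (a (Suc n) k - a n k)\<bar> \<le> 2 * ?L * dt * dt * ?v" if "n < M" "k \<in> cells" for n k
  proof -
    \<comment> \<open>\<open>weak_dt_box\<close> needs one further step of room. For
      \<open>n < M\<close> the level \<open>n + 2\<close> is at most \<open>M + 1\<close>, hence at
      most \<open>N\<close>.\<close>
    have "real (Suc n) * dt + (real (Suc n) * dt - real n * dt) = real (Suc (Suc n)) * dt"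
      by (simp add: algebra_simps)
    also have "\<dots> \<le> T" using SucN[of "Suc n"] that by simp
    finally show ?thesis
      using weak_dt_box[OF T l_pos \<phi> n0 lt _ cell_bounds(1)[OF that(2)] cell_lo_less_hi[OF h_pos]
          cell_bounds(2)[OF that(2)], of n]
      unfolding gt_eq[OF that(2)] B_eq[OF that(1)] a_def \<Phi>_def len measure_cell[OF h_pos]
      by (simp del: of_nat_Suc)
  qed
  have gx_le: "\<bar>gx n k i - dt / s ^ 3 * (a (Suc n) (k + axis i 1) - a (Suc n) k)\<bar> \<le> ?L * (s ^ 3 + dt) * dt * ?v"
    if "n < M" "k \<in> cells" for n k i
    using weak_dx_box[OF T l_pos \<phi> n0 lt SucN h_pos h_le_l cell_bounds(1)[OF that(2)]
        cell_lo_less_hi[OF h_pos] cell_bounds(2)[OF that(2)], of n i] that(1)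
    unfolding gx_eq[OF that(2)] B_eq[OF that(1)] a_def \<Phi>_def len measure_cell[OF h_pos] integral_cell_shift s(3)
    by simp
  have last: "\<bar>gt M k\<bar> \<le> ?L * dt * ?v" "\<bar>gx M k i\<bar> \<le> ?L * dt * ?v" if "k \<in> cells" for k i
  proof -
    have "measure lborel (cbox (real M * dt, cell_lo h k) (min (real (Suc M) * dt) \<tau>, cell_hi h k)) \<le> dt * ?v"
    proof -
      have "real M * dt \<le> min (real (Suc M) * dt) \<tau>" using M(1) step[of M "Suc M"] by simp
      moreover have "min (real (Suc M) * dt) \<tau> - real M * dt \<le> dt" using len[of M] by linarith
      ultimately show ?thesis
        using h_pos by (simp only: content_time_box measure_cell) (simp add: mult_right_mono)
    qed
    then have "?L * measure lborel (cbox (real M * dt, cell_lo h k) (min (real (Suc M) * dt) \<tau>, cell_hi h k)) \<le> ?L * dt * ?v"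
      by (simp add: mult.assoc mult_left_mono)
    then show "\<bar>gt M k\<bar> \<le> ?L * dt * ?v" "\<bar>gx M k i\<bar> \<le> ?L * dt * ?v"
      using weak_deriv_indicator_box(3)[OF \<phi>(1) \<alpha>(1) B_sub[OF that], of M]
        weak_deriv_indicator_box(3)[OF \<phi>(1) \<alpha>(2)[of i] B_sub[OF that], of M]
      unfolding gt_def gx_def B_def by linarith+
  qed
  have I\<tau>: "integral\<^sup>L (lebesgue_on (cbox 0 l)) (\<lambda>x. u \<tau> x * \<phi> (\<tau>, x)) = (\<Sum>k\<in>cells. U M k * a' k)"
    unfolding a'_def
  proof (rule integral_torus_cells[OF c\<Phi>(1)])
    show "u \<tau> x * \<phi> (\<tau>, x) = U M k * \<Phi> (\<tau>, x)" if "k \<in> cells" "x \<in> cell h k" for k x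
      using u_cell[of M \<tau> k x] that M \<tau> \<Phi>_eq[of \<tau>] by simp
  qed
  have I0: "integral\<^sup>L (lebesgue_on (cbox 0 l)) (\<lambda>x. u 0 x * \<phi> (0, x)) = (\<Sum>k\<in>cells. U 0 k * a 0 k)"
    unfolding a_def
  proof (rule integral_torus_cells[OF c\<Phi>(1)])
    show "u 0 x * \<phi> (0, x) = U 0 k * \<Phi> (real 0 * dt, x)" if "k \<in> cells" "x \<in> cell h k" for k x
      using u_cell[of 0 0 k x] that dt(1) T \<Phi>_eq[of 0] by simp
  qed
  have RHS: "integral\<^sup>L (lebesgue_on ({0..\<tau>} \<times> cbox 0 l))
      (\<lambda>(t, x). u t x * weak_dt T l \<phi> (t, x) + burgers (u t x) * (\<Sum>i\<in>UNIV. weak_dx T l i \<phi> (t, x)))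
    = (\<Sum>n\<le>M. \<Sum>k\<in>cells. U n k * gt n k + (U n k)\<^sup>2 / 2 * (\<Sum>i\<in>UNIV. gx n k i))"
    unfolding gt_def gx_def B_def
    by (rule weak_formulation_cells[OF \<phi>(1) _ \<tau>(2) dt(1) M_def u_cell]) (use \<tau> in auto)
  have "0 \<le> A" unfolding A_def using R0 C2 by simp
  moreover have "real M * dt \<le> T" using M \<tau> by linarith
  ultimately have "\<bar>(\<Sum>k\<in>cells. U M k * a' k) - (\<Sum>k\<in>cells. U 0 k * a 0 k)
      - (\<Sum>n\<le>M. \<Sum>k\<in>cells. U n k * gt n k + (U n k)\<^sup>2 / 2 * (\<Sum>i\<in>UNIV. gx n k i))\<bar>
    \<le> ?L * (?v * real (card cells)) * (2 * R * C2 + real CARD('n) * R\<^sup>2 / 2 * C2 + 2 * R * C2 * T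
        + real CARD('n) * R\<^sup>2 / 2 * (1 + C2) * T + 2 * real CARD('n) * A * (Z T + T * real CARD('n))) * s"
    using h_pos
    by (intro consistency_error_le[OF Uper UR s(1,2) dt(1) dts _ _ _ _ F(1) scheme cubed a_per
          a_space a_time gt_le gx_le last]) auto
  then show ?thesis
    unfolding I\<tau> I0 RHS area_eq s_def[symmetric] d_def .
qed

end

text \<open>Membership in \<open>Winf\<close> determines \<open>\<phi>\<close> only up to null sets.
  The continuity premise picks the representative whose time slices at 0 and \<open>\<tau>\<close>
  are meant on the left-hand side.\<close>

theorem lemma4p2:
  fixes l :: "real ^ 'n" and C1 C2 ubar :: real
  assumes "CARD('n) = 2 \<or> CARD('n) = 3"
    and "\<forall>i. 0 < l $ i"
    and "0 < C1" and "C1 \<le> 1 / 24"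
  shows "\<exists>Cu :: real \<Rightarrow> real \<Rightarrow> real.
    \<forall>(T::real) (N::nat) (dt::real) (h::real) (u0 :: real ^ 'n \<Rightarrow> real)
      (u :: real \<Rightarrow> real ^ 'n \<Rightarrow> real) (\<phi> :: real \<times> (real ^ 'n) \<Rightarrow> real) (\<tau>::real).
      0 < T \<and> 0 < N \<and> dt = T / real N \<and> dt \<le> 1 \<and>
      uniform_mesh l h \<and> h \<le> 1 \<and> dt \<le> C2 * h powr (4 / 3) \<and>
      periodic l u0 \<and> u0 \<in> Linf (lebesgue_on (cbox 0 l)) \<and>
      stabilized_grp_solution l C1 h dt N u0 u \<and>
      (\<forall>t \<in> {0..<T}. \<forall>x. \<bar>u t x\<bar> \<le> ubar) \<and>
      0 < \<tau> \<and> \<tau> < T \<and>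
      \<phi> \<in> Winf 2 T l \<and> continuous_on ({0..T} \<times> UNIV) \<phi>
      \<longrightarrow>
      (\<exists>e_u :: real.
         integral\<^sup>L (lebesgue_on (cbox 0 l)) (\<lambda>x. u \<tau> x * \<phi> (\<tau>, x))
           - integral\<^sup>L (lebesgue_on (cbox 0 l)) (\<lambda>x. u 0 x * \<phi> (0, x))
         = integral\<^sup>L (lebesgue_on ({0..\<tau>} \<times> cbox 0 l))
             (\<lambda>(t, x). u t x * weak_dt T l \<phi> (t, x)
                + burgers (u t x) * (\<Sum>i \<in> UNIV. weak_dx T l i \<phi> (t, x)))
           + e_u
         \<and> \<bar>e_u\<bar> \<le> Cu T (Winf_norm 2 T l \<phi>) * h powr (1 / 3))"
proof -
  define d A K where "d = real CARD('n)" and "A = 2 * ubar + ubar\<^sup>2 / 2 * C2"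
    and "K = C2 * (ubar\<^sup>2 / 2 * ((4 * d\<^sup>2 + 1) / 2) + 8 * d ^ 3 * (A + ubar)\<^sup>2)"
  define Z where "Z = (\<lambda>T. 2 / C1 * (ubar\<^sup>2 / 2 + T * (K * d / (C1 / (2 * (K + 1)))\<^sup>2)))"
  \<comment> \<open>Fixed before mesh, time step, solution and \<open>\<phi>\<close> are chosen. The
    absolute value avoids an argument about the sign of \<open>Winf_norm\<close>.\<close>
  define Cu where "Cu = (\<lambda>T L :: real. \<bar>L\<bar> * integral\<^sup>L (lebesgue_on (cbox 0 l)) (\<lambda>_. 1 :: real)
        * (2 * ubar * C2 + d * ubar\<^sup>2 / 2 * C2 + 2 * ubar * C2 * T + d * ubar\<^sup>2 / 2 * (1 + C2) * T
            + 2 * d * A * (Z T + T * d)))"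
  show ?thesis
  proof (intro exI[of _ Cu] allI impI, elim conjE)
    fix T :: real and N :: nat and dt h :: real and u0 :: "real ^ 'n \<Rightarrow> real"
      and u :: "real \<Rightarrow> real ^ 'n \<Rightarrow> real" and \<phi> :: "real \<times> (real ^ 'n) \<Rightarrow> real" and \<tau> :: real
    assume T: "0 < T" and N: "0 < N" "dt = T / real N" and mesh: "uniform_mesh l h" and h: "h \<le> 1"
      and dt: "dt \<le> C2 * h powr (4 / 3)" and sol: "stabilized_grp_solution l C1 h dt N u0 u"
      and R: "\<forall>t \<in> {0..<T}. \<forall>x. \<bar>u t x\<bar> \<le> ubar" and \<tau>: "0 < \<tau>" "\<tau> < T"
      and \<phi>: "\<phi> \<in> Winf 2 T l" "continuous_on ({0..T} \<times> UNIV) \<phi>"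
    obtain m :: "int ^ 'n" where "torus_grid m l h" using uniform_meshE[OF mesh] .
    then interpret torus_grid m l h .
    let ?L = "integral\<^sup>L (lebesgue_on (cbox 0 l)) (\<lambda>x. u \<tau> x * \<phi> (\<tau>, x))
           - integral\<^sup>L (lebesgue_on (cbox 0 l)) (\<lambda>x. u 0 x * \<phi> (0, x))"
      and ?R = "integral\<^sup>L (lebesgue_on ({0..\<tau>} \<times> cbox 0 l))
             (\<lambda>(t, x). u t x * weak_dt T l \<phi> (t, x)
                + burgers (u t x) * (\<Sum>i \<in> UNIV. weak_dx T l i \<phi> (t, x)))"
    have "\<bar>?L - ?R\<bar> \<le> Cu T (Winf_norm 2 T l \<phi>) * h powr (1 / 3)"
      unfolding Cu_def Z_def K_def A_def d_def
      by (rule consistency[OF assms(3,4) T _ _ dt h sol _ \<tau> \<phi>]) (use T N R in auto)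
    then show "\<exists>e_u. ?L = ?R + e_u \<and> \<bar>e_u\<bar> \<le> Cu T (Winf_norm 2 T l \<phi>) * h powr (1 / 3)"
      by (intro exI[of _ "?L - ?R"]) simp
  qed
qed

end
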